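(* Let $I$ be an index set, and regard the row and column Hilbert operator spaces $\ell^2_r(I)$ and $\ell^2_c(I)$ as algebras (and left modules over themselves) under pointwise multiplication. Then $$(\ell^2_r(I))^h=(\ell^2_r(I))^*\quad\text{and}\quad(\ell^2_c(I))^h=(\ell^2_c(I))^*.$$
   Context: $\ell^2_r(I)$ and $\ell^2_c(I)$ denote $\ell^2(I)$ with its row and column operator space structures, respectively. It is known that both are operator algebras under pointwise multiplication. For a completely contractive Banach algebra $A$ and a left operator $A$-module $X$, $A\otimes^h_A X:=(A\otimes^h X)/N_X$, where $\otimes^h$ is the Haagerup tensor product and $N_X$ is the closed linear span in $A\otimes^h X$ of $\{ab\otimes x-a\otimes b\cdot x:a,b\in A,\ x\in X\}$; the Haagerup dual is $X^h:=(A\otimes^h_A X)^*$ with the dual operator space structure. Here $A=X=\ell^2_r(I)$, respectively $A=X=\ell^2_c(I)$, with the pointwise product. An equality of operator spaces means completely isometric isomorphism. *)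

theory Defs
  imports "HOL-Analysis.Analysis"
begin

section \<open>Matrix normed complex vector spaces\<close>

text \<open>
  A complex vector space on an explicit carrier together with a norm on each \<open>M\<^sub>n(V)\<close>.
  An element of \<open>M\<^sub>n(V)\<close> is a function \<^typ>\<open>nat \<Rightarrow> nat \<Rightarrow> 'v\<close> of which only the entries with
  indices below \<open>n\<close> are relevant.  Ruan's axioms are not part of the record: they are properties
  of the spaces constructed below.
\<close>

record 'v opspace =
  carr  :: "'v set"
  vzero :: 'v
  vadd  :: "'v \<Rightarrow> 'v \<Rightarrow> 'v"
  vscale :: "complex \<Rightarrow> 'v \<Rightarrow> 'v"
  mnorm :: "nat \<Rightarrow> (nat \<Rightarrow> nat \<Rightarrow> 'v) \<Rightarrow> real"

definition vsub :: "'v opspace \<Rightarrow> 'v \<Rightarrow> 'v \<Rightarrow> 'v" where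
  "vsub V v w = vadd V v (vscale V (-1) w)"

definition vnorm :: "'v opspace \<Rightarrow> 'v \<Rightarrow> real" where
  "vnorm V v = mnorm V 1 (\<lambda>_ _. v)"

definition mats :: "'v opspace \<Rightarrow> nat \<Rightarrow> nat \<Rightarrow> (nat \<Rightarrow> nat \<Rightarrow> 'v) set" where
  "mats V m n = {v. \<forall>i<m. \<forall>j<n. v i j \<in> carr V}"

text \<open>Rectangular matrices are normed by padding them with zeros to a square matrix.\<close>

definition rnorm :: "'v opspace \<Rightarrow> nat \<Rightarrow> nat \<Rightarrow> (nat \<Rightarrow> nat \<Rightarrow> 'v) \<Rightarrow> real" where
  "rnorm V m n v = mnorm V (max m n) (\<lambda>i j. if i < m \<and> j < n then v i j else vzero V)"

definition linear_map :: "'v opspace \<Rightarrow> 'w opspace \<Rightarrow> ('v \<Rightarrow> 'w) \<Rightarrow> bool" where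
  "linear_map V W f \<longleftrightarrow>
     (\<forall>v\<in>carr V. f v \<in> carr W) \<and>
     (\<forall>v\<in>carr V. \<forall>w\<in>carr V. f (vadd V v w) = vadd W (f v) (f w)) \<and>
     (\<forall>c. \<forall>v\<in>carr V. f (vscale V c v) = vscale W c (f v))"

definition completely_isometric_iso :: "'v opspace \<Rightarrow> 'w opspace \<Rightarrow> ('v \<Rightarrow> 'w) \<Rightarrow> bool" where
  "completely_isometric_iso V W f \<longleftrightarrow>
     linear_map V W f \<and> bij_betw f (carr V) (carr W) \<and>
     (\<forall>n\<ge>1. \<forall>v\<in>mats V n n. mnorm W n (\<lambda>i j. f (v i j)) = mnorm V n v)"

definition completely_isometrically_isomorphic :: "'v opspace \<Rightarrow> 'w opspace \<Rightarrow> bool"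
    (infix "\<cong>\<^sub>c\<^sub>i" 50) where
  "V \<cong>\<^sub>c\<^sub>i W \<longleftrightarrow> (\<exists>f. completely_isometric_iso V W f)"


section \<open>The row and column operator spaces of \<open>\<ell>\<^sup>2(I)\<close>\<close>

definition ell2 :: "'i set \<Rightarrow> ('i \<Rightarrow> complex) set" where
  "ell2 I = {x. (\<forall>i. i \<notin> I \<longrightarrow> x i = 0) \<and> (\<lambda>i. (cmod (x i))\<^sup>2) summable_on I}"

definition ell2_norm :: "'i set \<Rightarrow> ('i \<Rightarrow> complex) \<Rightarrow> real" where
  "ell2_norm I x = sqrt (\<Sum>\<^sub>\<infinity>i\<in>I. (cmod (x i))\<^sup>2)"

text \<open>Norm of the scalar matrix \<open>T\<close> as an operator from \<open>\<ell>\<^sup>2(C)\<close> to \<open>\<ell>\<^sup>2(R)\<close>.\<close>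

definition matrix_opnorm :: "'r set \<Rightarrow> 'c set \<Rightarrow> ('r \<Rightarrow> 'c \<Rightarrow> complex) \<Rightarrow> real" where
  "matrix_opnorm R C T =
     Sup {ell2_norm R (\<lambda>r. \<Sum>\<^sub>\<infinity>c\<in>C. T r c * z c) | z. z \<in> ell2 C \<and> ell2_norm C z \<le> 1}"

text \<open>
  The column structure identifies \<open>\<ell>\<^sup>2(I)\<close> with \<open>B(\<complex>, \<ell>\<^sup>2(I))\<close>, hence \<open>M\<^sub>n(\<ell>\<^sup>2\<^sub>c(I))\<close> with the
  operators from \<open>\<complex>\<^sup>n\<close> to \<open>\<ell>\<^sup>2(I)\<^sup>n = \<ell>\<^sup>2({..<n} \<times> I)\<close>.  The row structure identifies \<open>x\<close> with
  the functional \<open>\<eta> \<mapsto> \<Sum>\<^sub>k x\<^sub>k \<eta>\<^sub>k\<close> in \<open>B(\<ell>\<^sup>2(I), \<complex>)\<close>, hence \<open>M\<^sub>n(\<ell>\<^sup>2\<^sub>r(I))\<close> with the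
  operators from \<open>\<ell>\<^sup>2(I)\<^sup>n\<close> to \<open>\<complex>\<^sup>n\<close>.
\<close>

definition column_ell2 :: "'i set \<Rightarrow> ('i \<Rightarrow> complex) opspace" where
  "column_ell2 I = \<lparr>
     carr = ell2 I,
     vzero = (\<lambda>_. 0),
     vadd = (\<lambda>x y i. x i + y i),
     vscale = (\<lambda>c x i. c * x i),
     mnorm = (\<lambda>n x. matrix_opnorm ({..<n} \<times> I) {..<n} (\<lambda>(i, k) j. x i j k)) \<rparr>"

definition row_ell2 :: "'i set \<Rightarrow> ('i \<Rightarrow> complex) opspace" where
  "row_ell2 I = \<lparr>
     carr = ell2 I,
     vzero = (\<lambda>_. 0),
     vadd = (\<lambda>x y i. x i + y i),
     vscale = (\<lambda>c x i. c * x i),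
     mnorm = (\<lambda>n x. matrix_opnorm {..<n} ({..<n} \<times> I) (\<lambda>i (j, k). x i j k)) \<rparr>"

definition pointwise_mult :: "('i \<Rightarrow> complex) \<Rightarrow> ('i \<Rightarrow> complex) \<Rightarrow> ('i \<Rightarrow> complex)" where
  "pointwise_mult x y = (\<lambda>i. x i * y i)"


section \<open>Dual operator spaces\<close>

definition bounded_functional :: "'v opspace \<Rightarrow> ('v \<Rightarrow> complex) \<Rightarrow> bool" where
  "bounded_functional V f \<longleftrightarrow>
     (\<forall>v\<in>carr V. \<forall>w\<in>carr V. f (vadd V v w) = f v + f w) \<and>
     (\<forall>c. \<forall>v\<in>carr V. f (vscale V c v) = c * f v) \<and>
     (\<exists>K. \<forall>v\<in>carr V. cmod (f v) \<le> K * vnorm V v)"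

text \<open>
  The norm on \<open>M\<^sub>n(V\<^sup>*)\<close> is the completely bounded norm of \<open>CB(V, M\<^sub>n)\<close>.  Functionals are
  extended by zero outside the carrier, so that each is represented by exactly one function.
\<close>

definition os_dual :: "'v opspace \<Rightarrow> ('v \<Rightarrow> complex) opspace" where
  "os_dual V = \<lparr>
     carr = {f. bounded_functional V f \<and> (\<forall>v. v \<notin> carr V \<longrightarrow> f v = 0)},
     vzero = (\<lambda>_. 0),
     vadd = (\<lambda>f g v. f v + g v),
     vscale = (\<lambda>c f v. c * f v),
     mnorm = (\<lambda>n f. Sup {matrix_opnorm ({..<n} \<times> {..<m}) ({..<n} \<times> {..<m})
                           (\<lambda>(i, k) (j, l). f i j (v k l)) | m v.
                         v \<in> mats V m m \<and> mnorm V m v \<le> 1}) \<rparr>"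


section \<open>Quotients and closed linear spans\<close>

definition closed_subspace :: "'v opspace \<Rightarrow> 'v set \<Rightarrow> bool" where
  "closed_subspace V W \<longleftrightarrow>
     W \<subseteq> carr V \<and> vzero V \<in> W \<and>
     (\<forall>v\<in>W. \<forall>w\<in>W. vadd V v w \<in> W) \<and>
     (\<forall>c. \<forall>v\<in>W. vscale V c v \<in> W) \<and>
     (\<forall>v\<in>carr V. (\<forall>e>0. \<exists>w\<in>W. vnorm V (vsub V v w) < e) \<longrightarrow> v \<in> W)"

definition closed_span :: "'v opspace \<Rightarrow> 'v set \<Rightarrow> 'v set" where
  "closed_span V S = closed_subspace V hull S"

definition os_coset :: "'v opspace \<Rightarrow> 'v set \<Rightarrow> 'v \<Rightarrow> 'v set" where
  "os_coset V N v = (\<lambda>w. vadd V v w) ` N"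

text \<open>The scalar multiple adds \<open>N\<close> so that it is again a coset when \<open>c = 0\<close>.\<close>

definition os_quotient :: "'v opspace \<Rightarrow> 'v set \<Rightarrow> 'v set opspace" where
  "os_quotient V N = \<lparr>
     carr = os_coset V N ` carr V,
     vzero = N,
     vadd = (\<lambda>P Q. {vadd V p q | p q. p \<in> P \<and> q \<in> Q}),
     vscale = (\<lambda>c P. {vadd V (vscale V c p) w | p w. p \<in> P \<and> w \<in> N}),
     mnorm = (\<lambda>n P. Inf {mnorm V n v | v. v \<in> mats V n n \<and> (\<forall>i<n. \<forall>j<n. v i j \<in> P i j)}) \<rparr>"


section \<open>Completion\<close>

definition cauchy_seqs :: "'v opspace \<Rightarrow> (nat \<Rightarrow> 'v) set" where
  "cauchy_seqs V = {s. (\<forall>k. s k \<in> carr V) \<and>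
     (\<forall>e>0. \<exists>M. \<forall>k\<ge>M. \<forall>l\<ge>M. vnorm V (vsub V (s k) (s l)) < e)}"

definition cauchy_rel :: "'v opspace \<Rightarrow> ((nat \<Rightarrow> 'v) \<times> (nat \<Rightarrow> 'v)) set" where
  "cauchy_rel V = {(s, t). s \<in> cauchy_seqs V \<and> t \<in> cauchy_seqs V \<and>
     (\<lambda>k. vnorm V (vsub V (s k) (t k))) \<longlonglongrightarrow> 0}"

definition cauchy_class :: "'v opspace \<Rightarrow> (nat \<Rightarrow> 'v) \<Rightarrow> (nat \<Rightarrow> 'v) set" where
  "cauchy_class V s = cauchy_rel V `` {s}"

definition cauchy_rep :: "(nat \<Rightarrow> 'v) set \<Rightarrow> nat \<Rightarrow> 'v" where
  "cauchy_rep P = (SOME s. s \<in> P)"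

definition os_completion :: "'v opspace \<Rightarrow> (nat \<Rightarrow> 'v) set opspace" where
  "os_completion V = \<lparr>
     carr = cauchy_seqs V // cauchy_rel V,
     vzero = cauchy_class V (\<lambda>_. vzero V),
     vadd = (\<lambda>P Q. cauchy_class V (\<lambda>k. vadd V (cauchy_rep P k) (cauchy_rep Q k))),
     vscale = (\<lambda>c P. cauchy_class V (\<lambda>k. vscale V c (cauchy_rep P k))),
     mnorm = (\<lambda>n P. lim (\<lambda>k. mnorm V n (\<lambda>i j. cauchy_rep (P i j) k))) \<rparr>"

definition completion_embed :: "'v opspace \<Rightarrow> 'v \<Rightarrow> (nat \<Rightarrow> 'v) set" where
  "completion_embed V v = cauchy_class V (\<lambda>_. v)"


section \<open>The Haagerup tensor product\<close>

text \<open>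
  The algebraic tensor product \<open>V \<otimes> W\<close> is realised inside the linear functionals on the space of
  bilinear forms on \<open>V \<times> W\<close>, with \<open>v \<otimes> w\<close> acting as evaluation at \<open>(v, w)\<close>.
\<close>

type_synonym ('v, 'w) tensor = "('v \<Rightarrow> 'w \<Rightarrow> complex) \<Rightarrow> complex"

definition bilinear_forms :: "'v opspace \<Rightarrow> 'w opspace \<Rightarrow> ('v \<Rightarrow> 'w \<Rightarrow> complex) set" where
  "bilinear_forms V W = {B.
     (\<forall>v\<in>carr V. \<forall>v'\<in>carr V. \<forall>w\<in>carr W. B (vadd V v v') w = B v w + B v' w) \<and>
     (\<forall>v\<in>carr V. \<forall>w\<in>carr W. \<forall>w'\<in>carr W. B v (vadd W w w') = B v w + B v w') \<and>
     (\<forall>c. \<forall>v\<in>carr V. \<forall>w\<in>carr W. B (vscale V c v) w = c * B v w \<and> B v (vscale W c w) = c * B v w)}"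

definition elem_tensor :: "'v opspace \<Rightarrow> 'w opspace \<Rightarrow> 'v \<Rightarrow> 'w \<Rightarrow> ('v, 'w) tensor" where
  "elem_tensor V W v w = (\<lambda>B. if B \<in> bilinear_forms V W then B v w else 0)"

text \<open>
  The Haagerup norm of \<open>u \<in> M\<^sub>n(V \<otimes> W)\<close> is the infimum of \<open>\<parallel>v\<parallel> \<parallel>w\<parallel>\<close> over all factorisations
  \<open>u = v \<odot> w\<close> with \<open>v \<in> M\<^sub>n\<^sub>,\<^sub>p(V)\<close> and \<open>w \<in> M\<^sub>p\<^sub>,\<^sub>n(W)\<close>, where
  \<open>(v \<odot> w)\<^sub>i\<^sub>j = \<Sum>\<^sub>k v\<^sub>i\<^sub>k \<otimes> w\<^sub>k\<^sub>j\<close>.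
\<close>

definition alg_haagerup :: "'v opspace \<Rightarrow> 'w opspace \<Rightarrow> ('v, 'w) tensor opspace" where
  "alg_haagerup V W = \<lparr>
     carr = {u. \<exists>p v w. (\<forall>k<p. v k \<in> carr V \<and> w k \<in> carr W) \<and>
                        u = (\<lambda>B. \<Sum>k<(p::nat). elem_tensor V W (v k) (w k) B)},
     vzero = (\<lambda>_. 0),
     vadd = (\<lambda>s t B. s B + t B),
     vscale = (\<lambda>c t B. c * t B),
     mnorm = (\<lambda>n u. Inf {rnorm V n p v * rnorm W p n w | p v w.
                v \<in> mats V n p \<and> w \<in> mats W p n \<and>
                (\<forall>i<n. \<forall>j<n. u i j = (\<lambda>B. \<Sum>k<p. elem_tensor V W (v i k) (w k j) B))}) \<rparr>"

definition haagerup :: "'v opspace \<Rightarrow> 'w opspace \<Rightarrow> (nat \<Rightarrow> ('v, 'w) tensor) set opspace" where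
  "haagerup V W = os_completion (alg_haagerup V W)"

definition haagerup_tensor :: "'v opspace \<Rightarrow> 'w opspace \<Rightarrow> 'v \<Rightarrow> 'w \<Rightarrow> (nat \<Rightarrow> ('v, 'w) tensor) set" where
  "haagerup_tensor V W v w = completion_embed (alg_haagerup V W) (elem_tensor V W v w)"


section \<open>The module Haagerup tensor product and the Haagerup dual\<close>

text \<open>
  Here \<open>mul\<close> is the product of the algebra \<open>A\<close> and \<open>act\<close> the left action of \<open>A\<close> on \<open>X\<close>.
\<close>

definition balancing_subspace ::
    "'a opspace \<Rightarrow> ('a \<Rightarrow> 'a \<Rightarrow> 'a) \<Rightarrow> 'x opspace \<Rightarrow> ('a \<Rightarrow> 'x \<Rightarrow> 'x) \<Rightarrow> (nat \<Rightarrow> ('a, 'x) tensor) set set"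
  where
  "balancing_subspace A mul X act =
     closed_span (haagerup A X)
       {vsub (haagerup A X) (haagerup_tensor A X (mul a b) x) (haagerup_tensor A X a (act b x)) | a b x.
          a \<in> carr A \<and> b \<in> carr A \<and> x \<in> carr X}"

definition module_haagerup ::
    "'a opspace \<Rightarrow> ('a \<Rightarrow> 'a \<Rightarrow> 'a) \<Rightarrow> 'x opspace \<Rightarrow> ('a \<Rightarrow> 'x \<Rightarrow> 'x) \<Rightarrow>
      (nat \<Rightarrow> ('a, 'x) tensor) set set opspace"
  where
  "module_haagerup A mul X act = os_quotient (haagerup A X) (balancing_subspace A mul X act)"

definition haagerup_dual ::
    "'a opspace \<Rightarrow> ('a \<Rightarrow> 'a \<Rightarrow> 'a) \<Rightarrow> 'x opspace \<Rightarrow> ('a \<Rightarrow> 'x \<Rightarrow> 'x) \<Rightarrow>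
      ((nat \<Rightarrow> ('a, 'x) tensor) set set \<Rightarrow> complex) opspace"
  where
  "haagerup_dual A mul X act = os_dual (module_haagerup A mul X act)"

end

theory Submission
  imports Defs
begin

text \<open>
  Let \<open>A\<close> be the row or the column space and \<open>m : A \<otimes> A \<rightarrow> A\<close> the product map
  \<open>a \<otimes> b \<mapsto> a b\<close>.  It extends to a complete quotient map from the Haagerup tensor product
  onto \<open>A\<close> whose kernel is the balancing subspace.  Hence the module Haagerup tensor
  product is \<open>A\<close> itself, completely isometrically, and the two duals agree.

  Three facts carry this.  First, \<open>m\<close> is completely contractive, because pointwise
  multiplication of matrices over \<open>A\<close> is submultiplicative (\<open>column_norm_mult\<close>).  Second,
  norms are attained: \<open>x\<close> lifts to \<open>\<Sum>\<^sub>k x\<^sub>k e\<^sub>k \<otimes> e\<^sub>k\<close>, and a matrix of such diagonal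
  tensors with finitely many \<open>k\<close> has Haagerup norm at most that of the matrix it lifts
  (\<open>column_norm_diagonal_factorisation\<close>); for infinite supports one passes to the limit in the
  completion (\<open>psi_lift\<close>).  Third, the off-diagonal tensors lie in every closed subspace containing
  the generators, since \<open>e\<^sub>k \<otimes> c = e\<^sub>k e\<^sub>k \<otimes> c - e\<^sub>k \<otimes> e\<^sub>k c\<close> when \<open>c\<^sub>k = 0\<close>; so modulo such a
  subspace, and up to a small error, every tensor \<open>t\<close> is the diagonal tensor with entries
  \<open>m(t)\<close>, whose norm is at most \<open>\<parallel>m(t)\<parallel>\<close>, and the kernel of \<open>m\<close> is contained in the subspace (\<open>balancing_kernel\<close>).

  The row and the column case are treated together.  Transposing matrices and flipping tensors
  interchange the two structures, and the properties of the matrix norms used below, collected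
  in the locale \<open>hilbertian_algebra\<close>, are invariant under this interchange.  They are proved for the
  column space, where all estimates reduce to finite sums.
\<close>

section \<open>Finite sections of scalar matrices\<close>

lemma finite_sums_le_infsum:
  fixes f :: "'a \<Rightarrow> real"
  assumes "f summable_on A" "\<And>x. x \<in> A \<Longrightarrow> 0 \<le> f x" "finite F" "F \<subseteq> A"
  shows "sum f F \<le> infsum f A"
  using assms by (intro finite_sum_le_infsum) auto

lemma ell2_norm_nonneg: "0 \<le> ell2_norm I x"
  unfolding ell2_norm_def by (simp add: infsum_nonneg)

lemma ell2_norm_le:
  assumes "\<And>F. finite F \<Longrightarrow> F \<subseteq> I \<Longrightarrow> (\<Sum>i\<in>F. (cmod (x i))\<^sup>2) \<le> K\<^sup>2" "0 \<le> K"
  shows "(\<lambda>i. (cmod (x i))\<^sup>2) summable_on I" "ell2_norm I x \<le> K"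
proof -
  show s: "(\<lambda>i. (cmod (x i))\<^sup>2) summable_on I"
    by (rule nonneg_bdd_above_summable_on) (auto intro!: bdd_aboveI2 assms(1))
  have "(\<Sum>\<^sub>\<infinity>i\<in>I. (cmod (x i))\<^sup>2) \<le> K\<^sup>2"
    by (rule infsum_le_finite_sums[OF s]) (use assms(1) in auto)
  then show "ell2_norm I x \<le> K"
    unfolding ell2_norm_def using assms(2) real_le_lsqrt real_sqrt_le_iff
    by (metis real_sqrt_abs abs_of_nonneg)
qed

lemma sum_le_ell2_norm_square:
  assumes "(\<lambda>i. (cmod (x i))\<^sup>2) summable_on I" "finite F" "F \<subseteq> I"
  shows "(\<Sum>i\<in>F. (cmod (x i))\<^sup>2) \<le> (ell2_norm I x)\<^sup>2"
  using finite_sums_le_infsum[OF assms(1) _ assms(2,3)]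
  by (simp add: ell2_norm_def infsum_nonneg)

lemma norm_entry_le_ell2_norm:
  assumes "x \<in> ell2 I"
  shows "cmod (x i) \<le> ell2_norm I x"
proof (cases "i \<in> I")
  case True
  then have "(cmod (x i))\<^sup>2 \<le> (ell2_norm I x)\<^sup>2"
    using sum_le_ell2_norm_square[of x I "{i}"] assms by (auto simp: ell2_def)
  then show ?thesis using ell2_norm_nonneg power2_le_imp_le by blast
next
  case False
  then show ?thesis using assms ell2_norm_nonneg by (auto simp: ell2_def)
qed

text \<open>
  A number \<open>K\<close> bounds a matrix exactly when it bounds all finite sections.  Formulated this way,
  estimates of operator norms involve finite sums only.
\<close>

definition section_bound :: "'r set \<Rightarrow> 'c set \<Rightarrow> ('r \<Rightarrow> 'c \<Rightarrow> complex) \<Rightarrow> real \<Rightarrow> bool" where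
  "section_bound R C M K \<longleftrightarrow>
     (\<forall>R' C' z. finite R' \<longrightarrow> R' \<subseteq> R \<longrightarrow> finite C' \<longrightarrow> C' \<subseteq> C \<longrightarrow>
        (\<Sum>r\<in>R'. (cmod (\<Sum>c\<in>C'. M r c * z c))\<^sup>2) \<le> K\<^sup>2 * (\<Sum>c\<in>C'. (cmod (z c))\<^sup>2))"

lemma section_boundD:
  assumes "section_bound R C M K" "finite R'" "R' \<subseteq> R" "finite C'" "C' \<subseteq> C"
  shows "(\<Sum>r\<in>R'. (cmod (\<Sum>c\<in>C'. M r c * z c))\<^sup>2) \<le> K\<^sup>2 * (\<Sum>c\<in>C'. (cmod (z c))\<^sup>2)"
  using assms unfolding section_bound_def by blast

lemma section_bound_row_summable:
  assumes b: "section_bound R C M K" and K: "0 \<le> K" and r: "r \<in> R" and z: "z \<in> ell2 C"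
  shows "(\<lambda>c. M r c * z c) summable_on C"
proof -
  have "(\<Sum>c\<in>C'. cmod (M r c * z c)) \<le> K * ell2_norm C z" if C': "finite C'" "C' \<subseteq> C" for C'
  proof -
    \<comment> \<open>Rotating the entries of \<open>z\<close> turns the section into a sum of absolute values.\<close>
    define w where "w = (\<lambda>c. of_real (cmod (z c)) * cnj (sgn (M r c)))"
    have "M r c * w c = of_real (cmod (M r c * z c))" for c
    proof -
      have "M r c * cnj (sgn (M r c)) = of_real (cmod (M r c))"
        by (cases "M r c = 0")
          (auto simp: sgn_eq complex_norm_square[symmetric] power2_eq_square field_simps)
      then show ?thesis by (simp add: w_def norm_mult mult.left_commute mult.commute)
    qed
    then have "(\<Sum>c\<in>C'. M r c * w c) = of_real (\<Sum>c\<in>C'. cmod (M r c * z c))"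
      by simp
    then have "(\<Sum>c\<in>C'. cmod (M r c * z c))\<^sup>2 = (cmod (\<Sum>c\<in>C'. M r c * w c))\<^sup>2"
      by (simp only: norm_of_real power2_abs)
    also have "\<dots> \<le> K\<^sup>2 * (\<Sum>c\<in>C'. (cmod (w c))\<^sup>2)"
      using section_boundD[OF b, of "{r}" C' w] r C' by simp
    also have "\<dots> \<le> K\<^sup>2 * (\<Sum>c\<in>C'. (cmod (z c))\<^sup>2)"
      by (intro mult_left_mono sum_mono power_mono)
        (auto simp: w_def norm_mult norm_sgn)
    also have "\<dots> \<le> K\<^sup>2 * (ell2_norm C z)\<^sup>2"
      using sum_le_ell2_norm_square[of z C C'] z C' by (intro mult_left_mono) (auto simp: ell2_def)
    finally show ?thesis
      using K ell2_norm_nonneg[of C z] by (simp add: power_mult_distrib[symmetric] power2_le_iff_abs_le)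
  qed
  then have "(\<lambda>c. norm (M r c * z c)) summable_on C"
    by (intro nonneg_bdd_above_summable_on) (auto intro!: bdd_aboveI2)
  then show ?thesis by (rule abs_summable_summable)
qed

lemma section_bound_apply:
  assumes b: "section_bound R C M K" and K: "0 \<le> K" and z: "z \<in> ell2 C"
  shows "(\<lambda>r. (cmod (\<Sum>\<^sub>\<infinity>c\<in>C. M r c * z c))\<^sup>2) summable_on R"
    and "ell2_norm R (\<lambda>r. \<Sum>\<^sub>\<infinity>c\<in>C. M r c * z c) \<le> K * ell2_norm C z"
proof -
  have *: "(\<Sum>r\<in>R'. (cmod (\<Sum>\<^sub>\<infinity>c\<in>C. M r c * z c))\<^sup>2) \<le> (K * ell2_norm C z)\<^sup>2"
    if R': "finite R'" "R' \<subseteq> R" for R'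
  proof (rule tendsto_upperbound)
    show "((\<lambda>C'. \<Sum>r\<in>R'. (cmod (\<Sum>c\<in>C'. M r c * z c))\<^sup>2) \<longlongrightarrow>
          (\<Sum>r\<in>R'. (cmod (\<Sum>\<^sub>\<infinity>c\<in>C. M r c * z c))\<^sup>2)) (finite_subsets_at_top C)"
      using R' section_bound_row_summable[OF b K _ z]
      by (intro tendsto_intros infsum_tendsto) auto
    show "\<forall>\<^sub>F C' in finite_subsets_at_top C.
        (\<Sum>r\<in>R'. (cmod (\<Sum>c\<in>C'. M r c * z c))\<^sup>2) \<le> (K * ell2_norm C z)\<^sup>2"
    proof (rule eventually_finite_subsets_at_top_weakI)
      fix C' assume C': "finite C'" "C' \<subseteq> C"
      have "(\<Sum>r\<in>R'. (cmod (\<Sum>c\<in>C'. M r c * z c))\<^sup>2) \<le> K\<^sup>2 * (\<Sum>c\<in>C'. (cmod (z c))\<^sup>2)"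
        by (rule section_boundD[OF b R' C'])
      also have "\<dots> \<le> K\<^sup>2 * (ell2_norm C z)\<^sup>2"
        using sum_le_ell2_norm_square[of z C C'] z C' by (intro mult_left_mono) (auto simp: ell2_def)
      finally show "(\<Sum>r\<in>R'. (cmod (\<Sum>c\<in>C'. M r c * z c))\<^sup>2) \<le> (K * ell2_norm C z)\<^sup>2"
        by (simp add: power_mult_distrib)
    qed
  qed simp
  show "(\<lambda>r. (cmod (\<Sum>\<^sub>\<infinity>c\<in>C. M r c * z c))\<^sup>2) summable_on R"
    "ell2_norm R (\<lambda>r. \<Sum>\<^sub>\<infinity>c\<in>C. M r c * z c) \<le> K * ell2_norm C z"
    using ell2_norm_le[OF *] K ell2_norm_nonneg[of C z] by auto
qed

text \<open>
  The supremum defining \<open>matrix_opnorm\<close> says something only if it is taken over a bounded set,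
  and infinite sums are meaningful only if they converge.  One bound \<open>K\<^sub>0\<close> for the finite
  sections ensures both.
\<close>

lemma matrix_opnorm_bounds:
  assumes b: "section_bound R C M K0" and K0: "0 \<le> K0"
  shows "0 \<le> matrix_opnorm R C M"
    and "0 \<le> K \<Longrightarrow> matrix_opnorm R C M \<le> K \<longleftrightarrow> section_bound R C M K"
proof -
  define S where "S = {ell2_norm R (\<lambda>r. \<Sum>\<^sub>\<infinity>c\<in>C. M r c * z c) | z. z \<in> ell2 C \<and> ell2_norm C z \<le> 1}"
  have op: "matrix_opnorm R C M = Sup S" by (simp add: S_def matrix_opnorm_def)
  have z0: "(\<lambda>_. 0) \<in> ell2 C" "ell2_norm C (\<lambda>_. 0) \<le> 1" by (auto simp: ell2_def ell2_norm_def)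
  have S0: "0 \<in> S"
    unfolding S_def by (rule CollectI, rule exI[of _ "\<lambda>_. 0"]) (use z0 in \<open>auto simp: ell2_norm_def\<close>)
  have le: "s \<le> K" if sK: "section_bound R C M K" "0 \<le> K" "s \<in> S" for s K
  proof -
    obtain z where z: "z \<in> ell2 C" "ell2_norm C z \<le> 1"
      "s = ell2_norm R (\<lambda>r. \<Sum>\<^sub>\<infinity>c\<in>C. M r c * z c)" using sK(3) by (auto simp: S_def)
    have "s \<le> K * ell2_norm C z" using section_bound_apply(2)[OF that(1,2) z(1)] z by simp
    also have "\<dots> \<le> K * 1" using z that by (intro mult_left_mono) auto
    finally show ?thesis by simp
  qed
  have bdd: "bdd_above S" using le[OF b K0] by (auto simp: bdd_above_def)
  show "0 \<le> matrix_opnorm R C M" unfolding op using bdd S0 cSup_upper by blast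
  show "matrix_opnorm R C M \<le> K \<longleftrightarrow> section_bound R C M K" if K: "0 \<le> K"
  proof
    assume "section_bound R C M K"
    then show "matrix_opnorm R C M \<le> K" unfolding op using le K S0 by (intro cSup_least) auto
  next
    assume leK: "matrix_opnorm R C M \<le> K"
    show "section_bound R C M K"
      unfolding section_bound_def
    proof (intro allI impI)
      fix R' C' z assume R': "finite R'" "R' \<subseteq> R" and C': "finite C'" "C' \<subseteq> C"
      define t where "t = sqrt (\<Sum>c\<in>C'. (cmod (z c))\<^sup>2)"
      have t2: "t\<^sup>2 = (\<Sum>c\<in>C'. (cmod (z c))\<^sup>2)" by (simp add: t_def sum_nonneg)
      show "(\<Sum>r\<in>R'. (cmod (\<Sum>c\<in>C'. M r c * z c))\<^sup>2) \<le> K\<^sup>2 * (\<Sum>c\<in>C'. (cmod (z c))\<^sup>2)"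
      proof (cases "t = 0")
        case True
        then have "(\<Sum>c\<in>C'. (cmod (z c))\<^sup>2) = 0" using t2 by simp
        then have "\<forall>c\<in>C'. z c = 0" using C' by (simp add: sum_nonneg_eq_0_iff)
        then show ?thesis by simp
      next
        case False
        then have t: "t > 0" by (simp add: t_def less_le sum_nonneg)
        define w where "w = (\<lambda>c. if c \<in> C' then z c / of_real t else 0)"
        have sw: "infsum f C = sum f C'" "f summable_on C"
          if "\<And>c. c \<notin> C' \<Longrightarrow> f c = 0" for f :: "_ \<Rightarrow> 'x::{topological_comm_monoid_add,t2_space}"
        proof -
          have "infsum f C = infsum f C'" by (rule infsum_cong_neutral) (use that C' in auto)
          then show "infsum f C = sum f C'" using C' by simp
          have "f summable_on C \<longleftrightarrow> f summable_on C'" by (rule summable_on_cong_neutral) (use that C' in auto)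
          then show "f summable_on C" using C' by simp
        qed
        have w: "w \<in> ell2 C" unfolding ell2_def using C' by (auto simp: w_def intro!: sw)
        have "(\<Sum>\<^sub>\<infinity>c\<in>C. (cmod (w c))\<^sup>2) = (\<Sum>c\<in>C'. (cmod (w c))\<^sup>2)" by (rule sw) (auto simp: w_def)
        also have "\<dots> = (\<Sum>c\<in>C'. (cmod (z c))\<^sup>2 / t\<^sup>2)"
          by (intro sum.cong) (auto simp: w_def norm_divide power_divide)
        also have "\<dots> = 1" using t by (simp add: sum_divide_distrib[symmetric] t2[symmetric])
        finally have "ell2_norm C w \<le> 1" by (simp add: ell2_norm_def)
        then have "ell2_norm R (\<lambda>r. \<Sum>\<^sub>\<infinity>c\<in>C. M r c * w c) \<in> S" using w by (auto simp: S_def)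
        then have *: "ell2_norm R (\<lambda>r. \<Sum>\<^sub>\<infinity>c\<in>C. M r c * w c) \<le> K"
          using leK cSup_upper[OF _ bdd] unfolding op by fastforce
        have "(\<Sum>r\<in>R'. (cmod (\<Sum>\<^sub>\<infinity>c\<in>C. M r c * w c))\<^sup>2)
            \<le> (ell2_norm R (\<lambda>r. \<Sum>\<^sub>\<infinity>c\<in>C. M r c * w c))\<^sup>2"
          by (rule sum_le_ell2_norm_square[OF section_bound_apply(1)[OF b K0 w] R'])
        also have "\<dots> \<le> K\<^sup>2" using * by (intro power_mono ell2_norm_nonneg) 
        finally have "(\<Sum>r\<in>R'. (cmod (\<Sum>\<^sub>\<infinity>c\<in>C. M r c * w c))\<^sup>2) \<le> K\<^sup>2" .
        moreover have "(\<Sum>\<^sub>\<infinity>c\<in>C. M r c * w c) = (\<Sum>c\<in>C'. M r c * z c) / of_real t" for r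
        proof -
          have "(\<Sum>\<^sub>\<infinity>c\<in>C. M r c * w c) = (\<Sum>c\<in>C'. M r c * w c)" by (rule sw) (auto simp: w_def)
          then show ?thesis by (simp add: w_def sum_divide_distrib)
        qed
        ultimately have "(\<Sum>r\<in>R'. (cmod (\<Sum>c\<in>C'. M r c * z c))\<^sup>2 / t\<^sup>2) \<le> K\<^sup>2"
          using t by (simp add: norm_divide power_divide)
        then have "(\<Sum>r\<in>R'. (cmod (\<Sum>c\<in>C'. M r c * z c))\<^sup>2) \<le> K\<^sup>2 * t\<^sup>2"
          using t by (simp add: sum_divide_distrib[symmetric] field_simps)
        then show ?thesis by (simp add: t2)
      qed
    qed
  qed
qed

text \<open>
  With \<open>t = M\<^sup>T y\<close>, the number \<open>\<Sum> |t\<^sub>c|\<^sup>2\<close> is the pairing of \<open>y\<close> with \<open>M\<close> applied to the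
  conjugate of \<open>t\<close>, so Cauchy-Schwarz bounds it by \<open>K \<parallel>y\<parallel> \<parallel>t\<parallel>\<close>.
\<close>

lemma section_bound_transpose:
  assumes b: "section_bound R C M K" and K: "0 \<le> K"
  shows "section_bound C R (\<lambda>c r. M r c) K"
  unfolding section_bound_def
proof (intro allI impI)
  fix C' R' y assume C': "finite C'" "C' \<subseteq> C" and R': "finite R'" "R' \<subseteq> R"
  define t where "t = (\<lambda>c. \<Sum>r\<in>R'. M r c * y r)"
  define s where "s = (\<lambda>r. \<Sum>c\<in>C'. M r c * cnj (t c))"
  let ?T = "L2_set (\<lambda>c. cmod (t c)) C'" and ?Y = "L2_set (\<lambda>r. cmod (y r)) R'"
  have sq: "(L2_set f A)\<^sup>2 = (\<Sum>a\<in>A. (f a)\<^sup>2)" for f :: "'x \<Rightarrow> real" and A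
    by (simp add: L2_set_def sum_nonneg)
  have "complex_of_real (?T\<^sup>2) = (\<Sum>c\<in>C'. t c * cnj (t c))"
    by (simp add: sq complex_norm_square[symmetric])
  also have "\<dots> = (\<Sum>c\<in>C'. \<Sum>r\<in>R'. M r c * y r * cnj (t c))"
    by (simp add: t_def sum_distrib_right)
  also have "\<dots> = (\<Sum>r\<in>R'. \<Sum>c\<in>C'. M r c * y r * cnj (t c))" by (rule sum.swap)
  also have "\<dots> = (\<Sum>r\<in>R'. y r * s r)"
    by (simp add: s_def sum_distrib_left mult_ac)
  finally have "cmod (complex_of_real (?T\<^sup>2)) = cmod (\<Sum>r\<in>R'. y r * s r)" by simp
  then have "?T\<^sup>2 = cmod (\<Sum>r\<in>R'. y r * s r)" by (simp only: norm_of_real abs_power2)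
  also have "\<dots> \<le> (\<Sum>r\<in>R'. cmod (y r) * cmod (s r))"
    by (rule order_trans[OF norm_sum]) (simp add: norm_mult)
  also have "\<dots> \<le> ?Y * L2_set (\<lambda>r. cmod (s r)) R'"
    using L2_set_mult_ineq[of "\<lambda>r. cmod (y r)" "\<lambda>r. cmod (s r)" R'] by simp
  also have "\<dots> \<le> ?Y * (K * ?T)"
  proof (intro mult_left_mono L2_set_nonneg)
    have "(L2_set (\<lambda>r. cmod (s r)) R')\<^sup>2 \<le> (K * ?T)\<^sup>2"
      using section_boundD[OF b R' C', of "\<lambda>c. cnj (t c)"]
      by (simp add: sq s_def power_mult_distrib)
    then show "L2_set (\<lambda>r. cmod (s r)) R' \<le> K * ?T"
      by (rule power2_le_imp_le) (use K in \<open>simp add: L2_set_nonneg\<close>)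
  qed
  finally have "?T * ?T \<le> (K * ?Y) * ?T" by (simp add: power2_eq_square mult_ac)
  then have "?T \<le> K * ?Y"
    using K by (cases "?T = 0") (auto simp: L2_set_nonneg less_le)
  then have "?T\<^sup>2 \<le> (K * ?Y)\<^sup>2" by (intro power_mono L2_set_nonneg)
  then show "(\<Sum>c\<in>C'. (cmod (\<Sum>r\<in>R'. M r c * y r))\<^sup>2) \<le> K\<^sup>2 * (\<Sum>r\<in>R'. (cmod (y r))\<^sup>2)"
    by (simp add: sq power_mult_distrib t_def)
qed

lemma matrix_opnorm_transpose:
  assumes b: "section_bound R C M K0" and K0: "0 \<le> K0"
  shows "matrix_opnorm C R (\<lambda>c r. M r c) = matrix_opnorm R C M"
proof -
  note b' = section_bound_transpose[OF b K0]
  note m = matrix_opnorm_bounds[OF b K0] and m' = matrix_opnorm_bounds[OF b' K0]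
  show ?thesis
  proof (rule antisym)
    show "matrix_opnorm C R (\<lambda>c r. M r c) \<le> matrix_opnorm R C M"
      using m m' section_bound_transpose[of R C M "matrix_opnorm R C M"] by blast
    show "matrix_opnorm R C M \<le> matrix_opnorm C R (\<lambda>c r. M r c)"
      using m m' section_bound_transpose[of C R "\<lambda>c r. M r c" "matrix_opnorm C R (\<lambda>c r. M r c)"] by blast
  qed
qed

section \<open>Matrices over the column space\<close>

definition ell2_mats :: "'i set \<Rightarrow> nat \<Rightarrow> nat \<Rightarrow> (nat \<Rightarrow> nat \<Rightarrow> 'i \<Rightarrow> complex) set" where
  "ell2_mats I m n = {x. \<forall>i<m. \<forall>j<n. x i j \<in> ell2 I}"

definition column_norm :: "'i set \<Rightarrow> nat \<Rightarrow> nat \<Rightarrow> (nat \<Rightarrow> nat \<Rightarrow> 'i \<Rightarrow> complex) \<Rightarrow> real" where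
  "column_norm I m n x = matrix_opnorm ({..<m} \<times> I) {..<n} (\<lambda>(i, k) j. x i j k)"

definition column_bound :: "'i set \<Rightarrow> nat \<Rightarrow> nat \<Rightarrow> (nat \<Rightarrow> nat \<Rightarrow> 'i \<Rightarrow> complex) \<Rightarrow> real \<Rightarrow> bool" where
  "column_bound I m n x K \<longleftrightarrow> (\<forall>F z. finite F \<longrightarrow> F \<subseteq> I \<longrightarrow>
     (\<Sum>i<m. \<Sum>k\<in>F. (cmod (\<Sum>j<n. x i j k * z j))\<^sup>2) \<le> K\<^sup>2 * (\<Sum>j<n. (cmod (z j))\<^sup>2))"

lemma column_boundD:
  assumes "column_bound I m n x K" "finite F" "F \<subseteq> I"
  shows "(\<Sum>i<m. \<Sum>k\<in>F. (cmod (\<Sum>j<n. x i j k * z j))\<^sup>2) \<le> K\<^sup>2 * (\<Sum>j<n. (cmod (z j))\<^sup>2)"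
  using assms unfolding column_bound_def by blast

text \<open>
  For a column matrix the domain \<open>\<complex>\<^sup>n\<close> is finite, so only the index set \<open>I\<close> has to be
  truncated.
\<close>

lemma section_bound_iff_column_bound:
  "section_bound ({..<m} \<times> I) {..<n} (\<lambda>(i, k) j. x i j k) K \<longleftrightarrow> column_bound I m n x K"
proof
  assume b: "section_bound ({..<m} \<times> I) {..<n} (\<lambda>(i, k) j. x i j k) K"
  show "column_bound I m n x K"
    unfolding column_bound_def
  proof (intro allI impI)
    fix F z assume "finite F" "F \<subseteq> I"
    then show "(\<Sum>i<m. \<Sum>k\<in>F. (cmod (\<Sum>j<n. x i j k * z j))\<^sup>2) \<le> K\<^sup>2 * (\<Sum>j<n. (cmod (z j))\<^sup>2)"
      using section_boundD[OF b, of "{..<m} \<times> F" "{..<n}" z]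
      by (simp add: sum.cartesian_product case_prod_unfold Sigma_mono)
  qed
next
  assume b: "column_bound I m n x K"
  show "section_bound ({..<m} \<times> I) {..<n} (\<lambda>(i, k) j. x i j k) K"
    unfolding section_bound_def
  proof (intro allI impI)
    fix R' C' and z :: "nat \<Rightarrow> complex" assume R': "finite R'" "R' \<subseteq> {..<m} \<times> I" and C': "finite C'" "C' \<subseteq> {..<n}"
    define w where "w = (\<lambda>j. if j \<in> C' then z j else 0)"
    have [simp]: "{..<n} \<inter> C' = C'" using C' by auto
    have ext: "(\<Sum>c\<in>C'. g c) = (\<Sum>j<n. if j \<in> C' then g j else 0)" for g :: "nat \<Rightarrow> 'x::comm_monoid_add"
      by (simp add: sum.inter_restrict[symmetric])
    have "(\<Sum>r\<in>R'. (cmod (\<Sum>c\<in>C'. (case r of (i, k) \<Rightarrow> \<lambda>j. x i j k) c * z c))\<^sup>2)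
        \<le> (\<Sum>r\<in>{..<m} \<times> snd ` R'. (cmod (\<Sum>c\<in>C'. (case r of (i, k) \<Rightarrow> \<lambda>j. x i j k) c * z c))\<^sup>2)"
      by (rule sum_mono2) (use R' in force)+
    also have "\<dots> = (\<Sum>i<m. \<Sum>k\<in>snd ` R'. (cmod (\<Sum>j<n. x i j k * w j))\<^sup>2)"
      by (simp add: sum.cartesian_product case_prod_unfold ext w_def if_distrib cong: if_cong)
    also have "\<dots> \<le> K\<^sup>2 * (\<Sum>j<n. (cmod (w j))\<^sup>2)"
      by (rule column_boundD[OF b]) (use R' in auto)
    also have "(\<Sum>j<n. (cmod (w j))\<^sup>2) = (\<Sum>c\<in>C'. (cmod (z c))\<^sup>2)"
      by (auto simp: ext w_def intro!: sum.cong)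
    finally show "(\<Sum>r\<in>R'. (cmod (\<Sum>c\<in>C'. (case r of (i, k) \<Rightarrow> \<lambda>j. x i j k) c * z c))\<^sup>2)
        \<le> K\<^sup>2 * (\<Sum>c\<in>C'. (cmod (z c))\<^sup>2)" .
  qed
qed

text \<open>
  The Hilbert-Schmidt norm dominates the operator norm.
\<close>

lemma ex_column_bound:
  assumes x: "x \<in> ell2_mats I m n"
  shows "\<exists>K\<ge>0. column_bound I m n x K"
proof -
  define K where "K = sqrt (\<Sum>i<m. \<Sum>j<n. (ell2_norm I (x i j))\<^sup>2)"
  have K2: "K\<^sup>2 = (\<Sum>i<m. \<Sum>j<n. (ell2_norm I (x i j))\<^sup>2)" by (simp add: K_def sum_nonneg)
  have "column_bound I m n x K"
    unfolding column_bound_def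
  proof (intro allI impI)
    fix F z assume F: "finite F" "F \<subseteq> I"
    let ?Z = "\<Sum>j<n. (cmod (z j))\<^sup>2"
    have "(cmod (\<Sum>j<n. x i j k * z j))\<^sup>2 \<le> (\<Sum>j<n. (cmod (x i j k))\<^sup>2) * ?Z" for i k
    proof -
      have "cmod (\<Sum>j<n. x i j k * z j) \<le> (\<Sum>j<n. cmod (x i j k) * cmod (z j))"
        by (rule order_trans[OF norm_sum]) (simp add: norm_mult)
      also have "\<dots> \<le> L2_set (\<lambda>j. cmod (x i j k)) {..<n} * L2_set (\<lambda>j. cmod (z j)) {..<n}"
        using L2_set_mult_ineq[of "\<lambda>j. cmod (x i j k)" "\<lambda>j. cmod (z j)"] by simp
      finally have "(cmod (\<Sum>j<n. x i j k * z j))\<^sup>2 \<le> \<dots>\<^sup>2" by (intro power_mono) auto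
      then show ?thesis by (simp add: power_mult_distrib L2_set_def sum_nonneg)
    qed
    then have "(\<Sum>i<m. \<Sum>k\<in>F. (cmod (\<Sum>j<n. x i j k * z j))\<^sup>2)
        \<le> (\<Sum>i<m. \<Sum>k\<in>F. (\<Sum>j<n. (cmod (x i j k))\<^sup>2) * ?Z)"
      by (intro sum_mono)
    also have "\<dots> = (\<Sum>i<m. \<Sum>j<n. \<Sum>k\<in>F. (cmod (x i j k))\<^sup>2) * ?Z"
      by (simp add: sum_distrib_right[symmetric] sum.swap[of _ "{..<n}" F])
    also have "\<dots> \<le> K\<^sup>2 * ?Z"
      unfolding K2
    proof (intro mult_right_mono sum_mono sum_nonneg zero_le_power2)
      fix i j assume "i \<in> {..<m}" "j \<in> {..<n}"
      then have "x i j \<in> ell2 I" using x by (auto simp: ell2_mats_def)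
      then show "(\<Sum>k\<in>F. (cmod (x i j k))\<^sup>2) \<le> (ell2_norm I (x i j))\<^sup>2"
        using F by (intro sum_le_ell2_norm_square) (auto simp: ell2_def)
    qed
    finally show "(\<Sum>i<m. \<Sum>k\<in>F. (cmod (\<Sum>j<n. x i j k * z j))\<^sup>2) \<le> K\<^sup>2 * ?Z" .
  qed
  then show ?thesis by (intro exI[of _ K]) (auto simp: K_def sum_nonneg)
qed

lemma column_norm_nonneg: "x \<in> ell2_mats I m n \<Longrightarrow> 0 \<le> column_norm I m n x"
  using ex_column_bound[of x I m n] matrix_opnorm_bounds(1)[of "{..<m} \<times> I" "{..<n}" "\<lambda>(i, k) j. x i j k"]
  unfolding column_norm_def section_bound_iff_column_bound by blast

lemma column_norm_le_iff:
  "x \<in> ell2_mats I m n \<Longrightarrow> 0 \<le> K \<Longrightarrow> column_norm I m n x \<le> K \<longleftrightarrow> column_bound I m n x K"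
  using ex_column_bound[of x I m n] matrix_opnorm_bounds(2)[of "{..<m} \<times> I" "{..<n}" "\<lambda>(i, k) j. x i j k"]
  unfolding column_norm_def section_bound_iff_column_bound by blast

lemma column_bound_column_norm:
  "x \<in> ell2_mats I m n \<Longrightarrow> column_bound I m n x (column_norm I m n x)"
  using column_norm_le_iff column_norm_nonneg by blast

lemma column_norm_eqI:
  assumes "x \<in> ell2_mats I m n" "y \<in> ell2_mats I m' n'"
    and "\<And>K. column_bound I m n x K \<longleftrightarrow> column_bound I m' n' y K"
  shows "column_norm I m n x = column_norm I m' n' y"
  using assms column_norm_le_iff[of x I m n] column_norm_le_iff[of y I m' n']
    column_norm_nonneg[of x I m n] column_norm_nonneg[of y I m' n'] by (metis antisym order_refl)

lemma column_bound_imp_ell2_mats: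
  assumes b: "column_bound I m n x K" and "0 \<le> K" and z: "\<And>i j k. i < m \<Longrightarrow> j < n \<Longrightarrow> k \<notin> I \<Longrightarrow> x i j k = 0"
  shows "x \<in> ell2_mats I m n"
  unfolding ell2_mats_def ell2_def
proof (intro CollectI allI impI conjI)
  fix i j assume ij: "i < m" "j < n"
  show "(\<lambda>k. (cmod (x i j k))\<^sup>2) summable_on I"
  proof (rule ell2_norm_le(1)[OF _ \<open>0 \<le> K\<close>])
    fix F assume F: "finite F" "F \<subseteq> I"
    have "(\<Sum>k\<in>F. (cmod (x i j k))\<^sup>2) \<le> (\<Sum>i<m. \<Sum>k\<in>F. (cmod (x i j k))\<^sup>2)"
      using ij by (intro member_le_sum[of i "{..<m}" "\<lambda>i. \<Sum>k\<in>F. (cmod (x i j k))\<^sup>2"]) (auto intro: sum_nonneg)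
    also have "\<dots> \<le> K\<^sup>2"
    proof -
      have "(\<Sum>j'<n. (cmod (if j' = j then 1 else 0))\<^sup>2) = (\<Sum>j'<n. if j' = j then 1 else 0)"
        by (intro sum.cong) auto
      also have "\<dots> = 1" using ij by simp
      finally show ?thesis
        using column_boundD[OF b F, of "\<lambda>j'. if j' = j then 1 else 0"] ij
        by (simp add: if_distrib cong: if_cong)
    qed
    finally show "(\<Sum>k\<in>F. (cmod (x i j k))\<^sup>2) \<le> K\<^sup>2" .
  qed
qed (use z in auto)

lemma zero_in_ell2: "(\<lambda>_. 0) \<in> ell2 I" by (simp add: ell2_def)

lemma column_norm_le:
  assumes b: "column_bound I m n x K" "0 \<le> K" "\<And>i j k. i < m \<Longrightarrow> j < n \<Longrightarrow> k \<notin> I \<Longrightarrow> x i j k = 0"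
  shows "x \<in> ell2_mats I m n" "column_norm I m n x \<le> K"
  using column_bound_imp_ell2_mats[OF assms] column_norm_le_iff[OF _ b(2)] b(1) by blast+

lemma ell2_matsD: "x \<in> ell2_mats I m n \<Longrightarrow> i < m \<Longrightarrow> j < n \<Longrightarrow> k \<notin> I \<Longrightarrow> x i j k = 0"
  by (auto simp: ell2_mats_def ell2_def)

lemma column_norm_cong:
  assumes "\<And>i j. i < m \<Longrightarrow> j < n \<Longrightarrow> x i j = y i j" "x \<in> ell2_mats I m n"
  shows "column_norm I m n x = column_norm I m n y"
proof (rule column_norm_eqI)
  show "y \<in> ell2_mats I m n" using assms by (simp add: ell2_mats_def)
  have "(\<Sum>j<n. x i j k * z j) = (\<Sum>j<n. y i j k * z j)" if "i < m" for i k z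
    using assms that by simp
  then show "column_bound I m n x K \<longleftrightarrow> column_bound I m n y K" for K
    unfolding column_bound_def by simp
qed (use assms in auto)

lemma column_norm_pad:
  assumes x: "x \<in> ell2_mats I m n" and N: "m \<le> N" "n \<le> N"
  shows "column_norm I N N (\<lambda>i j. if i < m \<and> j < n then x i j else (\<lambda>_. 0)) = column_norm I m n x"
proof (rule column_norm_eqI)
  let ?y = "\<lambda>i j. if i < m \<and> j < n then x i j else (\<lambda>_. 0)"
  have tr: "(\<Sum>i<N. if i < l then f i else 0) = (\<Sum>i<l. f i)" if "l \<le> N"
    for f :: "nat \<Rightarrow> 'x::comm_monoid_add" and l
    using that by (intro sum.mono_neutral_cong_right) auto
  have "(\<Sum>j<N. ?y i j k * z j) = (if i < m then \<Sum>j<n. x i j k * z j else 0)" for i k z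
    by (cases "i < m") (simp_all add: tr[OF N(2), symmetric] if_distrib[of "\<lambda>f. f _"] if_distrib[of "\<lambda>u. u * _"] cong: if_cong)
  then have eq: "(\<Sum>i<N. \<Sum>k\<in>F. (cmod (\<Sum>j<N. ?y i j k * z j))\<^sup>2)
      = (\<Sum>i<m. \<Sum>k\<in>F. (cmod (\<Sum>j<n. x i j k * z j))\<^sup>2)" for F z
    by (subst tr[OF N(1), symmetric]) (auto intro!: sum.cong)
  show "column_bound I N N ?y K \<longleftrightarrow> column_bound I m n x K" for K
  proof
    assume b: "column_bound I N N ?y K"
    show "column_bound I m n x K"
      unfolding column_bound_def
    proof (intro allI impI)
      fix F z assume F: "finite F" "F \<subseteq> I"
      have "(\<Sum>j<n. x i j k * (if j < n then z j else 0)) = (\<Sum>j<n. x i j k * z j)" for i k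
        by simp
      moreover have "(\<Sum>j<N. (cmod (if j < n then z j else 0))\<^sup>2) = (\<Sum>j<n. (cmod (z j))\<^sup>2)"
        by (subst tr[OF N(2), symmetric]) (auto intro!: sum.cong)
      ultimately show "(\<Sum>i<m. \<Sum>k\<in>F. (cmod (\<Sum>j<n. x i j k * z j))\<^sup>2) \<le> K\<^sup>2 * (\<Sum>j<n. (cmod (z j))\<^sup>2)"
        using column_boundD[OF b F, of "\<lambda>j. if j < n then z j else 0"] unfolding eq by simp
    qed
  next
    assume b: "column_bound I m n x K"
    show "column_bound I N N ?y K"
      unfolding column_bound_def eq
    proof (intro allI impI)
      fix F and z :: "nat \<Rightarrow> complex" assume F: "finite F" "F \<subseteq> I"
      have "(\<Sum>i<m. \<Sum>k\<in>F. (cmod (\<Sum>j<n. x i j k * z j))\<^sup>2) \<le> K\<^sup>2 * (\<Sum>j<n. (cmod (z j))\<^sup>2)"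
        by (rule column_boundD[OF b F])
      also have "\<dots> \<le> K\<^sup>2 * (\<Sum>j<N. (cmod (z j))\<^sup>2)"
        using N by (intro mult_left_mono sum_mono2) auto
      finally show "(\<Sum>i<m. \<Sum>k\<in>F. (cmod (\<Sum>j<n. x i j k * z j))\<^sup>2) \<le> K\<^sup>2 * (\<Sum>j<N. (cmod (z j))\<^sup>2)" .
    qed
  qed
qed (use x in \<open>auto simp: ell2_mats_def zero_in_ell2\<close>)

lemma ell2_opspace_simps [simp]:
  "carr (column_ell2 I) = ell2 I" "vzero (column_ell2 I) = (\<lambda>_. 0)"
  "vadd (column_ell2 I) = (\<lambda>x y i. x i + y i)" "vscale (column_ell2 I) = (\<lambda>c x i. c * x i)"
  "mnorm (column_ell2 I) n x = column_norm I n n x"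
  "carr (row_ell2 I) = ell2 I" "vzero (row_ell2 I) = (\<lambda>_. 0)"
  "vadd (row_ell2 I) = (\<lambda>x y i. x i + y i)" "vscale (row_ell2 I) = (\<lambda>c x i. c * x i)"
  by (simp_all add: column_ell2_def row_ell2_def column_norm_def)

lemma rnorm_column_ell2:
  assumes "x \<in> ell2_mats I m n"
  shows "rnorm (column_ell2 I) m n x = column_norm I m n x"
  using column_norm_pad[OF assms, of "max m n"]
  by (simp add: rnorm_def cong: if_cong)

text \<open>
  A matrix over the row space and the transposed matrix over the column space are, as matrices of
  scalars, transposes of each other, and transposition preserves operator norms.
\<close>

lemma mnorm_row_ell2:
  assumes x: "x \<in> ell2_mats I n n"
  shows "mnorm (row_ell2 I) n x = column_norm I n n (\<lambda>i j. x j i)"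
proof -
  have xt: "(\<lambda>i j. x j i) \<in> ell2_mats I n n" using x by (simp add: ell2_mats_def)
  obtain K where K: "0 \<le> K" "column_bound I n n (\<lambda>i j. x j i) K" using ex_column_bound[OF xt] by blast
  have "(\<lambda>c r. (case r of (i, k) \<Rightarrow> \<lambda>j. x j i k) c) = (\<lambda>i (j, k). x i j k)"
    by (auto simp: fun_eq_iff)
  with matrix_opnorm_transpose[OF K(2)[folded section_bound_iff_column_bound] K(1)]
  show ?thesis by (simp add: row_ell2_def column_norm_def)
qed

lemma rnorm_row_ell2:
  assumes x: "x \<in> ell2_mats I m n"
  shows "rnorm (row_ell2 I) m n x = column_norm I n m (\<lambda>i j. x j i)"
proof -
  have xt: "(\<lambda>i j. x j i) \<in> ell2_mats I n m" using x by (simp add: ell2_mats_def)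
  have "rnorm (row_ell2 I) m n x
      = mnorm (row_ell2 I) (max m n) (\<lambda>i j. if i < m \<and> j < n then x i j else (\<lambda>_. 0))"
    by (simp add: rnorm_def cong: if_cong)
  also have "\<dots> = column_norm I (max m n) (max m n) (\<lambda>i j. if j < m \<and> i < n then x j i else (\<lambda>_. 0))"
    by (rule mnorm_row_ell2) (use x in \<open>auto simp: ell2_mats_def zero_in_ell2\<close>)
  also have "\<dots> = column_norm I n m (\<lambda>i j. x j i)"
    using column_norm_pad[OF xt, of "max m n"] by (simp add: conj_commute)
  finally show ?thesis .
qed

section \<open>The algebra of matrices over the row and column spaces\<close>

definition unit_vec :: "'i \<Rightarrow> 'i \<Rightarrow> complex" where
  "unit_vec k = (\<lambda>i. if i = k then 1 else 0)"

lemma ell2_finite_support: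
  assumes "finite F" "F \<subseteq> I" "\<And>i. i \<notin> F \<Longrightarrow> x i = 0"
  shows "x \<in> ell2 I"
proof -
  have "(\<lambda>i. (cmod (x i))\<^sup>2) summable_on I \<longleftrightarrow> (\<lambda>i. (cmod (x i))\<^sup>2) summable_on F"
    by (rule summable_on_cong_neutral) (use assms in auto)
  then show ?thesis using assms by (auto simp: ell2_def)
qed

lemma unit_vec_in_ell2: "k \<in> I \<Longrightarrow> unit_vec k \<in> ell2 I"
  by (rule ell2_finite_support[of "{k}"]) (auto simp: unit_vec_def)

lemma sum_lessThan_add:
  "(\<Sum>i<p + q. f i) = (\<Sum>i<p. f i) + (\<Sum>i<(q::nat). f (p + i))" for f :: "nat \<Rightarrow> 'x::comm_monoid_add"
  by (induction q) (simp_all add: add.assoc)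

lemma ell2_mats_1_1: "x \<in> ell2 I \<Longrightarrow> (\<lambda>_ _. x) \<in> ell2_mats I m n"
  by (simp add: ell2_mats_def)

lemma column_norm_1_1:
  assumes x: "x \<in> ell2 I"
  shows "column_norm I 1 1 (\<lambda>_ _. x) = ell2_norm I x"
proof -
  have s: "(\<lambda>i. (cmod (x i))\<^sup>2) summable_on I" using x by (simp add: ell2_def)
  have "column_bound I 1 1 (\<lambda>_ _. x) (ell2_norm I x)"
    unfolding column_bound_def
    by (auto simp: norm_mult power_mult_distrib sum_distrib_right[symmetric]
        intro!: mult_right_mono sum_le_ell2_norm_square[OF s])
  then have "column_norm I 1 1 (\<lambda>_ _. x) \<le> ell2_norm I x"
    using column_norm_le_iff[OF ell2_mats_1_1[OF x] ell2_norm_nonneg] by blast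
  moreover have "ell2_norm I x \<le> column_norm I 1 1 (\<lambda>_ _. x)"
    using column_boundD[OF column_bound_column_norm[OF ell2_mats_1_1[OF x, of 1 1]], of _ "\<lambda>_. 1"]
    by (intro ell2_norm_le(2) column_norm_nonneg ell2_mats_1_1[OF x]) auto
  ultimately show ?thesis by simp
qed

lemma column_norm_scale:
  assumes x: "x \<in> ell2_mats I m n"
  shows "(\<lambda>i j k. c * x i j k) \<in> ell2_mats I m n"
    and "column_norm I m n (\<lambda>i j k. c * x i j k) \<le> cmod c * column_norm I m n x"
proof -
  have "column_bound I m n (\<lambda>i j k. c * x i j k) (cmod c * column_norm I m n x)"
    unfolding column_bound_def
  proof (intro allI impI)
    fix F z assume F: "finite F" "F \<subseteq> I"
    have "(\<Sum>i<m. \<Sum>k\<in>F. (cmod (\<Sum>j<n. c * x i j k * z j))\<^sup>2)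
        = (cmod c)\<^sup>2 * (\<Sum>i<m. \<Sum>k\<in>F. (cmod (\<Sum>j<n. x i j k * z j))\<^sup>2)"
      by (simp add: mult.assoc sum_distrib_left[symmetric] norm_mult power_mult_distrib)
    also have "\<dots> \<le> (cmod c)\<^sup>2 * ((column_norm I m n x)\<^sup>2 * (\<Sum>j<n. (cmod (z j))\<^sup>2))"
      by (intro mult_left_mono column_boundD[OF column_bound_column_norm[OF x] F]) auto
    finally show "(\<Sum>i<m. \<Sum>k\<in>F. (cmod (\<Sum>j<n. c * x i j k * z j))\<^sup>2)
        \<le> (cmod c * column_norm I m n x)\<^sup>2 * (\<Sum>j<n. (cmod (z j))\<^sup>2)"
      by (simp add: power_mult_distrib mult.assoc)
  qed
  from column_norm_le[OF this] show "(\<lambda>i j k. c * x i j k) \<in> ell2_mats I m n"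
    "column_norm I m n (\<lambda>i j k. c * x i j k) \<le> cmod c * column_norm I m n x"
    by (auto simp: ell2_matsD[OF x] column_norm_nonneg[OF x])
qed

lemma column_norm_in_row:
  assumes v: "v \<in> ell2_mats I 1 p"
  shows "column_norm I n p (\<lambda>i j. if i = r then v 0 j else (\<lambda>_. 0)) \<le> column_norm I 1 p v"
proof (rule column_norm_le(2))
  show "column_bound I n p (\<lambda>i j. if i = r then v 0 j else (\<lambda>_. 0)) (column_norm I 1 p v)"
    unfolding column_bound_def
  proof (intro allI impI)
    fix F z assume F: "finite F" "F \<subseteq> I"
    have "(\<Sum>i<n. \<Sum>k\<in>F. (cmod (\<Sum>j<p. (if i = r then v 0 j else (\<lambda>_. 0)) k * z j))\<^sup>2)
        = (\<Sum>i<n. if i = r then \<Sum>k\<in>F. (cmod (\<Sum>j<p. v 0 j k * z j))\<^sup>2 else 0)"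
      by (intro sum.cong) auto
    also have "\<dots> \<le> (\<Sum>k\<in>F. (cmod (\<Sum>j<p. v 0 j k * z j))\<^sup>2)"
      by (auto intro: sum_nonneg)
    also have "\<dots> \<le> (column_norm I 1 p v)\<^sup>2 * (\<Sum>j<p. (cmod (z j))\<^sup>2)"
      using column_boundD[OF column_bound_column_norm[OF v] F, of z] by simp
    finally show "(\<Sum>i<n. \<Sum>k\<in>F. (cmod (\<Sum>j<p. (if i = r then v 0 j else (\<lambda>_. 0)) k * z j))\<^sup>2)
        \<le> (column_norm I 1 p v)\<^sup>2 * (\<Sum>j<p. (cmod (z j))\<^sup>2)" .
  qed
qed (use column_norm_nonneg[OF v] ell2_matsD[OF v] in auto)

lemma column_norm_in_column:
  assumes v: "v \<in> ell2_mats I p 1"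
  shows "column_norm I p n (\<lambda>i j. if j = r then v i 0 else (\<lambda>_. 0)) \<le> column_norm I p 1 v"
proof (rule column_norm_le(2))
  show "column_bound I p n (\<lambda>i j. if j = r then v i 0 else (\<lambda>_. 0)) (column_norm I p 1 v)"
    unfolding column_bound_def
  proof (intro allI impI)
    fix F and z :: "nat \<Rightarrow> complex" assume F: "finite F" "F \<subseteq> I"
    let ?w = "if r < n then z r else 0"
    have "(\<Sum>j<n. (if j = r then v i 0 else (\<lambda>_. 0)) k * z j) = (\<Sum>j<n. if j = r then v i 0 k * z r else 0)"
      for i k by (intro sum.cong) auto
    then have "(\<Sum>i<p. \<Sum>k\<in>F. (cmod (\<Sum>j<n. (if j = r then v i 0 else (\<lambda>_. 0)) k * z j))\<^sup>2)
        = (\<Sum>i<p. \<Sum>k\<in>F. (cmod (v i 0 k * ?w))\<^sup>2)"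
      by simp
    also have "\<dots> \<le> (column_norm I p 1 v)\<^sup>2 * (cmod ?w)\<^sup>2"
      using column_boundD[OF column_bound_column_norm[OF v] F, of "\<lambda>_. ?w"] by simp
    also have "\<dots> \<le> (column_norm I p 1 v)\<^sup>2 * (\<Sum>j<n. (cmod (z j))\<^sup>2)"
      by (intro mult_left_mono) (auto intro: member_le_sum sum_nonneg)
    finally show "(\<Sum>i<p. \<Sum>k\<in>F. (cmod (\<Sum>j<n. (if j = r then v i 0 else (\<lambda>_. 0)) k * z j))\<^sup>2)
        \<le> (column_norm I p 1 v)\<^sup>2 * (\<Sum>j<n. (cmod (z j))\<^sup>2)" .
  qed
qed (use column_norm_nonneg[OF v] ell2_matsD[OF v] in auto)

text \<open>
  This and the next lemma give the triangle inequality for the Haagerup norm: factorisations of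
  two tensors are concatenated, the left factors as a block row and the right factors as a block
  column.
\<close>

lemma column_norm_append_columns:
  assumes a: "a \<in> ell2_mats I m p" and b: "b \<in> ell2_mats I m q"
  shows "(column_norm I m (p + q) (\<lambda>i j. if j < p then a i j else b i (j - p)))\<^sup>2
      \<le> (column_norm I m p a)\<^sup>2 + (column_norm I m q b)\<^sup>2"
proof -
  let ?A = "column_norm I m p a" and ?B = "column_norm I m q b"
  have sq: "(L2_set f A)\<^sup>2 = (\<Sum>a\<in>A. (f a)\<^sup>2)" for f :: "'x \<Rightarrow> real" and A
    by (simp add: L2_set_def sum_nonneg)
  have "column_bound I m (p + q) (\<lambda>i j. if j < p then a i j else b i (j - p)) (sqrt (?A\<^sup>2 + ?B\<^sup>2))"
    unfolding column_bound_def
  proof (intro allI impI)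
    fix F z assume F: "finite F" "F \<subseteq> I"
    define s where "s = L2_set (\<lambda>j. cmod (z j)) {..<p}"
    define t where "t = L2_set (\<lambda>j. cmod (z (p + j))) {..<q}"
    let ?X = "{..<m} \<times> F"
    define f where "f = (\<lambda>(i, k). \<Sum>j<p. a i j k * z j)"
    define g where "g = (\<lambda>(i, k). \<Sum>j<q. b i j k * z (p + j))"
    have f: "L2_set (\<lambda>x. cmod (f x)) ?X \<le> ?A * s"
    proof (rule power2_le_imp_le)
      show "(L2_set (\<lambda>x. cmod (f x)) ?X)\<^sup>2 \<le> (?A * s)\<^sup>2"
        using column_boundD[OF column_bound_column_norm[OF a] F, of z]
        by (simp add: sq f_def s_def power_mult_distrib sum.cartesian_product case_prod_unfold)
    qed (simp add: s_def L2_set_nonneg column_norm_nonneg[OF a])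
    have g: "L2_set (\<lambda>x. cmod (g x)) ?X \<le> ?B * t"
    proof (rule power2_le_imp_le)
      show "(L2_set (\<lambda>x. cmod (g x)) ?X)\<^sup>2 \<le> (?B * t)\<^sup>2"
        using column_boundD[OF column_bound_column_norm[OF b] F, of "\<lambda>j. z (p + j)"]
        by (simp add: sq g_def t_def power_mult_distrib sum.cartesian_product case_prod_unfold)
    qed (simp add: t_def L2_set_nonneg column_norm_nonneg[OF b])
    have "(\<Sum>i<m. \<Sum>k\<in>F. (cmod (\<Sum>j<p + q. (if j < p then a i j else b i (j - p)) k * z j))\<^sup>2)
        = (\<Sum>i<m. \<Sum>k\<in>F. (cmod (f (i, k) + g (i, k)))\<^sup>2)"
      by (simp add: sum_lessThan_add f_def g_def)
    also have "\<dots> = (L2_set (\<lambda>x. cmod (f x + g x)) ?X)\<^sup>2"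
      by (simp add: sq sum.cartesian_product case_prod_unfold)
    also have "\<dots> \<le> (L2_set (\<lambda>x. cmod (f x) + cmod (g x)) ?X)\<^sup>2"
      by (intro power_mono L2_set_mono L2_set_nonneg norm_triangle_ineq) auto
    also have "\<dots> \<le> (?A * s + ?B * t)\<^sup>2"
      using L2_set_triangle_ineq[of "\<lambda>x. cmod (f x)" "\<lambda>x. cmod (g x)" ?X] f g
      by (intro power_mono L2_set_nonneg) linarith
    also have "\<dots> \<le> (?A\<^sup>2 + ?B\<^sup>2) * (s\<^sup>2 + t\<^sup>2)"
    proof -
      have "0 \<le> (?A * t - ?B * s)\<^sup>2" by simp
      then show ?thesis by (simp add: power2_eq_square algebra_simps)
    qed
    also have "s\<^sup>2 + t\<^sup>2 = (\<Sum>j<p + q. (cmod (z j))\<^sup>2)"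
      by (simp add: s_def t_def sq sum_lessThan_add)
    finally show "(\<Sum>i<m. \<Sum>k\<in>F. (cmod (\<Sum>j<p + q. (if j < p then a i j else b i (j - p)) k * z j))\<^sup>2)
        \<le> (sqrt (?A\<^sup>2 + ?B\<^sup>2))\<^sup>2 * (\<Sum>j<p + q. (cmod (z j))\<^sup>2)"
      by simp
  qed
  from column_norm_le(2)[OF this]
  have "column_norm I m (p + q) (\<lambda>i j. if j < p then a i j else b i (j - p)) \<le> sqrt (?A\<^sup>2 + ?B\<^sup>2)"
    using ell2_matsD[OF a] ell2_matsD[OF b] by auto
  moreover have "0 \<le> column_norm I m (p + q) (\<lambda>i j. if j < p then a i j else b i (j - p))"
    by (rule column_norm_nonneg) (use a b in \<open>auto simp: ell2_mats_def\<close>)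
  ultimately have "(column_norm I m (p + q) (\<lambda>i j. if j < p then a i j else b i (j - p)))\<^sup>2 \<le> (sqrt (?A\<^sup>2 + ?B\<^sup>2))\<^sup>2"
    by (rule power_mono)
  then show ?thesis by simp
qed

lemma column_norm_append_rows:
  assumes a: "a \<in> ell2_mats I p n" and b: "b \<in> ell2_mats I q n"
  shows "(column_norm I (p + q) n (\<lambda>i j. if i < p then a i j else b (i - p) j))\<^sup>2
      \<le> (column_norm I p n a)\<^sup>2 + (column_norm I q n b)\<^sup>2"
proof -
  let ?A = "column_norm I p n a" and ?B = "column_norm I q n b"
  have "column_bound I (p + q) n (\<lambda>i j. if i < p then a i j else b (i - p) j) (sqrt (?A\<^sup>2 + ?B\<^sup>2))"
    unfolding column_bound_def
  proof (intro allI impI)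
    fix F z assume F: "finite F" "F \<subseteq> I"
    show "(\<Sum>i<p + q. \<Sum>k\<in>F. (cmod (\<Sum>j<n. (if i < p then a i j else b (i - p) j) k * z j))\<^sup>2)
        \<le> (sqrt (?A\<^sup>2 + ?B\<^sup>2))\<^sup>2 * (\<Sum>j<n. (cmod (z j))\<^sup>2)"
      using column_boundD[OF column_bound_column_norm[OF a] F, of z]
        column_boundD[OF column_bound_column_norm[OF b] F, of z]
      by (simp add: sum_lessThan_add distrib_right)
  qed
  from column_norm_le(2)[OF this]
  have "column_norm I (p + q) n (\<lambda>i j. if i < p then a i j else b (i - p) j) \<le> sqrt (?A\<^sup>2 + ?B\<^sup>2)"
    using ell2_matsD[OF a] ell2_matsD[OF b] by auto
  moreover have "0 \<le> column_norm I (p + q) n (\<lambda>i j. if i < p then a i j else b (i - p) j)"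
    by (rule column_norm_nonneg) (use a b in \<open>auto simp: ell2_mats_def\<close>)
  ultimately have "(column_norm I (p + q) n (\<lambda>i j. if i < p then a i j else b (i - p) j))\<^sup>2 \<le> (sqrt (?A\<^sup>2 + ?B\<^sup>2))\<^sup>2"
    by (rule power_mono)
  then show ?thesis by simp
qed

text \<open>
  Each finite section is continuous in the entries, so norm bounds survive pointwise limits.
  This is what extends the multiplication map to the completion.
\<close>

lemma column_norm_limit:
  assumes x: "\<And>r. x r \<in> ell2_mats I m n" and K: "\<And>r. column_norm I m n (x r) \<le> K r" "K \<longlonglongrightarrow> L"
    and lim: "\<And>i j k. i < m \<Longrightarrow> j < n \<Longrightarrow> (\<lambda>r. x r i j k) \<longlonglongrightarrow> y i j k"
  shows "y \<in> ell2_mats I m n" "column_norm I m n y \<le> L"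
proof -
  have K0: "0 \<le> K r" for r using column_norm_nonneg[OF x] K(1) by (metis order_trans)
  have L: "0 \<le> L" using K(2) K0 LIMSEQ_le_const by blast
  have "column_bound I m n y L"
    unfolding column_bound_def
  proof (intro allI impI)
    fix F and z :: "nat \<Rightarrow> complex" assume F: "finite F" "F \<subseteq> I"
    show "(\<Sum>i<m. \<Sum>k\<in>F. (cmod (\<Sum>j<n. y i j k * z j))\<^sup>2) \<le> L\<^sup>2 * (\<Sum>j<n. (cmod (z j))\<^sup>2)"
    proof (rule LIMSEQ_le)
      show "(\<lambda>r. \<Sum>i<m. \<Sum>k\<in>F. (cmod (\<Sum>j<n. x r i j k * z j))\<^sup>2)
          \<longlonglongrightarrow> (\<Sum>i<m. \<Sum>k\<in>F. (cmod (\<Sum>j<n. y i j k * z j))\<^sup>2)"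
        by (intro tendsto_intros lim) auto
      show "(\<lambda>r. (K r)\<^sup>2 * (\<Sum>j<n. (cmod (z j))\<^sup>2)) \<longlonglongrightarrow> L\<^sup>2 * (\<Sum>j<n. (cmod (z j))\<^sup>2)"
        by (intro tendsto_intros K)
      have "column_bound I m n (x r) (K r)" for r
        using column_norm_le_iff[OF x K0] K(1) by blast
      then show "\<exists>N. \<forall>r\<ge>N. (\<Sum>i<m. \<Sum>k\<in>F. (cmod (\<Sum>j<n. x r i j k * z j))\<^sup>2)
          \<le> (K r)\<^sup>2 * (\<Sum>j<n. (cmod (z j))\<^sup>2)"
        using column_boundD F by blast
    qed
  qed
  moreover have "y i j k = 0" if "i < m" "j < n" "k \<notin> I" for i j k
    using lim[OF that(1,2), of k] ell2_matsD[OF x that] by (simp add: LIMSEQ_const_iff)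
  ultimately show "y \<in> ell2_mats I m n" "column_norm I m n y \<le> L"
    using column_norm_le[OF _ L] by blast+
qed

text \<open>
  The pointwise product is completely contractive: put \<open>y = b z\<close>.  The coordinates
  \<open>k \<in> I\<close> of \<open>(a b) z\<close> are obtained by applying the single coordinate \<open>k\<close> of \<open>a\<close> to the scalar
  vector \<open>(y\<^sub>q(k))\<^sub>q\<close>, and the resulting estimates add up over \<open>k\<close>.
\<close>

lemma column_norm_mult:
  assumes a: "a \<in> ell2_mats I m p" and b: "b \<in> ell2_mats I p n"
  shows "(\<lambda>i j k. \<Sum>q<p. a i q k * b q j k) \<in> ell2_mats I m n"
    and "column_norm I m n (\<lambda>i j k. \<Sum>q<p. a i q k * b q j k) \<le> column_norm I m p a * column_norm I p n b"
proof -
  let ?A = "column_norm I m p a" and ?B = "column_norm I p n b"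
  have "column_bound I m n (\<lambda>i j k. \<Sum>q<p. a i q k * b q j k) (?A * ?B)"
    unfolding column_bound_def
  proof (intro allI impI)
    fix F z assume F: "finite F" "F \<subseteq> I"
    define y where "y = (\<lambda>q k. \<Sum>j<n. b q j k * z j)"
    have "(\<Sum>j<n. (\<Sum>q<p. a i q k * b q j k) * z j) = (\<Sum>q<p. a i q k * y q k)" for i k
      unfolding y_def sum_distrib_right sum_distrib_left by (subst sum.swap) (simp add: mult_ac)
    then have "(\<Sum>i<m. \<Sum>k\<in>F. (cmod (\<Sum>j<n. (\<Sum>q<p. a i q k * b q j k) * z j))\<^sup>2)
        = (\<Sum>k\<in>F. \<Sum>i<m. (cmod (\<Sum>q<p. a i q k * y q k))\<^sup>2)"
      by (simp add: sum.swap[of _ F])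
    also have "\<dots> \<le> (\<Sum>k\<in>F. ?A\<^sup>2 * (\<Sum>q<p. (cmod (y q k))\<^sup>2))"
    proof (rule sum_mono)
      fix k assume "k \<in> F"
      then show "(\<Sum>i<m. (cmod (\<Sum>q<p. a i q k * y q k))\<^sup>2) \<le> ?A\<^sup>2 * (\<Sum>q<p. (cmod (y q k))\<^sup>2)"
        using column_boundD[OF column_bound_column_norm[OF a], of "{k}" "\<lambda>q. y q k"] F by auto
    qed
    also have "\<dots> = ?A\<^sup>2 * (\<Sum>q<p. \<Sum>k\<in>F. (cmod (y q k))\<^sup>2)"
      by (simp add: sum_distrib_left[symmetric] sum.swap[of _ F])
    also have "\<dots> \<le> ?A\<^sup>2 * (?B\<^sup>2 * (\<Sum>j<n. (cmod (z j))\<^sup>2))"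
      unfolding y_def by (intro mult_left_mono column_boundD[OF column_bound_column_norm[OF b] F]) auto
    finally show "(\<Sum>i<m. \<Sum>k\<in>F. (cmod (\<Sum>j<n. (\<Sum>q<p. a i q k * b q j k) * z j))\<^sup>2)
        \<le> (?A * ?B)\<^sup>2 * (\<Sum>j<n. (cmod (z j))\<^sup>2)"
      by (simp add: power_mult_distrib mult.assoc)
  qed
  from column_norm_le[OF this] show "(\<lambda>i j k. \<Sum>q<p. a i q k * b q j k) \<in> ell2_mats I m n"
    "column_norm I m n (\<lambda>i j k. \<Sum>q<p. a i q k * b q j k) \<le> ?A * ?B"
    by (auto simp: ell2_matsD[OF b] column_norm_nonneg[OF a] column_norm_nonneg[OF b] intro!: sum.neutral)
qed

text \<open>
  Bilinear forms have this property.  Flipping the arguments preserves it, which transfers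
  factorisations from the column space to the row space.
\<close>

definition bihomogeneous :: "'i set \<Rightarrow> (('i \<Rightarrow> complex) \<Rightarrow> ('i \<Rightarrow> complex) \<Rightarrow> complex) \<Rightarrow> bool" where
  "bihomogeneous I B \<longleftrightarrow> (\<forall>c. \<forall>a\<in>ell2 I. \<forall>b\<in>ell2 I.
     B (\<lambda>k. c * a k) b = c * B a b \<and> B a (\<lambda>k. c * b k) = c * B a b)"

lemma bihomogeneous_zero:
  assumes "bihomogeneous I B" "a \<in> ell2 I"
  shows "B (\<lambda>_. 0) a = 0" "B a (\<lambda>_. 0) = 0"
proof -
  have "B (\<lambda>k. 0 * a k) a = 0 * B a a" "B a (\<lambda>k. 0 * a k) = 0 * B a a"
    using assms unfolding bihomogeneous_def by blast+
  then show "B (\<lambda>_. 0) a = 0" "B a (\<lambda>_. 0) = 0" by simp_all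
qed

text \<open>
  The matrix \<open>\<Sum>\<^sub>k\<^sub>\<in>\<^sub>F x(k) e\<^sub>k \<otimes> e\<^sub>k\<close> of diagonal tensors factors through the pairs
  \<open>(l, k)\<close> with \<open>l < n\<close> and \<open>k \<in> F\<close>: the left factor has entries \<open>\<delta>\<^sub>i\<^sub>l e\<^sub>k\<close> and is an
  isometry, and the right factor has entries \<open>x\<^sub>l\<^sub>j(k) e\<^sub>k\<close>, so that its norm is that of \<open>x\<close>
  truncated to \<open>F\<close>.
\<close>

lemma column_norm_diagonal_factorisation:
  assumes x: "x \<in> ell2_mats I n n" and F: "finite F" "F \<subseteq> I"
  shows "\<exists>p v w. v \<in> ell2_mats I n p \<and> w \<in> ell2_mats I p n \<and>
    column_norm I n p v * column_norm I p n w \<le> column_norm I n n x \<and>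
    (\<forall>B i j. bihomogeneous I B \<longrightarrow> i < n \<longrightarrow> j < n \<longrightarrow>
      (\<Sum>q<p. B (v i q) (w q j)) = (\<Sum>k\<in>F. x i j k * B (unit_vec k) (unit_vec k)))"
proof -
  let ?X = "{..<n} \<times> F" and ?C = "column_norm I n n x"
  obtain h where h: "bij_betw h {..<card ?X} ?X"
    using ex_bij_betw_nat_finite[of ?X] F by (auto simp: atLeast0LessThan)
  define p where "p = card ?X"
  have h: "bij_betw h {..<p} ?X" using h by (simp add: p_def)
  have reindex: "(\<Sum>q<p. f (h q)) = (\<Sum>l<n. \<Sum>k\<in>F. f (l, k))" for f :: "_ \<Rightarrow> 'x::comm_monoid_add"
    using sum.reindex_bij_betw[OF h, of f] by (simp add: sum.cartesian_product case_prod_unfold)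
  have hin: "fst (h q) < n" "snd (h q) \<in> F" if "q < p" for q
  proof -
    have "h q \<in> {..<n} \<times> F" using bij_betw_apply[OF h, of q] that by blast
    then show "fst (h q) < n" "snd (h q) \<in> F" by (simp_all add: mem_Times_iff)
  qed
  define v where "v = (\<lambda>i q. if fst (h q) = i then unit_vec (snd (h q)) else (\<lambda>_. 0::complex))"
  define w where "w = (\<lambda>q j k. x (fst (h q)) j (snd (h q)) * unit_vec (snd (h q)) k)"
  have unit: "unit_vec (snd (h q)) \<in> ell2 I" if "q < p" for q
    by (rule unit_vec_in_ell2) (rule subsetD[OF F(2) hin(2)[OF that]])
  have v: "v \<in> ell2_mats I n p" by (auto simp: v_def ell2_mats_def zero_in_ell2 unit)
  have "column_bound I n p v 1"
    unfolding column_bound_def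
  proof (intro allI impI)
    fix G and z :: "nat \<Rightarrow> complex" assume G: "finite G" "G \<subseteq> I"
    define g where "g = inv_into {..<p} h"
    have zg: "z q = z (g (h q))" if "q < p" for q
      using h that by (simp add: g_def bij_betw_def)
    have eq: "(\<Sum>q<p. v i q k * z q) = (if k \<in> F then z (g (i, k)) else 0)" if "i < n" for i k
    proof -
      have "(\<Sum>q<p. v i q k * z q)
          = (\<Sum>q<p. (\<lambda>y. (if fst y = i then unit_vec (snd y) k else 0) * z (g y)) (h q))"
        by (intro sum.cong) (auto simp: v_def zg)
      also have "\<dots> = (\<Sum>l<n. \<Sum>k'\<in>F. (if l = i then unit_vec k' k else 0) * z (g (l, k')))"
        by (subst reindex) (simp cong: if_cong)
      also have "\<dots> = (\<Sum>l<n. if l = i then \<Sum>k'\<in>F. unit_vec k' k * z (g (l, k')) else 0)"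
        by (intro sum.cong) auto
      also have "\<dots> = (\<Sum>k'\<in>F. unit_vec k' k * z (g (i, k')))" using that by simp
      also have "\<dots> = (\<Sum>k'\<in>F. if k = k' then z (g (i, k')) else 0)"
        by (intro sum.cong) (auto simp: unit_vec_def)
      finally show ?thesis using F by simp
    qed
    have "(\<Sum>i<n. \<Sum>k\<in>G. (cmod (\<Sum>q<p. v i q k * z q))\<^sup>2)
        = (\<Sum>i<n. \<Sum>k\<in>G. if k \<in> F then (cmod (z (g (i, k))))\<^sup>2 else 0)"
      by (intro sum.cong) (auto simp: eq)
    also have "\<dots> = (\<Sum>i<n. \<Sum>k\<in>G \<inter> F. (cmod (z (g (i, k))))\<^sup>2)"
      by (simp add: sum.inter_restrict[OF G(1)])
    also have "\<dots> \<le> (\<Sum>i<n. \<Sum>k\<in>F. (cmod (z (g (i, k))))\<^sup>2)"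
      by (intro sum_mono sum_mono2) (use F in auto)
    also have "\<dots> = (\<Sum>q<p. (cmod (z (g (h q))))\<^sup>2)" by (rule reindex[symmetric])
    also have "\<dots> = (\<Sum>q<p. (cmod (z q))\<^sup>2)" by (intro sum.cong) (auto simp: zg[symmetric])
    finally show "(\<Sum>i<n. \<Sum>k\<in>G. (cmod (\<Sum>q<p. v i q k * z q))\<^sup>2) \<le> 1\<^sup>2 * (\<Sum>q<p. (cmod (z q))\<^sup>2)"
      by simp
  qed
  then have v1: "column_norm I n p v \<le> 1" using column_norm_le_iff[OF v] by simp
  have "column_bound I p n w ?C"
    unfolding column_bound_def
  proof (intro allI impI)
    fix G and z :: "nat \<Rightarrow> complex" assume G: "finite G" "G \<subseteq> I"
    let ?s = "\<lambda>y. \<Sum>j<n. x (fst y) j (snd y) * z j"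
    have "(\<Sum>j<n. w q j k * z j) = unit_vec (snd (h q)) k * ?s (h q)" for q k
      by (simp add: w_def sum_distrib_left mult_ac)
    then have "(\<Sum>q<p. \<Sum>k\<in>G. (cmod (\<Sum>j<n. w q j k * z j))\<^sup>2)
        = (\<Sum>q<p. \<Sum>k\<in>G. if k = snd (h q) then (cmod (?s (h q)))\<^sup>2 else 0)"
      by (intro sum.cong) (auto simp: unit_vec_def)
    also have "\<dots> \<le> (\<Sum>q<p. (cmod (?s (h q)))\<^sup>2)"
      by (intro sum_mono) (use G in auto)
    also have "\<dots> = (\<Sum>i<n. \<Sum>k\<in>F. (cmod (\<Sum>j<n. x i j k * z j))\<^sup>2)"
      by (subst reindex) simp
    also have "\<dots> \<le> ?C\<^sup>2 * (\<Sum>j<n. (cmod (z j))\<^sup>2)"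
      by (rule column_boundD[OF column_bound_column_norm[OF x] F])
    finally show "(\<Sum>q<p. \<Sum>k\<in>G. (cmod (\<Sum>j<n. w q j k * z j))\<^sup>2) \<le> ?C\<^sup>2 * (\<Sum>j<n. (cmod (z j))\<^sup>2)" .
  qed
  moreover have "w q j k = 0" if "q < p" "k \<notin> I" for q j k
    using hin(2)[OF that(1)] that(2) F by (auto simp: w_def unit_vec_def)
  ultimately have w: "w \<in> ell2_mats I p n" "column_norm I p n w \<le> ?C"
    using column_norm_le[OF _ column_norm_nonneg[OF x]] by blast+
  have "column_norm I n p v * column_norm I p n w \<le> 1 * ?C"
    using v1 w column_norm_nonneg[OF v] column_norm_nonneg[OF w(1)] by (intro mult_mono) auto
  moreover have "(\<Sum>q<p. B (v i q) (w q j)) = (\<Sum>k\<in>F. x i j k * B (unit_vec k) (unit_vec k))"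
    if B: "bihomogeneous I B" and ij: "i < n" "j < n" for B i j
  proof -
    have "B (v i q) (w q j) = (\<lambda>y. if fst y = i then x (fst y) j (snd y) * B (unit_vec (snd y)) (unit_vec (snd y)) else 0) (h q)"
      if q: "q < p" for q
    proof (cases "fst (h q) = i")
      case True
      then show ?thesis using B unit[OF q] by (simp add: v_def w_def bihomogeneous_def)
    next
      case False
      have "w q j \<in> ell2 I" using w(1) q ij by (simp add: ell2_mats_def)
      then show ?thesis using False bihomogeneous_zero(1)[OF B] by (simp add: v_def)
    qed
    then have "(\<Sum>q<p. B (v i q) (w q j))
       = (\<Sum>l<n. \<Sum>k\<in>F. if l = i then x l j k * B (unit_vec k) (unit_vec k) else 0)"
      using reindex[of "\<lambda>y. if fst y = i then x (fst y) j (snd y) * B (unit_vec (snd y)) (unit_vec (snd y)) else 0"]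
      by (simp cong: if_cong)
    also have "\<dots> = (\<Sum>l<n. if l = i then \<Sum>k\<in>F. x i j k * B (unit_vec k) (unit_vec k) else 0)"
      by (intro sum.cong) auto
    finally show ?thesis using ij by simp
  qed
  ultimately show ?thesis using v w(1) by (intro exI[of _ p] exI[of _ v] exI[of _ w]) auto
qed

text \<open>
  The number \<open>N m n x\<close> is the norm of the rectangular matrix \<open>x\<close> in \<open>M\<^sub>m\<^sub>,\<^sub>n(A)\<close>.  Replacing it by
  \<open>N n m\<close> of the transpose of \<open>x\<close> leads to the same list of assumptions.
\<close>

locale hilbertian_algebra =
  fixes I :: "'i set" and A :: "('i \<Rightarrow> complex) opspace"
    and N :: "nat \<Rightarrow> nat \<Rightarrow> (nat \<Rightarrow> nat \<Rightarrow> 'i \<Rightarrow> complex) \<Rightarrow> real"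
  assumes carr_A: "carr A = ell2 I"
    and vadd_A: "vadd A = (\<lambda>x y i. x i + y i)"
    and vscale_A: "vscale A = (\<lambda>c x i. c * x i)"
    and mnorm_A: "x \<in> ell2_mats I n n \<Longrightarrow> mnorm A n x = N n n x"
    and rnorm_A: "x \<in> ell2_mats I m n \<Longrightarrow> rnorm A m n x = N m n x"
    and N_nonneg: "x \<in> ell2_mats I m n \<Longrightarrow> 0 \<le> N m n x"
    and N_cong: "x \<in> ell2_mats I m n \<Longrightarrow> (\<And>i j. i < m \<Longrightarrow> j < n \<Longrightarrow> x i j = y i j) \<Longrightarrow> N m n x = N m n y"
    and N_1_1: "a \<in> ell2 I \<Longrightarrow> N 1 1 (\<lambda>_ _. a) = ell2_norm I a"
    and N_scale: "x \<in> ell2_mats I m n \<Longrightarrow> N m n (\<lambda>i j k. c * x i j k) \<le> cmod c * N m n x"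
    and N_in_row: "x \<in> ell2_mats I 1 p \<Longrightarrow> N n p (\<lambda>i j. if i = r then x 0 j else (\<lambda>_. 0)) \<le> N 1 p x"
    and N_in_column: "x \<in> ell2_mats I p 1 \<Longrightarrow> N p n (\<lambda>i j. if j = r then x i 0 else (\<lambda>_. 0)) \<le> N p 1 x"
    and N_append_columns: "x \<in> ell2_mats I m p \<Longrightarrow> y \<in> ell2_mats I m q \<Longrightarrow>
      (N m (p + q) (\<lambda>i j. if j < p then x i j else y i (j - p)))\<^sup>2 \<le> (N m p x)\<^sup>2 + (N m q y)\<^sup>2"
    and N_append_rows: "x \<in> ell2_mats I p n \<Longrightarrow> y \<in> ell2_mats I q n \<Longrightarrow>
      (N (p + q) n (\<lambda>i j. if i < p then x i j else y (i - p) j))\<^sup>2 \<le> (N p n x)\<^sup>2 + (N q n y)\<^sup>2"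
    and N_limit: "(\<And>r. X r \<in> ell2_mats I m n) \<Longrightarrow> (\<And>r. N m n (X r) \<le> K r) \<Longrightarrow> K \<longlonglongrightarrow> L \<Longrightarrow>
      (\<And>i j k. i < m \<Longrightarrow> j < n \<Longrightarrow> (\<lambda>r. X r i j k) \<longlonglongrightarrow> y i j k) \<Longrightarrow>
      y \<in> ell2_mats I m n \<and> N m n y \<le> L"
    and N_mult: "x \<in> ell2_mats I m p \<Longrightarrow> y \<in> ell2_mats I p n \<Longrightarrow>
      (\<lambda>i j k. \<Sum>q<p. x i q k * y q j k) \<in> ell2_mats I m n \<and>
      N m n (\<lambda>i j k. \<Sum>q<p. x i q k * y q j k) \<le> N m p x * N p n y"
    and N_diagonal_factorisation: "x \<in> ell2_mats I n n \<Longrightarrow> finite F \<Longrightarrow> F \<subseteq> I \<Longrightarrow>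
      \<exists>p v w. v \<in> ell2_mats I n p \<and> w \<in> ell2_mats I p n \<and> N n p v * N p n w \<le> N n n x \<and>
        (\<forall>B i j. bihomogeneous I B \<longrightarrow> i < n \<longrightarrow> j < n \<longrightarrow>
          (\<Sum>q<p. B (v i q) (w q j)) = (\<Sum>k\<in>F. x i j k * B (unit_vec k) (unit_vec k)))"

lemma hilbertian_algebra_column: "hilbertian_algebra I (column_ell2 I) (column_norm I)"
proof
  show "column_norm I m n x = column_norm I m n y"
    if "x \<in> ell2_mats I m n" "\<And>i j. i < m \<Longrightarrow> j < n \<Longrightarrow> x i j = y i j" for x y m n
    by (rule column_norm_cong) (use that in auto)
  show "y \<in> ell2_mats I m n \<and> column_norm I m n y \<le> L"
    if "\<And>r. X r \<in> ell2_mats I m n" "\<And>r. column_norm I m n (X r) \<le> K r" "K \<longlonglongrightarrow> L"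
      "\<And>i j k. i < m \<Longrightarrow> j < n \<Longrightarrow> (\<lambda>r. X r i j k) \<longlonglongrightarrow> y i j k" for X y m n K L
    using column_norm_limit[OF that] by blast
qed (simp_all only: ell2_opspace_simps rnorm_column_ell2 column_norm_nonneg column_norm_1_1
    column_norm_scale column_norm_in_row column_norm_in_column column_norm_append_columns
    column_norm_append_rows column_norm_mult column_norm_diagonal_factorisation simp_thms)

lemma hilbertian_algebra_row:
  "hilbertian_algebra I (row_ell2 I) (\<lambda>m n x. column_norm I n m (\<lambda>i j. x j i))"
proof
  show "column_norm I n m (\<lambda>i j. x j i) = column_norm I n m (\<lambda>i j. y j i)"
    if "x \<in> ell2_mats I m n" "\<And>i j. i < m \<Longrightarrow> j < n \<Longrightarrow> x i j = y i j" for x y m n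
    by (rule column_norm_cong) (use that in \<open>auto simp: ell2_mats_def\<close>)
  show "y \<in> ell2_mats I m n \<and> column_norm I n m (\<lambda>i j. y j i) \<le> L"
    if "\<And>r. X r \<in> ell2_mats I m n" "\<And>r. column_norm I n m (\<lambda>i j. X r j i) \<le> K r" "K \<longlonglongrightarrow> L"
      "\<And>i j k. i < m \<Longrightarrow> j < n \<Longrightarrow> (\<lambda>r. X r i j k) \<longlonglongrightarrow> y i j k" for X y m n K L
  proof -
    have "(\<lambda>i j. X r j i) \<in> ell2_mats I n m" for r using that(1) by (simp add: ell2_mats_def)
    from column_norm_limit[OF this that(2,3), of "\<lambda>i j. y j i"] that(4)
    show ?thesis by (auto simp: ell2_mats_def)
  qed
  show "(\<lambda>i j k. \<Sum>q<p. x i q k * y q j k) \<in> ell2_mats I m n \<and>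
      column_norm I n m (\<lambda>i j k. \<Sum>q<p. x j q k * y q i k)
      \<le> column_norm I p m (\<lambda>i j. x j i) * column_norm I n p (\<lambda>i j. y j i)"
    if "x \<in> ell2_mats I m p" "y \<in> ell2_mats I p n" for x y m n p
  proof -
    have t: "(\<lambda>i j. y j i) \<in> ell2_mats I n p" "(\<lambda>i j. x j i) \<in> ell2_mats I p m"
      using that by (simp_all add: ell2_mats_def)
    have eq: "(\<lambda>i j k. \<Sum>q<p. y q i k * x j q k) = (\<lambda>i j k. \<Sum>q<p. x j q k * y q i k)"
      by (simp add: mult.commute)
    have "(\<lambda>i j k. \<Sum>q<p. x i q k * y q j k) \<in> ell2_mats I m n"
      using column_norm_mult(1)[OF t]
      unfolding eq by (simp add: ell2_mats_def)
    then show ?thesis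
      using column_norm_mult(2)[OF t] unfolding eq by (simp add: mult.commute)
  qed
  show "\<exists>p v w. v \<in> ell2_mats I n p \<and> w \<in> ell2_mats I p n \<and>
      column_norm I p n (\<lambda>i j. v j i) * column_norm I n p (\<lambda>i j. w j i) \<le> column_norm I n n (\<lambda>i j. x j i) \<and>
        (\<forall>B i j. bihomogeneous I B \<longrightarrow> i < n \<longrightarrow> j < n \<longrightarrow>
          (\<Sum>q<p. B (v i q) (w q j)) = (\<Sum>k\<in>F. x i j k * B (unit_vec k) (unit_vec k)))"
    if x: "x \<in> ell2_mats I n n" and F: "finite F" "F \<subseteq> I" for x n F
  proof -
    have "(\<lambda>i j. x j i) \<in> ell2_mats I n n" using x by (simp add: ell2_mats_def)
    from column_norm_diagonal_factorisation[OF this F] obtain p v w where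
      vw: "v \<in> ell2_mats I n p" "w \<in> ell2_mats I p n"
        "column_norm I n p v * column_norm I p n w \<le> column_norm I n n (\<lambda>i j. x j i)"
        and B: "\<And>B i j. bihomogeneous I B \<Longrightarrow> i < n \<Longrightarrow> j < n \<Longrightarrow>
          (\<Sum>q<p. B (v i q) (w q j)) = (\<Sum>k\<in>F. x j i k * B (unit_vec k) (unit_vec k))"
      by blast
    have "(\<Sum>q<p. B (w q i) (v j q)) = (\<Sum>k\<in>F. x i j k * B (unit_vec k) (unit_vec k))"
      if "bihomogeneous I B" "i < n" "j < n" for B i j
    proof -
      have "bihomogeneous I (\<lambda>a b. B b a)" using that(1) by (auto simp: bihomogeneous_def)
      from B[OF this that(3,2)] show ?thesis .
    qed
    with vw show ?thesis
      by (intro exI[of _ p] exI[of _ "\<lambda>i q. w q i"] exI[of _ "\<lambda>q j. v j q"])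
        (auto simp: ell2_mats_def mult.commute)
  qed
next
  fix m p q :: nat and x y assume "x \<in> ell2_mats I m p" "y \<in> ell2_mats I m q"
  then show "(column_norm I (p + q) m (\<lambda>i j. if i < p then x j i else y j (i - p)))\<^sup>2
      \<le> (column_norm I p m (\<lambda>i j. x j i))\<^sup>2 + (column_norm I q m (\<lambda>i j. y j i))\<^sup>2"
    by (intro column_norm_append_rows) (simp_all add: ell2_mats_def)
next
  fix n p q :: nat and x y assume "x \<in> ell2_mats I p n" "y \<in> ell2_mats I q n"
  then show "(column_norm I n (p + q) (\<lambda>i j. if j < p then x j i else y (j - p) i))\<^sup>2
      \<le> (column_norm I n p (\<lambda>i j. x j i))\<^sup>2 + (column_norm I n q (\<lambda>i j. y j i))\<^sup>2"
    by (intro column_norm_append_columns) (simp_all add: ell2_mats_def)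
next
  fix p n r :: nat and x assume "x \<in> ell2_mats I 1 p"
  then show "column_norm I p n (\<lambda>i j. if j = r then x 0 i else (\<lambda>_. 0)) \<le> column_norm I p 1 (\<lambda>i j. x j i)"
    by (intro column_norm_in_column) (simp add: ell2_mats_def)
next
  fix p n r :: nat and x assume "x \<in> ell2_mats I p 1"
  then show "column_norm I n p (\<lambda>i j. if i = r then x j 0 else (\<lambda>_. 0)) \<le> column_norm I 1 p (\<lambda>i j. x j i)"
    by (intro column_norm_in_row) (simp add: ell2_mats_def)
next
  fix m n :: nat and x and c :: complex assume "x \<in> ell2_mats I m n"
  then show "column_norm I n m (\<lambda>i j k. c * x j i k) \<le> cmod c * column_norm I n m (\<lambda>i j. x j i)"
    by (intro column_norm_scale(2)) (simp add: ell2_mats_def)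
next
  fix m n :: nat and x assume "x \<in> ell2_mats I m n"
  then show "0 \<le> column_norm I n m (\<lambda>i j. x j i)"
    by (intro column_norm_nonneg) (simp add: ell2_mats_def)
qed (simp_all add: mnorm_row_ell2 rnorm_row_ell2 column_norm_1_1[simplified])


section \<open>Completions\<close>

text \<open>
  Because of the last assumption, matrices whose entries are Cauchy sequences have convergent norms.
\<close>

locale matrix_seminormed =
  fixes V :: "('b \<Rightarrow> complex) opspace"
  assumes vadd_V: "vadd V = (\<lambda>s t b. s b + t b)"
    and vscale_V: "vscale V = (\<lambda>c t b. c * t b)"
    and zero_carr: "(\<lambda>_. 0) \<in> carr V"
    and add_carr: "s \<in> carr V \<Longrightarrow> t \<in> carr V \<Longrightarrow> (\<lambda>b. s b + t b) \<in> carr V"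
    and scale_carr: "s \<in> carr V \<Longrightarrow> (\<lambda>b. c * s b) \<in> carr V"
    and mnorm_nonneg: "u \<in> mats V n n \<Longrightarrow> 0 \<le> mnorm V n u"
    and mnorm_add: "u \<in> mats V n n \<Longrightarrow> v \<in> mats V n n \<Longrightarrow>
      mnorm V n (\<lambda>i j b. u i j b + v i j b) \<le> mnorm V n u + mnorm V n v"
    and mnorm_scale: "u \<in> mats V n n \<Longrightarrow> mnorm V n (\<lambda>i j b. c * u i j b) \<le> cmod c * mnorm V n u"
    and mnorm_le_sum: "u \<in> mats V n n \<Longrightarrow> mnorm V n u \<le> (\<Sum>i<n. \<Sum>j<n. vnorm V (u i j))"
begin

lemma diff_carr: "s \<in> carr V \<Longrightarrow> t \<in> carr V \<Longrightarrow> (\<lambda>b. s b - t b) \<in> carr V"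
  using add_carr[of s "\<lambda>b. -1 * t b"] scale_carr[of t "-1"] by simp

lemma vsub_V: "vsub V s t = (\<lambda>b. s b - t b)"
  by (simp add: vsub_def vadd_V vscale_V)

definition d :: "('b \<Rightarrow> complex) \<Rightarrow> ('b \<Rightarrow> complex) \<Rightarrow> real" where
  "d s t = vnorm V (\<lambda>b. s b - t b)"

lemma const_mats: "s \<in> carr V \<Longrightarrow> (\<lambda>_ _. s) \<in> mats V n m"
  by (simp add: mats_def)

lemma vnorm_nonneg: "s \<in> carr V \<Longrightarrow> 0 \<le> vnorm V s"
  unfolding vnorm_def by (intro mnorm_nonneg const_mats)

lemma vnorm_add: "s \<in> carr V \<Longrightarrow> t \<in> carr V \<Longrightarrow> vnorm V (\<lambda>b. s b + t b) \<le> vnorm V s + vnorm V t"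
  unfolding vnorm_def by (rule mnorm_add) (auto intro: const_mats)

lemma vnorm_scale: "s \<in> carr V \<Longrightarrow> vnorm V (\<lambda>b. c * s b) \<le> cmod c * vnorm V s"
  unfolding vnorm_def by (rule mnorm_scale) (auto intro: const_mats)

lemma d_nonneg: "s \<in> carr V \<Longrightarrow> t \<in> carr V \<Longrightarrow> 0 \<le> d s t"
  unfolding d_def by (intro vnorm_nonneg diff_carr)

lemma d_refl: "s \<in> carr V \<Longrightarrow> d s s = 0"
  using vnorm_scale[of s 0] vnorm_nonneg[OF zero_carr] by (simp add: d_def)

lemma d_sym: assumes "s \<in> carr V" "t \<in> carr V" shows "d s t = d t s"
proof -
  have "d s t \<le> d t s" if "s \<in> carr V" "t \<in> carr V" for s t
    using vnorm_scale[OF diff_carr[OF that(2,1)], of "-1"] by (simp add: d_def)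
  then show ?thesis using assms by (simp add: antisym)
qed

lemma d_triangle: "r \<in> carr V \<Longrightarrow> s \<in> carr V \<Longrightarrow> t \<in> carr V \<Longrightarrow> d r t \<le> d r s + d s t"
  using vnorm_add[OF diff_carr[of r s] diff_carr[of s t]] by (simp add: d_def)

lemma d_add:
  assumes "s \<in> carr V" "s' \<in> carr V" "t \<in> carr V" "t' \<in> carr V"
  shows "d (\<lambda>b. s b + t b) (\<lambda>b. s' b + t' b) \<le> d s s' + d t t'"
  using vnorm_add[OF diff_carr[of s s'] diff_carr[of t t']] assms by (simp add: d_def algebra_simps)

lemma d_scale:
  assumes "s \<in> carr V" "t \<in> carr V"
  shows "d (\<lambda>b. c * s b) (\<lambda>b. c * t b) \<le> cmod c * d s t"
  using vnorm_scale[OF diff_carr[OF assms], of c] by (simp add: d_def algebra_simps)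

lemma mnorm_diff:
  assumes u: "u \<in> mats V n n" and v: "v \<in> mats V n n"
  shows "\<bar>mnorm V n u - mnorm V n v\<bar> \<le> (\<Sum>i<n. \<Sum>j<n. d (u i j) (v i j))"
proof -
  have *: "mnorm V n u \<le> mnorm V n v + (\<Sum>i<n. \<Sum>j<n. d (u i j) (v i j))"
    if u: "u \<in> mats V n n" and v: "v \<in> mats V n n" for u v
  proof -
    have uv: "(\<lambda>i j b. u i j b - v i j b) \<in> mats V n n" using u v by (simp add: mats_def diff_carr)
    show ?thesis using mnorm_add[OF v uv] mnorm_le_sum[OF uv] by (simp add: d_def)
  qed
  have "d (u i j) (v i j) = d (v i j) (u i j)" if "i < n" "j < n" for i j
    using u v that by (intro d_sym) (auto simp: mats_def)
  then have "(\<Sum>i<n. \<Sum>j<n. d (u i j) (v i j)) = (\<Sum>i<n. \<Sum>j<n. d (v i j) (u i j))" by simp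
  then show ?thesis using *[OF u v] *[OF v u] by linarith
qed

lemma cauchy_seqs_iff:
  "s \<in> cauchy_seqs V \<longleftrightarrow> (\<forall>k. s k \<in> carr V) \<and> (\<forall>e>0. \<exists>M. \<forall>k\<ge>M. \<forall>l\<ge>M. d (s k) (s l) < e)"
  by (simp add: cauchy_seqs_def vsub_V d_def)

lemma cauchy_seqs_carr: "s \<in> cauchy_seqs V \<Longrightarrow> s k \<in> carr V"
  by (simp add: cauchy_seqs_iff)

lemma cauchy_rel_iff:
  "(s, t) \<in> cauchy_rel V \<longleftrightarrow> s \<in> cauchy_seqs V \<and> t \<in> cauchy_seqs V \<and> (\<lambda>k. d (s k) (t k)) \<longlonglongrightarrow> 0"
  by (simp add: cauchy_rel_def vsub_V d_def)

lemma equiv_cauchy_rel: "equiv (cauchy_seqs V) (cauchy_rel V)"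
proof (rule equivI)
  show "cauchy_rel V \<subseteq> cauchy_seqs V \<times> cauchy_seqs V" by (auto simp: cauchy_rel_iff)
  show "refl_on (cauchy_seqs V) (cauchy_rel V)"
    by (rule refl_onI) (simp_all add: cauchy_rel_iff d_refl cauchy_seqs_carr)
  show "sym (cauchy_rel V)"
    by (rule symI) (auto simp: cauchy_rel_iff d_sym cauchy_seqs_carr)
  show "trans (cauchy_rel V)"
  proof (rule transI)
    fix r s t assume rs: "(r, s) \<in> cauchy_rel V" and st: "(s, t) \<in> cauchy_rel V"
    then have c: "r \<in> cauchy_seqs V" "s \<in> cauchy_seqs V" "t \<in> cauchy_seqs V" by (auto simp: cauchy_rel_iff)
    have "(\<lambda>k. d (r k) (s k) + d (s k) (t k)) \<longlonglongrightarrow> 0"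
      using tendsto_add[of "\<lambda>k. d (r k) (s k)" 0 _ "\<lambda>k. d (s k) (t k)" 0] rs st
      by (auto simp: cauchy_rel_iff)
    then have "(\<lambda>k. d (r k) (t k)) \<longlonglongrightarrow> 0"
      by (rule tendsto_sandwich[OF _ _ tendsto_const, rotated 2])
        (simp_all add: d_nonneg d_triangle cauchy_seqs_carr[OF c(1)] cauchy_seqs_carr[OF c(2)] cauchy_seqs_carr[OF c(3)])
    then show "(r, t) \<in> cauchy_rel V" using c by (simp add: cauchy_rel_iff)
  qed
qed

abbreviation H where "H \<equiv> os_completion V"

lemma carr_H: "carr H = cauchy_seqs V // cauchy_rel V" by (simp add: os_completion_def)

lemma class_carr_H: "s \<in> cauchy_seqs V \<Longrightarrow> cauchy_class V s \<in> carr H"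
  by (simp add: carr_H cauchy_class_def quotientI)

lemma mem_class: "s \<in> cauchy_seqs V \<Longrightarrow> s \<in> cauchy_class V s"
  unfolding cauchy_class_def using equiv_cauchy_rel by (rule equiv_class_self)

lemma mem_class_iff: "t \<in> cauchy_class V s \<longleftrightarrow> (s, t) \<in> cauchy_rel V"
  by (simp add: cauchy_class_def)

lemma mem_carr_H:
  assumes "P \<in> carr H" "s \<in> P"
  shows "s \<in> cauchy_seqs V" "P = cauchy_class V s"
proof -
  obtain t where t: "t \<in> cauchy_seqs V" "P = cauchy_class V t"
    using assms(1) by (auto simp: carr_H cauchy_class_def elim: quotientE)
  then have "(t, s) \<in> cauchy_rel V" using assms(2) by (simp add: mem_class_iff)
  then show "s \<in> cauchy_seqs V" "P = cauchy_class V s"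
    using t(2) equiv_class_eq[OF equiv_cauchy_rel] by (auto simp: cauchy_rel_iff cauchy_class_def)
qed

lemma rep_mem: "P \<in> carr H \<Longrightarrow> cauchy_rep P \<in> P"
  unfolding cauchy_rep_def carr_H using equiv_cauchy_rel in_quotient_imp_non_empty some_in_eq by metis

lemma carr_H_eqI: "P \<in> carr H \<Longrightarrow> Q \<in> carr H \<Longrightarrow> s \<in> P \<Longrightarrow> s \<in> Q \<Longrightarrow> P = Q"
  using mem_carr_H(2) by metis

lemma mems_dist: "P \<in> carr H \<Longrightarrow> s \<in> P \<Longrightarrow> t \<in> P \<Longrightarrow> (\<lambda>k. d (s k) (t k)) \<longlonglongrightarrow> 0"
  using mem_carr_H(2) mem_class_iff cauchy_rel_iff by metis

lemma add_cauchy: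
  assumes s: "s \<in> cauchy_seqs V" and t: "t \<in> cauchy_seqs V"
  shows "(\<lambda>k b. s k b + t k b) \<in> cauchy_seqs V"
  unfolding cauchy_seqs_iff
proof (intro conjI allI impI)
  show "(\<lambda>b. s k b + t k b) \<in> carr V" for k by (intro add_carr cauchy_seqs_carr s t)
  fix e :: real assume "0 < e"
  then have e: "0 < e / 2" by simp
  obtain M1 where M1: "\<And>k l. k \<ge> M1 \<Longrightarrow> l \<ge> M1 \<Longrightarrow> d (s k) (s l) < e / 2"
    using s e unfolding cauchy_seqs_iff by blast
  obtain M2 where M2: "\<And>k l. k \<ge> M2 \<Longrightarrow> l \<ge> M2 \<Longrightarrow> d (t k) (t l) < e / 2"
    using t e unfolding cauchy_seqs_iff by blast
  have "d (\<lambda>b. s k b + t k b) (\<lambda>b. s l b + t l b) < e" if "k \<ge> max M1 M2" "l \<ge> max M1 M2" for k l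
    using d_add[of "s k" "s l" "t k" "t l"] M1[of k l] M2[of k l] that s t cauchy_seqs_carr by fastforce
  then show "\<exists>M. \<forall>k\<ge>M. \<forall>l\<ge>M. d (\<lambda>b. s k b + t k b) (\<lambda>b. s l b + t l b) < e" by blast
qed

lemma scale_cauchy:
  assumes s: "s \<in> cauchy_seqs V"
  shows "(\<lambda>k b. c * s k b) \<in> cauchy_seqs V"
  unfolding cauchy_seqs_iff
proof (intro conjI allI impI)
  show "(\<lambda>b. c * s k b) \<in> carr V" for k by (intro scale_carr cauchy_seqs_carr s)
  fix e :: real assume e: "0 < e"
  have c: "0 < cmod c + 1" by (simp add: add_nonneg_pos)
  then have "0 < e / (cmod c + 1)" using e by simp
  then obtain M where M: "\<And>k l. k \<ge> M \<Longrightarrow> l \<ge> M \<Longrightarrow> d (s k) (s l) < e / (cmod c + 1)"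
    using s unfolding cauchy_seqs_iff by blast
  have "d (\<lambda>b. c * s k b) (\<lambda>b. c * s l b) < e" if "k \<ge> M" "l \<ge> M" for k l
  proof -
    have sk: "s k \<in> carr V" "s l \<in> carr V" using s cauchy_seqs_carr by auto
    have "d (\<lambda>b. c * s k b) (\<lambda>b. c * s l b) \<le> (cmod c + 1) * d (s k) (s l)"
      using d_scale[OF sk, of c] d_nonneg[OF sk] by (simp add: distrib_right)
    also have "\<dots> < e" using M[OF that] c by (simp add: pos_less_divide_eq mult.commute)
    finally show ?thesis .
  qed
  then show "\<exists>M. \<forall>k\<ge>M. \<forall>l\<ge>M. d (\<lambda>b. c * s k b) (\<lambda>b. c * s l b) < e" by blast
qed

lemma const_cauchy: "v \<in> carr V \<Longrightarrow> (\<lambda>_. v) \<in> cauchy_seqs V"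
  by (simp add: cauchy_seqs_iff d_refl)

lemma embed_carr: "v \<in> carr V \<Longrightarrow> completion_embed V v \<in> carr H"
  by (simp add: completion_embed_def class_carr_H const_cauchy)

lemma embed_mem: "v \<in> carr V \<Longrightarrow> (\<lambda>_. v) \<in> completion_embed V v"
  by (simp add: completion_embed_def mem_class const_cauchy)

lemma vadd_H:
  assumes P: "P \<in> carr H" and Q: "Q \<in> carr H" and s: "s \<in> P" and t: "t \<in> Q"
  shows "vadd H P Q \<in> carr H" "(\<lambda>k b. s k b + t k b) \<in> vadd H P Q"
proof -
  let ?s = "cauchy_rep P" and ?t = "cauchy_rep Q"
  note s' = rep_mem[OF P] and t' = rep_mem[OF Q]
  note c = mem_carr_H(1)[OF P s] mem_carr_H(1)[OF P s'] mem_carr_H(1)[OF Q t] mem_carr_H(1)[OF Q t']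
  have eq: "vadd H P Q = cauchy_class V (\<lambda>k b. ?s k b + ?t k b)"
    by (simp add: os_completion_def vadd_V)
  show "vadd H P Q \<in> carr H" unfolding eq by (intro class_carr_H add_cauchy c)
  have "(\<lambda>k. d (?s k) (s k) + d (?t k) (t k)) \<longlonglongrightarrow> 0"
    using tendsto_add[OF mems_dist[OF P s' s] mems_dist[OF Q t' t]] by simp
  then have "(\<lambda>k. d (\<lambda>b. ?s k b + ?t k b) (\<lambda>b. s k b + t k b)) \<longlonglongrightarrow> 0"
    by (rule tendsto_sandwich[OF _ _ tendsto_const, rotated 2])
      (simp_all add: d_nonneg d_add add_carr c[THEN cauchy_seqs_carr])
  then show "(\<lambda>k b. s k b + t k b) \<in> vadd H P Q"
    unfolding eq mem_class_iff cauchy_rel_iff by (intro conjI add_cauchy c)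
qed

lemma vscale_H:
  assumes P: "P \<in> carr H" and s: "s \<in> P"
  shows "vscale H c P \<in> carr H" "(\<lambda>k b. c * s k b) \<in> vscale H c P"
proof -
  let ?s = "cauchy_rep P"
  note s' = rep_mem[OF P]
  note c = mem_carr_H(1)[OF P s] mem_carr_H(1)[OF P s']
  have eq: "vscale H c P = cauchy_class V (\<lambda>k b. c * ?s k b)"
    by (simp add: os_completion_def vscale_V)
  show "vscale H c P \<in> carr H" unfolding eq by (intro class_carr_H scale_cauchy c)
  have "(\<lambda>k. cmod c * d (?s k) (s k)) \<longlonglongrightarrow> 0"
    using tendsto_mult_left[OF mems_dist[OF P s' s]] by simp
  then have "(\<lambda>k. d (\<lambda>b. c * ?s k b) (\<lambda>b. c * s k b)) \<longlonglongrightarrow> 0"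
    by (rule tendsto_sandwich[OF _ _ tendsto_const, rotated 2])
      (simp_all add: d_nonneg d_scale scale_carr c[THEN cauchy_seqs_carr])
  then show "(\<lambda>k b. c * s k b) \<in> vscale H c P"
    unfolding eq mem_class_iff cauchy_rel_iff by (intro conjI scale_cauchy c)
qed

lemma vsub_H:
  assumes P: "P \<in> carr H" and Q: "Q \<in> carr H" and s: "s \<in> P" and t: "t \<in> Q"
  shows "vsub H P Q \<in> carr H" "(\<lambda>k b. s k b - t k b) \<in> vsub H P Q"
  using vadd_H[OF P vscale_H(1)[OF Q t] s vscale_H(2)[OF Q t], of "-1"] by (simp_all add: vsub_def)

text \<open>
  The norm on the completion is defined with chosen representatives.  Any other representatives
  of the entries give the same limit, since the norms of two matrices differ by at most the sum of
  the distances of their entries.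
\<close>

lemma mnorm_H:
  assumes P: "P \<in> mats H n n" and s: "\<And>i j. i < n \<Longrightarrow> j < n \<Longrightarrow> s i j \<in> P i j"
  shows "(\<lambda>k. mnorm V n (\<lambda>i j. s i j k)) \<longlonglongrightarrow> mnorm H n P"
proof -
  define r where "r = (\<lambda>i j. cauchy_rep (P i j))"
  have PH: "P i j \<in> carr H" if "i < n" "j < n" for i j using P that by (simp add: mats_def)
  have r: "r i j \<in> P i j" if "i < n" "j < n" for i j using PH[OF that] by (simp add: r_def rep_mem)
  have rm: "(\<lambda>i j. r i j k) \<in> mats V n n" for k
    using mem_carr_H(1)[OF PH r] by (simp add: mats_def cauchy_seqs_carr)
  have sm: "(\<lambda>i j. s i j k) \<in> mats V n n" for k
    using mem_carr_H(1)[OF PH s] by (simp add: mats_def cauchy_seqs_carr)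
  define X where "X = (\<lambda>k. mnorm V n (\<lambda>i j. r i j k))"
  have "Cauchy X"
  proof (rule metric_CauchyI)
    fix e :: real assume e: "0 < e"
    define e' where "e' = e / (real n * real n + 1)"
    have n1: "0 < real n * real n + 1" by (simp add: add_nonneg_pos)
    then have e': "0 < e'" using e by (simp add: e'_def)
    have "\<exists>M. \<forall>k\<ge>M. \<forall>l\<ge>M. d (r i j k) (r i j l) < e'" if "i < n" "j < n" for i j
      using mem_carr_H(1)[OF PH r, OF that that] e' unfolding cauchy_seqs_iff by blast
    then obtain M where M: "\<And>i j k l. i < n \<Longrightarrow> j < n \<Longrightarrow> k \<ge> M i j \<Longrightarrow> l \<ge> M i j \<Longrightarrow> d (r i j k) (r i j l) < e'"
      by metis
    \<comment> \<open>The sum is a common upper bound of the finitely many \<open>M i j\<close>.\<close>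
    define M' where "M' = (\<Sum>i<n. \<Sum>j<n. M i j)"
    have MM': "M i j \<le> M'" if "i < n" "j < n" for i j
    proof -
      have "M i j \<le> (\<Sum>j<n. M i j)" using that by (intro member_le_sum) auto
      also have "\<dots> \<le> M'" unfolding M'_def
        using that by (intro member_le_sum[of i "{..<n}" "\<lambda>i. \<Sum>j<n. M i j"]) auto
      finally show ?thesis .
    qed
    have "dist (X k) (X l) < e" if kl: "k \<ge> M'" "l \<ge> M'" for k l
    proof -
      have "M i j \<le> k" "M i j \<le> l" if "i < n" "j < n" for i j
        using MM'[OF that] kl by linarith+
      note kl' = this
      have "dist (X k) (X l) \<le> (\<Sum>i<n. \<Sum>j<n. d (r i j k) (r i j l))"
        unfolding X_def dist_real_def by (rule mnorm_diff[OF rm rm])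
      also have "\<dots> \<le> (\<Sum>i<n. \<Sum>j<n. e')"
        by (intro sum_mono less_imp_le M kl') auto
      also have "\<dots> = real n * real n * e'" by simp
      also have "\<dots> < (real n * real n + 1) * e'" using e' by (simp add: distrib_right)
      also have "\<dots> = e" using n1 by (simp add: e'_def)
      finally show ?thesis .
    qed
    then show "\<exists>M. \<forall>k\<ge>M. \<forall>l\<ge>M. dist (X k) (X l) < e" by blast
  qed
  then have "X \<longlonglongrightarrow> lim X" by (simp add: Cauchy_convergent_iff convergent_LIMSEQ_iff)
  also have "lim X = mnorm H n P" by (simp add: os_completion_def X_def r_def)
  finally have X: "X \<longlonglongrightarrow> mnorm H n P" .
  have z: "(\<lambda>k. \<Sum>i<n. \<Sum>j<n. d (s i j k) (r i j k)) \<longlonglongrightarrow> 0"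
    by (intro tendsto_null_sum) (auto intro: mems_dist[OF PH s r])
  have "(\<lambda>k. mnorm V n (\<lambda>i j. s i j k) - X k) \<longlonglongrightarrow> 0"
    by (rule Lim_null_comparison[OF _ z])
      (use mnorm_diff[OF sm rm] in \<open>auto simp: X_def\<close>)
  from tendsto_add[OF this X] show ?thesis by simp
qed

lemma vnorm_H:
  assumes "P \<in> carr H" "s \<in> P"
  shows "(\<lambda>k. vnorm V (s k)) \<longlonglongrightarrow> vnorm H P"
  unfolding vnorm_def using mnorm_H[of "\<lambda>_ _. P" 1 "\<lambda>_ _. s"] assms by (simp add: mats_def)

end

section \<open>The Haagerup norm on the algebraic tensor product\<close>

definition restrict0 :: "'i set \<Rightarrow> ('i \<Rightarrow> complex) \<Rightarrow> 'i \<Rightarrow> complex" where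
  "restrict0 F x = (\<lambda>i. if i \<in> F then x i else 0)"

lemma ell2_norm_triangle:
  assumes x: "x \<in> ell2 I" and y: "y \<in> ell2 I"
  shows "(\<lambda>i. x i + y i) \<in> ell2 I" "ell2_norm I (\<lambda>i. x i + y i) \<le> ell2_norm I x + ell2_norm I y"
proof -
  have sq: "(L2_set f A)\<^sup>2 = (\<Sum>a\<in>A. (f a)\<^sup>2)" for f :: "'a \<Rightarrow> real" and A
    by (simp add: L2_set_def sum_nonneg)
  have le: "L2_set (\<lambda>i. cmod (x i)) F \<le> ell2_norm I x" if "finite F" "F \<subseteq> I" "x \<in> ell2 I" for F x
    using sum_le_ell2_norm_square[of x I F] that
    by (intro power2_le_imp_le[OF _ ell2_norm_nonneg]) (auto simp: sq ell2_def)
  have *: "(\<Sum>i\<in>F. (cmod (x i + y i))\<^sup>2) \<le> (ell2_norm I x + ell2_norm I y)\<^sup>2" if F: "finite F" "F \<subseteq> I" for F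
  proof -
    have "L2_set (\<lambda>i. cmod (x i + y i)) F \<le> L2_set (\<lambda>i. cmod (x i) + cmod (y i)) F"
      by (intro L2_set_mono norm_triangle_ineq) auto
    also have "\<dots> \<le> L2_set (\<lambda>i. cmod (x i)) F + L2_set (\<lambda>i. cmod (y i)) F"
      by (rule L2_set_triangle_ineq)
    also have "\<dots> \<le> ell2_norm I x + ell2_norm I y" by (intro add_mono le F x y)
    finally have "(L2_set (\<lambda>i. cmod (x i + y i)) F)\<^sup>2 \<le> (ell2_norm I x + ell2_norm I y)\<^sup>2"
      by (intro power_mono L2_set_nonneg)
    then show ?thesis by (simp add: sq)
  qed
  show "(\<lambda>i. x i + y i) \<in> ell2 I" "ell2_norm I (\<lambda>i. x i + y i) \<le> ell2_norm I x + ell2_norm I y"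
    using ell2_norm_le[OF *] ell2_norm_nonneg[of I x] ell2_norm_nonneg[of I y] x y
    by (auto simp: ell2_def)
qed

lemma scale_in_ell2: "x \<in> ell2 I \<Longrightarrow> (\<lambda>i. c * x i) \<in> ell2 I"
  by (auto simp: ell2_def norm_mult power_mult_distrib intro: summable_on_cmult_right)

lemma restrict0_in_ell2: "finite F \<Longrightarrow> F \<subseteq> I \<Longrightarrow> restrict0 F x \<in> ell2 I"
  by (rule ell2_finite_support[of F]) (auto simp: restrict0_def)

lemma restrict0_Compl_in_ell2:
  assumes "x \<in> ell2 I" shows "restrict0 (- F) x \<in> ell2 I"
proof -
  have "(\<lambda>i. (cmod (restrict0 (- F) x i))\<^sup>2) summable_on I"
    by (rule summable_on_comparison_test[of "\<lambda>i. (cmod (x i))\<^sup>2"])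
      (use assms in \<open>auto simp: ell2_def restrict0_def\<close>)
  then show ?thesis using assms by (auto simp: ell2_def restrict0_def)
qed

lemma ell2_norm_restrict0_Compl_tendsto:
  assumes x: "x \<in> ell2 I"
  shows "((\<lambda>F. ell2_norm I (restrict0 (- F) x)) \<longlongrightarrow> 0) (finite_subsets_at_top I)"
proof -
  let ?f = "\<lambda>i. (cmod (x i))\<^sup>2"
  have s: "?f summable_on I" using x by (simp add: ell2_def)
  have "((\<lambda>F. sqrt (infsum ?f I - sum ?f F)) \<longlongrightarrow> sqrt (infsum ?f I - infsum ?f I)) (finite_subsets_at_top I)"
    by (intro tendsto_intros infsum_tendsto s)
  then have "((\<lambda>F. sqrt (infsum ?f I - sum ?f F)) \<longlongrightarrow> 0) (finite_subsets_at_top I)" by simp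
  then show ?thesis
  proof (rule Lim_transform_eventually)
    show "\<forall>\<^sub>F F in finite_subsets_at_top I. sqrt (infsum ?f I - sum ?f F) = ell2_norm I (restrict0 (- F) x)"
    proof (rule eventually_finite_subsets_at_top_weakI)
      fix F assume F: "finite F" "F \<subseteq> I"
      have "(\<Sum>\<^sub>\<infinity>i\<in>I. (cmod (restrict0 (- F) x i))\<^sup>2) = infsum ?f (I - F)"
        by (rule infsum_cong_neutral) (auto simp: restrict0_def)
      also have "\<dots> = infsum ?f I - sum ?f F"
        using infsum_Diff[OF s summable_on_finite[OF F(1)] F(2)] F by simp
      finally show "sqrt (infsum ?f I - sum ?f F) = ell2_norm I (restrict0 (- F) x)"
        by (simp add: ell2_norm_def)
    qed
  qed
qed

context hilbertian_algebra
begin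

abbreviation T where "T \<equiv> alg_haagerup A A"

abbreviation tensor (infixl "\<otimes>" 75) where "a \<otimes> b \<equiv> elem_tensor A A a b"

lemma mats_A: "mats A m n = ell2_mats I m n"
  by (simp add: mats_def ell2_mats_def carr_A)

lemma bilinear_forms_bihomogeneous: "B \<in> bilinear_forms A A \<Longrightarrow> bihomogeneous I B"
  by (auto simp: bilinear_forms_def bihomogeneous_def carr_A vscale_A)

lemma tensor_scale:
  assumes "a \<in> ell2 I" "b \<in> ell2 I"
  shows "((\<lambda>k. c * a k) \<otimes> b) B = c * (a \<otimes> b) B" "(a \<otimes> (\<lambda>k. c * b k)) B = c * (a \<otimes> b) B"
  using assms bilinear_forms_bihomogeneous[of B] by (auto simp: elem_tensor_def bihomogeneous_def)

lemma tensor_add: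
  assumes "a \<in> ell2 I" "a' \<in> ell2 I" "b \<in> ell2 I"
  shows "((\<lambda>k. a k + a' k) \<otimes> b) B = (a \<otimes> b) B + (a' \<otimes> b) B"
    and "(b \<otimes> (\<lambda>k. a k + a' k)) B = (b \<otimes> a) B + (b \<otimes> a') B"
  using assms by (auto simp: elem_tensor_def bilinear_forms_def carr_A vadd_A)

lemma tensor_zero:
  assumes "b \<in> ell2 I"
  shows "((\<lambda>_. 0) \<otimes> b) B = 0" "(b \<otimes> (\<lambda>_. 0)) B = 0"
  using assms bihomogeneous_zero[OF bilinear_forms_bihomogeneous[of B]] by (auto simp: elem_tensor_def)

definition factorises :: "nat \<Rightarrow> (nat \<Rightarrow> nat \<Rightarrow> ('i \<Rightarrow> complex, 'i \<Rightarrow> complex) tensor) \<Rightarrow>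
    nat \<Rightarrow> (nat \<Rightarrow> nat \<Rightarrow> 'i \<Rightarrow> complex) \<Rightarrow> (nat \<Rightarrow> nat \<Rightarrow> 'i \<Rightarrow> complex) \<Rightarrow> bool" where
  "factorises n u p v w \<longleftrightarrow> v \<in> ell2_mats I n p \<and> w \<in> ell2_mats I p n \<and>
     (\<forall>i<n. \<forall>j<n. u i j = (\<lambda>B. \<Sum>q<p. (v i q \<otimes> w q j) B))"

definition haagerup_bounds :: "nat \<Rightarrow> (nat \<Rightarrow> nat \<Rightarrow> ('i \<Rightarrow> complex, 'i \<Rightarrow> complex) tensor) \<Rightarrow> real set" where
  "haagerup_bounds n u = {N n p v * N p n w | p v w. factorises n u p v w}"

lemma mnorm_T: "mnorm T n u = Inf (haagerup_bounds n u)"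
proof -
  have "{rnorm A n p v * rnorm A p n w | p v w. v \<in> mats A n p \<and> w \<in> mats A p n \<and>
          (\<forall>i<n. \<forall>j<n. u i j = (\<lambda>B. \<Sum>q<p. (v i q \<otimes> w q j) B))} = haagerup_bounds n u"
  proof -
    have "(r = rnorm A n p v * rnorm A p n w \<and> v \<in> mats A n p \<and> w \<in> mats A p n \<and>
          (\<forall>i<n. \<forall>j<n. u i j = (\<lambda>B. \<Sum>q<p. (v i q \<otimes> w q j) B))) \<longleftrightarrow>
        (r = N n p v * N p n w \<and> factorises n u p v w)" for r p v w
      by (auto simp: factorises_def mats_A rnorm_A)
    then show ?thesis by (simp add: haagerup_bounds_def)
  qed
  then show ?thesis by (simp add: alg_haagerup_def)
qed

lemma T_simps: "vzero T = (\<lambda>_. 0)" "vadd T = (\<lambda>s t B. s B + t B)" "vscale T = (\<lambda>c t B. c * t B)"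
  by (simp_all add: alg_haagerup_def)

lemma carr_T_iff: "t \<in> carr T \<longleftrightarrow> (\<exists>p v w. factorises 1 (\<lambda>_ _. t) p v w)"
proof
  assume "t \<in> carr T"
  then obtain p :: nat and v w where "\<forall>q<p. v q \<in> ell2 I \<and> w q \<in> ell2 I" "t = (\<lambda>B. \<Sum>q<p. (v q \<otimes> w q) B)"
    by (auto simp: alg_haagerup_def carr_A)
  then have "factorises 1 (\<lambda>_ _. t) p (\<lambda>_ q. v q) (\<lambda>q _. w q)"
    by (simp add: factorises_def ell2_mats_def)
  then show "\<exists>p v w. factorises 1 (\<lambda>_ _. t) p v w" by blast
next
  assume "\<exists>p v w. factorises 1 (\<lambda>_ _. t) p v w"
  then obtain p v w where "factorises 1 (\<lambda>_ _. t) p v w" by blast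
  then have "(\<forall>q<p. v 0 q \<in> carr A \<and> w q 0 \<in> carr A) \<and> t = (\<lambda>B. \<Sum>q<p. (v 0 q \<otimes> w q 0) B)"
    by (simp add: factorises_def ell2_mats_def carr_A)
  then show "t \<in> carr T"
    unfolding alg_haagerup_def opspace.simps
    by (intro CollectI) (rule exI[of _ p], rule exI[of _ "\<lambda>q. v 0 q"], rule exI[of _ "\<lambda>q. w q 0"], simp)
qed

lemma tensor_carr: "a \<in> ell2 I \<Longrightarrow> b \<in> ell2 I \<Longrightarrow> a \<otimes> b \<in> carr T"
  unfolding carr_T_iff
  by (intro exI[of _ 1] exI[of _ "\<lambda>_ _. a"] exI[of _ "\<lambda>_ _. b"]) (simp add: factorises_def ell2_mats_def)

lemma factorises_bound_nonneg: "factorises n u p v w \<Longrightarrow> 0 \<le> N n p v * N p n w"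
  unfolding factorises_def by (intro mult_nonneg_nonneg N_nonneg) auto

lemma haagerup_bounds_bdd: "bdd_below (haagerup_bounds n u)"
  by (rule bdd_belowI[of _ 0]) (auto simp: haagerup_bounds_def factorises_bound_nonneg)

lemma mnorm_T_le: "factorises n u p v w \<Longrightarrow> mnorm T n u \<le> N n p v * N p n w"
  unfolding mnorm_T by (rule cInf_lower[OF _ haagerup_bounds_bdd]) (auto simp: haagerup_bounds_def)

lemma factorises_scale:
  assumes f: "factorises n u p v w"
  shows "factorises n (\<lambda>i j B. c * u i j B) p (\<lambda>i j k. c * v i j k) w"
proof -
  have "((\<lambda>k. c * v i q k) \<otimes> w q j) B = c * (v i q \<otimes> w q j) B" if "i < n" "j < n" "q < p" for i j q B
    using f that by (intro tensor_scale) (auto simp: factorises_def ell2_mats_def)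
  then show ?thesis
    using f by (auto simp: factorises_def ell2_mats_def scale_in_ell2 sum_distrib_left intro!: ext sum.cong)
qed

lemma factorises_scale_right:
  assumes f: "factorises n u p v w"
  shows "factorises n (\<lambda>i j B. c * u i j B) p v (\<lambda>i j k. c * w i j k)"
proof -
  have "(v i q \<otimes> (\<lambda>k. c * w q j k)) B = c * (v i q \<otimes> w q j) B" if "i < n" "j < n" "q < p" for i j q B
    using f that by (intro tensor_scale) (auto simp: factorises_def ell2_mats_def)
  then show ?thesis
    using f by (auto simp: factorises_def ell2_mats_def scale_in_ell2 sum_distrib_left intro!: ext sum.cong)
qed

text \<open>
  A balanced form of the strict inequality \<open>\<parallel>u\<parallel> < K\<close>: both factors of a factorisation have
  norm below \<open>\<surd>K\<close>.  In this form, bounds add up under concatenation.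
\<close>

definition haagerup_less :: "nat \<Rightarrow> (nat \<Rightarrow> nat \<Rightarrow> ('i \<Rightarrow> complex, 'i \<Rightarrow> complex) tensor) \<Rightarrow> real \<Rightarrow> bool" where
  "haagerup_less n u K \<longleftrightarrow> (\<exists>p v w. factorises n u p v w \<and> (N n p v)\<^sup>2 < K \<and> (N p n w)\<^sup>2 < K)"

lemma haagerup_less_imp_mnorm_less:
  assumes "haagerup_less n u K"
  shows "mnorm T n u < K" "haagerup_bounds n u \<noteq> {}"
proof -
  obtain p v w where f: "factorises n u p v w" and K: "(N n p v)\<^sup>2 < K" "(N p n w)\<^sup>2 < K"
    using assms unfolding haagerup_less_def by blast
  have "2 * (N n p v * N p n w) \<le> (N n p v)\<^sup>2 + (N p n w)\<^sup>2"
    using sum_squares_bound[of "N n p v" "N p n w"] by simp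
  then show "mnorm T n u < K" using mnorm_T_le[OF f] K by linarith
  show "haagerup_bounds n u \<noteq> {}" using f unfolding haagerup_bounds_def by blast
qed

lemma haagerup_less_of_factorisation:
  assumes f: "factorises n u p v w" and less: "N n p v * N p n w < K"
  shows "haagerup_less n u K"
proof -
  let ?a = "N n p v" and ?b = "N p n w"
  have v: "v \<in> ell2_mats I n p" and w: "w \<in> ell2_mats I p n" using f by (auto simp: factorises_def)
  have a: "0 \<le> ?a" and b: "0 \<le> ?b" by (intro N_nonneg v w)+
  \<comment> \<open>Enlarge both factors slightly so that they can be balanced even when one of them vanishes.\<close>
  have "((\<lambda>e. (?a + e) * (?b + e)) \<longlongrightarrow> (?a + 0) * (?b + 0)) (at_right 0)"
    by (intro tendsto_intros)
  then have "\<forall>\<^sub>F e in at_right 0. (?a + e) * (?b + e) < K" using less by (intro order_tendstoD) auto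
  moreover have "\<forall>\<^sub>F e in at_right 0. (0::real) < e" by (simp add: eventually_at_right_less)
  ultimately have "\<forall>\<^sub>F e in at_right 0. (?a + e) * (?b + e) < K \<and> 0 < e" by (rule eventually_conj)
  then obtain e where e: "(?a + e) * (?b + e) < K" "0 < e"
    using eventually_happens trivial_limit_at_right_real by blast
  define t where "t = sqrt ((?b + e) / (?a + e))"
  have t: "0 < t" and t2: "t\<^sup>2 = (?b + e) / (?a + e)" using a b e by (simp_all add: t_def)
  let ?v = "\<lambda>i j k. of_real t * v i j k" and ?w = "\<lambda>i j k. of_real (1 / t) * w i j k"
  have "factorises n (\<lambda>i j B. of_real (1 / t) * (of_real t * u i j B)) p ?v ?w"
    by (rule factorises_scale_right[OF factorises_scale[OF f]])
  then have f': "factorises n u p ?v ?w" using t by (simp add: mult.assoc[symmetric])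
  have "N n p ?v \<le> t * ?a" using N_scale[OF v, of "of_real t"] t by simp
  moreover have "0 \<le> N n p ?v" "0 \<le> N p n ?w" using f' by (auto simp: factorises_def intro: N_nonneg)
  moreover have "N p n ?w \<le> ?b / t" using N_scale[OF w, of "of_real (1 / t)"] t by (simp add: norm_divide)
  ultimately have "(N n p ?v)\<^sup>2 \<le> (t * ?a)\<^sup>2" "(N p n ?w)\<^sup>2 \<le> (?b / t)\<^sup>2" by (auto intro: power_mono)
  moreover have "(t * ?a)\<^sup>2 < K"
  proof -
    have "(t * ?a)\<^sup>2 = (?b + e) * (?a * ?a / (?a + e))"
      by (simp only: power_mult_distrib t2) (simp add: power2_eq_square)
    also have "\<dots> \<le> (?b + e) * (?a + e)"
      using a b e mult_mono[of ?a "?a + e" ?a "?a + e"]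
      by (intro mult_left_mono) (simp_all add: divide_le_eq)
    finally show ?thesis using e by (simp add: mult.commute)
  qed
  moreover have "(?b / t)\<^sup>2 < K"
  proof -
    have "(?b / t)\<^sup>2 = (?a + e) * (?b * ?b / (?b + e))"
      by (simp only: power_divide t2) (simp add: power2_eq_square)
    also have "\<dots> \<le> (?a + e) * (?b + e)"
      using a b e mult_mono[of ?b "?b + e" ?b "?b + e"]
      by (intro mult_left_mono) (simp_all add: divide_le_eq)
    finally show ?thesis using e by simp
  qed
  ultimately show ?thesis unfolding haagerup_less_def using f' by (meson order_le_less_trans)
qed

lemma haagerup_less_of_mnorm_less:
  assumes "haagerup_bounds n u \<noteq> {}" "mnorm T n u < K"
  shows "haagerup_less n u K"
proof -
  obtain r where "r \<in> haagerup_bounds n u" "r < K"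
    using cInf_lessD[OF assms(1)] assms(2) unfolding mnorm_T by blast
  then show ?thesis unfolding haagerup_bounds_def using haagerup_less_of_factorisation by blast
qed

text \<open>
  Concatenating factorisations of \<open>u\<close> and \<open>u'\<close> gives one of \<open>u + u'\<close>, and the
  squares of the norms of the factors at most add.
\<close>

lemma factorises_add:
  assumes f: "factorises n u p v w" and f': "factorises n u' p' v' w'"
  shows "factorises n (\<lambda>i j B. u i j B + u' i j B) (p + p')
      (\<lambda>i q. if q < p then v i q else v' i (q - p)) (\<lambda>q j. if q < p then w q j else w' (q - p) j)"
  using f f' unfolding factorises_def by (auto simp: sum_lessThan_add ell2_mats_def)

lemma haagerup_less_add:
  assumes "haagerup_less n u K" "haagerup_less n u' K'"
  shows "haagerup_less n (\<lambda>i j B. u i j B + u' i j B) (K + K')"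
proof -
  obtain p v w where f: "factorises n u p v w" and K: "(N n p v)\<^sup>2 < K" "(N p n w)\<^sup>2 < K"
    using assms unfolding haagerup_less_def by blast
  obtain p' v' w' where f': "factorises n u' p' v' w'" and K': "(N n p' v')\<^sup>2 < K'" "(N p' n w')\<^sup>2 < K'"
    using assms unfolding haagerup_less_def by blast
  have m: "v \<in> ell2_mats I n p" "w \<in> ell2_mats I p n" "v' \<in> ell2_mats I n p'" "w' \<in> ell2_mats I p' n"
    using f f' by (auto simp: factorises_def)
  show ?thesis
    unfolding haagerup_less_def
    using factorises_add[OF f f'] N_append_columns[OF m(1,3)] N_append_rows[OF m(2,4)] K K'
    by (smt (verit, best))
qed

lemma haagerup_less_in_entry:
  assumes "haagerup_less 1 (\<lambda>_ _. t) K"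
  shows "haagerup_less n (\<lambda>i j. if i = r \<and> j = s then t else (\<lambda>_. 0)) K"
proof -
  obtain p v w where f: "factorises 1 (\<lambda>_ _. t) p v w" and K: "(N 1 p v)\<^sup>2 < K" "(N p 1 w)\<^sup>2 < K"
    using assms unfolding haagerup_less_def by blast
  have v: "v \<in> ell2_mats I 1 p" and w: "w \<in> ell2_mats I p 1"
    and t: "t = (\<lambda>B. \<Sum>q<p. (v 0 q \<otimes> w q 0) B)" using f by (auto simp: factorises_def)
  let ?v = "\<lambda>i q. if i = r then v 0 q else (\<lambda>_. 0)" and ?w = "\<lambda>q j. if j = s then w q 0 else (\<lambda>_. 0)"
  have m: "?v \<in> ell2_mats I n p" "?w \<in> ell2_mats I p n"
    using v w by (auto simp: ell2_mats_def zero_in_ell2)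
  have "(if i = r \<and> j = s then t else (\<lambda>_. 0)) = (\<lambda>B. \<Sum>q<p. (?v i q \<otimes> ?w q j) B)" for i j
  proof -
    have "(\<Sum>q<p. (?v i q \<otimes> ?w q j) B) = 0" if "\<not> (i = r \<and> j = s)" for B
      using that v w by (intro sum.neutral) (auto simp: ell2_mats_def tensor_zero zero_in_ell2)
    then show ?thesis by (auto simp: t)
  qed
  then have "factorises n (\<lambda>i j. if i = r \<and> j = s then t else (\<lambda>_. 0)) p ?v ?w"
    using m by (simp add: factorises_def)
  moreover have "(N n p ?v)\<^sup>2 \<le> (N 1 p v)\<^sup>2" "(N p n ?w)\<^sup>2 \<le> (N p 1 w)\<^sup>2"
    by (intro power_mono N_in_row N_in_column N_nonneg m v w)+
  ultimately show ?thesis unfolding haagerup_less_def using K by (meson order_le_less_trans)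
qed

lemma haagerup_less_zero:
  assumes "0 < K" shows "haagerup_less n (\<lambda>_ _ _. 0) K"
proof -
  have m: "(\<lambda>_ _ _. 0) \<in> ell2_mats I k l" for k l by (simp add: ell2_mats_def zero_in_ell2)
  have "N k l (\<lambda>_ _ _. 0) = 0" for k l using N_scale[OF m, of k l 0] N_nonneg[OF m, of k l] by simp
  then show ?thesis
    unfolding haagerup_less_def factorises_def using m assms
    by (intro exI[of _ 0] exI[of _ "\<lambda>_ _ _. 0"]) auto
qed

text \<open>
  A matrix is the sum of its entries, each placed in an otherwise zero matrix.  The slack \<open>e\<close>
  accounts for the zero matrix that starts the sum, whose norm is not strictly below \<open>0\<close>.
\<close>

lemma haagerup_less_entries:
  assumes K: "\<And>i j. i < n \<Longrightarrow> j < n \<Longrightarrow> haagerup_less 1 (\<lambda>_ _. u i j) (K i j)" and e: "0 < e"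
  shows "haagerup_less n u (e + (\<Sum>i<n. \<Sum>j<n. K i j))"
proof -
  have "haagerup_less n (\<lambda>i j. if (i, j) \<in> S then u i j else (\<lambda>_. 0)) (e + (\<Sum>(i, j)\<in>S. K i j))"
    if "finite S" "S \<subseteq> {..<n} \<times> {..<n}" for S
    using that
  proof (induction S rule: finite_induct)
    case empty
    show ?case using haagerup_less_zero[OF e] by simp
  next
    case (insert x S)
    obtain r s where x: "x = (r, s)" by fastforce
    have "haagerup_less n (\<lambda>i j. if i = r \<and> j = s then u r s else (\<lambda>_. 0)) (K r s)"
      using insert.prems x by (intro haagerup_less_in_entry K) auto
    from haagerup_less_add[OF this insert.IH] insert.prems
    have "haagerup_less n (\<lambda>i j B. (if i = r \<and> j = s then u r s else (\<lambda>_. 0)) B +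
        (if (i, j) \<in> S then u i j else (\<lambda>_. 0)) B) (K r s + (e + (\<Sum>(i, j)\<in>S. K i j)))" by simp
    also have "(\<lambda>i j B. (if i = r \<and> j = s then u r s else (\<lambda>_. 0)) B + (if (i, j) \<in> S then u i j else (\<lambda>_. 0)) B)
        = (\<lambda>i j. if (i, j) \<in> insert x S then u i j else (\<lambda>_. 0))"
      using insert.hyps(2) x by (auto simp: fun_eq_iff)
    also have "K r s + (e + (\<Sum>(i, j)\<in>S. K i j)) = e + (\<Sum>(i, j)\<in>insert x S. K i j)"
      using insert.hyps x by simp
    finally show ?case .
  qed
  from this[of "{..<n} \<times> {..<n}"]
  have "haagerup_less n (\<lambda>i j. if i < n \<and> j < n then u i j else (\<lambda>_. 0)) (e + (\<Sum>i<n. \<Sum>j<n. K i j))"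
    by (simp add: sum.cartesian_product)
  then show ?thesis by (simp add: haagerup_less_def factorises_def)
qed

lemma carr_T_haagerup_less:
  assumes "t \<in> carr T" "vnorm T t < K"
  shows "haagerup_less 1 (\<lambda>_ _. t) K"
proof (rule haagerup_less_of_mnorm_less)
  show "haagerup_bounds 1 (\<lambda>_ _. t) \<noteq> {}"
    using assms(1) unfolding carr_T_iff haagerup_bounds_def by blast
qed (use assms(2) in \<open>simp add: vnorm_def\<close>)

lemma mats_T_haagerup_less:
  assumes u: "u \<in> mats T n n" and K: "(\<Sum>i<n. \<Sum>j<n. vnorm T (u i j)) < K"
  shows "haagerup_less n u K"
proof -
  let ?S = "\<Sum>i<n. \<Sum>j<n. vnorm T (u i j)"
  define e where "e = (K - ?S) / (real n * real n + 1)"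
  have n1: "0 < real n * real n + 1" by (simp add: add_nonneg_pos)
  have e: "0 < e" using K n1 by (simp add: e_def)
  have "haagerup_less n u (e + (\<Sum>i<n. \<Sum>j<n. vnorm T (u i j) + e))"
    by (rule haagerup_less_entries[OF _ e], rule carr_T_haagerup_less) (use u e in \<open>auto simp: mats_def\<close>)
  also have "e + (\<Sum>i<n. \<Sum>j<n. vnorm T (u i j) + e) = ?S + (real n * real n + 1) * e"
    by (simp add: sum.distrib algebra_simps)
  also have "\<dots> = K" using n1 by (simp add: e_def)
  finally show ?thesis .
qed

lemma mats_T_bounds: "u \<in> mats T n n \<Longrightarrow> haagerup_bounds n u \<noteq> {}"
  using haagerup_less_imp_mnorm_less(2)[OF mats_T_haagerup_less] gt_ex by blast

sublocale T: matrix_seminormed T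
proof
  show "vadd T = (\<lambda>s t b. s b + t b)" "vscale T = (\<lambda>c t b. c * t b)" by (simp_all add: T_simps)
  show "(\<lambda>_. 0) \<in> carr T"
  proof -
    have "factorises 1 (\<lambda>_ _ _. 0) 0 (\<lambda>_ _ _. 0) (\<lambda>_ _ _. 0)"
      by (simp add: factorises_def ell2_mats_def)
    then show ?thesis unfolding carr_T_iff by blast
  qed
  show "(\<lambda>B. s B + t B) \<in> carr T" if "s \<in> carr T" "t \<in> carr T" for s t
    using that factorises_add unfolding carr_T_iff by blast
  show "(\<lambda>B. c * s B) \<in> carr T" if "s \<in> carr T" for c s
    using that factorises_scale unfolding carr_T_iff by blast
next
  fix n u assume u: "u \<in> mats T n n"
  show "0 \<le> mnorm T n u"
    unfolding mnorm_T
    by (rule cInf_greatest[OF mats_T_bounds[OF u]]) (auto simp: haagerup_bounds_def factorises_bound_nonneg)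
  show "mnorm T n u \<le> (\<Sum>i<n. \<Sum>j<n. vnorm T (u i j))"
    by (rule dense_ge) (rule less_imp_le[OF haagerup_less_imp_mnorm_less(1)[OF mats_T_haagerup_less[OF u]]])
  show "mnorm T n (\<lambda>i j b. u i j b + v i j b) \<le> mnorm T n u + mnorm T n v" if v: "v \<in> mats T n n" for v
  proof (rule field_le_epsilon)
    fix e :: real assume e: "0 < e"
    have "haagerup_less n u (mnorm T n u + e / 2)" "haagerup_less n v (mnorm T n v + e / 2)"
      using e by (auto intro!: haagerup_less_of_mnorm_less mats_T_bounds u v)
    from haagerup_less_imp_mnorm_less(1)[OF haagerup_less_add[OF this]]
    show "mnorm T n (\<lambda>i j b. u i j b + v i j b) \<le> mnorm T n u + mnorm T n v + e" by simp
  qed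
  show "mnorm T n (\<lambda>i j b. c * u i j b) \<le> cmod c * mnorm T n u" for c
  proof -
    have *: "mnorm T n (\<lambda>i j b. c * u i j b) \<le> cmod c * r" if rb: "r \<in> haagerup_bounds n u" for r
    proof -
      obtain p v w where f: "factorises n u p v w" and r: "r = N n p v * N p n w"
        using rb by (auto simp: haagerup_bounds_def)
      have m: "v \<in> ell2_mats I n p" "w \<in> ell2_mats I p n" using f by (auto simp: factorises_def)
      have "mnorm T n (\<lambda>i j b. c * u i j b) \<le> N n p (\<lambda>i j k. c * v i j k) * N p n w"
        by (rule mnorm_T_le[OF factorises_scale[OF f]])
      also have "\<dots> \<le> cmod c * N n p v * N p n w"
        by (intro mult_right_mono N_scale N_nonneg m)
      finally show ?thesis by (simp add: r mult.assoc)
    qed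
    show ?thesis
    proof (cases "c = 0")
      case True
      then show ?thesis using * mats_T_bounds[OF u] by auto
    next
      case False
      have "mnorm T n (\<lambda>i j b. c * u i j b) / cmod c \<le> mnorm T n u"
        unfolding mnorm_T[of n u]
        by (rule cInf_greatest[OF mats_T_bounds[OF u]])
          (use * False in \<open>auto simp: divide_le_eq mult.commute\<close>)
      then show ?thesis using False by (simp add: divide_le_eq mult.commute)
    qed
  qed
qed

end

section \<open>The multiplication map\<close>

context hilbertian_algebra
begin

text \<open>
  Tensors are functionals on bilinear forms, so the \<open>i\<close>-th coordinate of the product map
  \<open>a \<otimes> b \<mapsto> a b\<close> is evaluation at the bilinear form \<open>a\<^sub>i b\<^sub>i\<close>.
\<close>

definition mu :: "('i \<Rightarrow> complex, 'i \<Rightarrow> complex) tensor \<Rightarrow> 'i \<Rightarrow> complex" where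
  "mu t i = t (\<lambda>a b. a i * b i)"

lemma mu_tensor: "mu (a \<otimes> b) i = a i * b i"
proof -
  have "(\<lambda>a b. a i * b i) \<in> bilinear_forms A A"
    by (simp add: bilinear_forms_def vadd_A vscale_A algebra_simps)
  then show ?thesis by (simp add: mu_def elem_tensor_def)
qed

lemma mu_factorises:
  assumes f: "factorises n u p v w"
  shows "(\<lambda>i j. mu (u i j)) \<in> ell2_mats I n n" "N n n (\<lambda>i j. mu (u i j)) \<le> N n p v * N p n w"
proof -
  have m: "v \<in> ell2_mats I n p" "w \<in> ell2_mats I p n" using f by (auto simp: factorises_def)
  have eq: "(\<lambda>k. \<Sum>q<p. v i q k * w q j k) = mu (u i j)" if "i < n" "j < n" for i j
  proof
    fix k
    have "mu (u i j) k = (\<Sum>q<p. mu (v i q \<otimes> w q j) k)"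
      using f that by (simp add: factorises_def mu_def)
    then show "(\<Sum>q<p. v i q k * w q j k) = mu (u i j) k" by (simp add: mu_tensor)
  qed
  note mult = N_mult[OF m]
  show "(\<lambda>i j. mu (u i j)) \<in> ell2_mats I n n"
    using mult eq by (simp add: ell2_mats_def)
  show "N n n (\<lambda>i j. mu (u i j)) \<le> N n p v * N p n w"
    using mult N_cong[of "\<lambda>i j k. \<Sum>q<p. v i q k * w q j k" n n "\<lambda>i j. mu (u i j)"] eq by simp
qed

lemma mu_contractive:
  assumes u: "u \<in> mats T n n"
  shows "(\<lambda>i j. mu (u i j)) \<in> ell2_mats I n n" "N n n (\<lambda>i j. mu (u i j)) \<le> mnorm T n u"
proof -
  show "(\<lambda>i j. mu (u i j)) \<in> ell2_mats I n n"
    using mats_T_bounds[OF u] mu_factorises(1) by (auto simp: haagerup_bounds_def)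
  show "N n n (\<lambda>i j. mu (u i j)) \<le> mnorm T n u"
    unfolding mnorm_T
    by (rule cInf_greatest[OF mats_T_bounds[OF u]]) (auto simp: haagerup_bounds_def mu_factorises(2))
qed

lemma mu_carr:
  assumes t: "t \<in> carr T"
  shows "mu t \<in> ell2 I" "ell2_norm I (mu t) \<le> vnorm T t"
proof -
  show e: "mu t \<in> ell2 I"
    using mu_contractive(1)[OF T.const_mats[OF t, of 1 1]] by (simp add: ell2_mats_def)
  show "ell2_norm I (mu t) \<le> vnorm T t"
    using mu_contractive(2)[OF T.const_mats[OF t, of 1 1]] N_1_1[OF e] by (simp add: vnorm_def)
qed

lemma mu_entry_le: "t \<in> carr T \<Longrightarrow> cmod (mu t i) \<le> vnorm T t"
  using norm_entry_le_ell2_norm[of "mu t" I i] mu_carr by (metis order_trans)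

abbreviation H where "H \<equiv> os_completion T"

text \<open>
  The extension of \<open>mu\<close> to the completion.  The limit is taken coordinatewise; that
  it lies in \<open>\<ell>\<^sup>2\<close> and is completely contractive follows from \<open>N_limit\<close>.
\<close>

definition psi :: "(nat \<Rightarrow> ('i \<Rightarrow> complex, 'i \<Rightarrow> complex) tensor) set \<Rightarrow> 'i \<Rightarrow> complex" where
  "psi P i = lim (\<lambda>k. mu (cauchy_rep P k) i)"

lemma mu_diff_le_d: "s \<in> carr T \<Longrightarrow> t \<in> carr T \<Longrightarrow> cmod (mu s i - mu t i) \<le> T.d s t"
  using mu_entry_le[OF T.diff_carr[of s t], of i] by (simp add: mu_def T.d_def)

lemma psi_tendsto:
  assumes P: "P \<in> carr H" and s: "s \<in> P"
  shows "(\<lambda>k. mu (s k) i) \<longlonglongrightarrow> psi P i"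
proof -
  define r where "r = cauchy_rep P"
  have r: "r \<in> P" unfolding r_def by (rule T.rep_mem[OF P])
  have rc: "r \<in> cauchy_seqs T" and sc: "s \<in> cauchy_seqs T" using T.mem_carr_H(1)[OF P] r s by auto
  have rk: "r k \<in> carr T" and sk: "s k \<in> carr T" for k
    by (rule T.cauchy_seqs_carr[OF rc], rule T.cauchy_seqs_carr[OF sc])
  have "Cauchy (\<lambda>k. mu (r k) i)"
  proof (rule metric_CauchyI)
    fix e :: real assume "0 < e"
    then obtain M where "\<forall>k\<ge>M. \<forall>l\<ge>M. T.d (r k) (r l) < e"
      using rc unfolding T.cauchy_seqs_iff by blast
    then show "\<exists>M. \<forall>m\<ge>M. \<forall>n\<ge>M. dist (mu (r m) i) (mu (r n) i) < e"
      unfolding dist_norm using mu_diff_le_d[OF rk rk] by (meson order_le_less_trans)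
  qed
  then have r_lim: "(\<lambda>k. mu (r k) i) \<longlonglongrightarrow> psi P i"
    unfolding psi_def r_def by (simp add: Cauchy_convergent_iff convergent_LIMSEQ_iff)
  have "(\<lambda>k. mu (s k) i - mu (r k) i) \<longlonglongrightarrow> 0"
    by (rule Lim_null_comparison[OF _ T.mems_dist[OF P s r]]) (simp add: mu_diff_le_d sk rk)
  from tendsto_add[OF this r_lim] show ?thesis by simp
qed

lemma psi_eqI: "P \<in> carr H \<Longrightarrow> s \<in> P \<Longrightarrow> (\<And>i. (\<lambda>k. mu (s k) i) \<longlonglongrightarrow> f i) \<Longrightarrow> psi P = f"
  using psi_tendsto LIMSEQ_unique by (metis ext)

lemma psi_contractive:
  assumes P: "P \<in> mats H n n"
  shows "(\<lambda>i j. psi (P i j)) \<in> ell2_mats I n n" "N n n (\<lambda>i j. psi (P i j)) \<le> mnorm H n P"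
proof -
  define r where "r = (\<lambda>i j. cauchy_rep (P i j))"
  have PH: "P i j \<in> carr H" if "i < n" "j < n" for i j using P that by (simp add: mats_def)
  have r: "r i j \<in> P i j" if "i < n" "j < n" for i j using PH[OF that] by (simp add: r_def T.rep_mem)
  have rm: "(\<lambda>i j. r i j k) \<in> mats T n n" for k
    using T.mem_carr_H(1)[OF PH r] by (simp add: mats_def T.cauchy_seqs_carr)
  have "(\<lambda>i j. psi (P i j)) \<in> ell2_mats I n n \<and> N n n (\<lambda>i j. psi (P i j)) \<le> mnorm H n P"
    by (rule N_limit[of "\<lambda>k i j. mu (r i j k)", OF mu_contractive[OF rm] T.mnorm_H[OF P r]])
      (auto intro: psi_tendsto PH r)
  then show "(\<lambda>i j. psi (P i j)) \<in> ell2_mats I n n" "N n n (\<lambda>i j. psi (P i j)) \<le> mnorm H n P" by auto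
qed

lemma psi_carr:
  assumes P: "P \<in> carr H"
  shows "psi P \<in> ell2 I" "ell2_norm I (psi P) \<le> vnorm H P"
proof -
  have m: "(\<lambda>_ _. P) \<in> mats H 1 1" using P by (simp add: mats_def)
  show e: "psi P \<in> ell2 I"
    using psi_contractive(1)[OF m] by (simp add: ell2_mats_def)
  show "ell2_norm I (psi P) \<le> vnorm H P"
    using psi_contractive(2)[OF m] N_1_1[OF e] by (simp add: vnorm_def)
qed

lemma psi_vadd: "P \<in> carr H \<Longrightarrow> Q \<in> carr H \<Longrightarrow> psi (vadd H P Q) = (\<lambda>i. psi P i + psi Q i)"
  by (rule psi_eqI[OF T.vadd_H[OF _ _ T.rep_mem T.rep_mem]])
    (auto simp: mu_def intro!: tendsto_add psi_tendsto[unfolded mu_def] T.rep_mem)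

lemma psi_vscale: "P \<in> carr H \<Longrightarrow> psi (vscale H c P) = (\<lambda>i. c * psi P i)"
  by (rule psi_eqI[OF T.vscale_H[OF _ T.rep_mem]])
    (auto simp: mu_def intro!: tendsto_mult_left psi_tendsto[unfolded mu_def] T.rep_mem)

lemma psi_vsub: "P \<in> carr H \<Longrightarrow> Q \<in> carr H \<Longrightarrow> psi (vsub H P Q) = (\<lambda>i. psi P i - psi Q i)"
  by (simp add: vsub_def psi_vadd psi_vscale T.vscale_H(1)[OF _ T.rep_mem])

lemma psi_embed: "t \<in> carr T \<Longrightarrow> psi (completion_embed T t) = mu t"
  by (rule psi_eqI[OF T.embed_carr T.embed_mem]) auto

lemma linear_map_psi: "linear_map H A psi"
  by (simp add: linear_map_def carr_A vadd_A vscale_A psi_carr psi_vadd psi_vscale)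


section \<open>Lifting matrices to diagonal tensors\<close>

definition diag_tensor :: "'i set \<Rightarrow> ('i \<Rightarrow> complex) \<Rightarrow> ('i \<Rightarrow> complex, 'i \<Rightarrow> complex) tensor" where
  "diag_tensor F x = (\<lambda>B. \<Sum>k\<in>F. x k * (unit_vec k \<otimes> unit_vec k) B)"

lemma diag_tensor_norm:
  assumes x: "x \<in> ell2_mats I n n" and F: "finite F" "F \<subseteq> I"
  shows "mnorm T n (\<lambda>i j. diag_tensor F (x i j)) \<le> N n n x"
    and "\<exists>p v w. factorises n (\<lambda>i j. diag_tensor F (x i j)) p v w"
proof -
  obtain p v w where m: "v \<in> ell2_mats I n p" "w \<in> ell2_mats I p n"
    and le: "N n p v * N p n w \<le> N n n x"
    and B: "\<And>B i j. bihomogeneous I B \<Longrightarrow> i < n \<Longrightarrow> j < n \<Longrightarrow>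
          (\<Sum>q<p. B (v i q) (w q j)) = (\<Sum>k\<in>F. x i j k * B (unit_vec k) (unit_vec k))"
    using N_diagonal_factorisation[OF x F] by blast
  have "diag_tensor F (x i j) C = (\<Sum>q<p. (v i q \<otimes> w q j) C)" if "i < n" "j < n" for i j C
    using B[OF bilinear_forms_bihomogeneous that, of C]
    by (cases "C \<in> bilinear_forms A A") (simp_all add: diag_tensor_def elem_tensor_def)
  then have f: "factorises n (\<lambda>i j. diag_tensor F (x i j)) p v w"
    using m by (simp add: factorises_def fun_eq_iff)
  then show "\<exists>p v w. factorises n (\<lambda>i j. diag_tensor F (x i j)) p v w" by blast
  show "mnorm T n (\<lambda>i j. diag_tensor F (x i j)) \<le> N n n x"
    using mnorm_T_le[OF f] le by simp
qed

lemma diag_tensor_carr: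
  assumes x: "x \<in> ell2 I" and F: "finite F" "F \<subseteq> I"
  shows "diag_tensor F x \<in> carr T" "vnorm T (diag_tensor F x) \<le> ell2_norm I x"
  using diag_tensor_norm[OF ell2_mats_1_1[OF x] F, of 1] N_1_1[OF x]
  by (auto simp: carr_T_iff vnorm_def)

lemma diag_tensor_mono:
  assumes "finite G" "F \<subseteq> G" "\<And>k. k \<in> F \<Longrightarrow> x k = y k" "\<And>k. k \<in> G - F \<Longrightarrow> y k = 0"
  shows "diag_tensor F x = diag_tensor G y"
  unfolding diag_tensor_def using assms by (intro ext sum.mono_neutral_cong_left) auto

text \<open>
  The difference of the two diagonal tensors is again diagonal, with entries supported in the
  symmetric difference of \<open>F\<close> and \<open>G\<close>.  Hence diagonal tensors along an exhausting sequence of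
  finite sets form a Cauchy sequence.
\<close>

lemma diag_tensor_d_le:
  assumes x: "x \<in> ell2 I" and F: "finite F" "F \<subseteq> I" and G: "finite G" "G \<subseteq> I"
  shows "T.d (diag_tensor F x) (diag_tensor G x) \<le> ell2_norm I (restrict0 (- F) x) + ell2_norm I (restrict0 (- G) x)"
proof -
  have eq: "diag_tensor E x = diag_tensor (F \<union> G) (restrict0 E x)" if "E \<subseteq> F \<union> G" for E
    by (rule diag_tensor_mono) (use that F G in \<open>auto simp: restrict0_def\<close>)
  let ?y = "\<lambda>k. restrict0 (- G) x k + (- 1) * restrict0 (- F) x k"
  have y: "?y \<in> ell2 I" "ell2_norm I ?y \<le> ell2_norm I (restrict0 (- G) x) + ell2_norm I (\<lambda>k. (- 1) * restrict0 (- F) x k)"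
    by (intro ell2_norm_triangle scale_in_ell2 restrict0_Compl_in_ell2 x)+
  have "(\<lambda>B. diag_tensor F x B - diag_tensor G x B) = diag_tensor (F \<union> G) ?y"
    unfolding eq[OF Un_upper1] eq[OF Un_upper2] unfolding diag_tensor_def sum_subtractf[symmetric]
    by (intro ext sum.cong) (auto simp: restrict0_def)
  then have "T.d (diag_tensor F x) (diag_tensor G x) \<le> ell2_norm I ?y"
    unfolding T.d_def using diag_tensor_carr(2)[OF y(1), of "F \<union> G"] F G by simp
  also have "\<dots> \<le> ell2_norm I (restrict0 (- F) x) + ell2_norm I (restrict0 (- G) x)"
    using y(2) by (simp add: ell2_norm_def)
  finally show ?thesis .
qed

lemma mu_diag_tensor:
  assumes "finite F" shows "mu (diag_tensor F x) = restrict0 F x"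
proof
  fix i
  have "mu (diag_tensor F x) i = (\<Sum>k\<in>F. x k * mu (unit_vec k \<otimes> unit_vec k) i)"
    by (simp add: mu_def diag_tensor_def)
  also have "\<dots> = (\<Sum>k\<in>F. if i = k then x k else 0)"
    by (intro sum.cong) (auto simp: mu_tensor unit_vec_def)
  finally show "mu (diag_tensor F x) i = restrict0 F x i" using assms by (simp add: restrict0_def)
qed

text \<open>
  One sequence of finite sets has to serve all entries of \<open>x\<close>: the matrix norm of the
  diagonal lifts is controlled only when the entries are truncated simultaneously.
\<close>

lemma ex_exhausting_sequence:
  assumes x: "x \<in> ell2_mats I n n"
  shows "\<exists>F. (\<forall>r. finite (F r) \<and> F r \<subseteq> I) \<and>
    (\<forall>i<n. \<forall>j<n. (\<lambda>r. ell2_norm I (restrict0 (- F r) (x i j))) \<longlonglongrightarrow> 0)"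
proof -
  let ?t = "\<lambda>F i j. ell2_norm I (restrict0 (- F) (x i j))"
  have lim: "((\<lambda>F. \<Sum>i<n. \<Sum>j<n. ?t F i j) \<longlongrightarrow> 0) (finite_subsets_at_top I)"
    using x by (intro tendsto_null_sum ell2_norm_restrict0_Compl_tendsto) (auto simp: ell2_mats_def)
  have "\<exists>F. finite F \<and> F \<subseteq> I \<and> (\<Sum>i<n. \<Sum>j<n. ?t F i j) < 1 / real (Suc r)" for r
  proof -
    have "\<forall>\<^sub>F F in finite_subsets_at_top I. (\<Sum>i<n. \<Sum>j<n. ?t F i j) < 1 / real (Suc r)"
      using lim by (rule order_tendstoD) simp
    then show ?thesis unfolding eventually_finite_subsets_at_top by blast
  qed
  then obtain F where F: "\<And>r. finite (F r) \<and> F r \<subseteq> I \<and> (\<Sum>i<n. \<Sum>j<n. ?t (F r) i j) < 1 / real (Suc r)"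
    by metis
  have "(\<lambda>r. ?t (F r) i j) \<longlonglongrightarrow> 0" if "i < n" "j < n" for i j
  proof (rule Lim_null_comparison[OF _ LIMSEQ_inverse_real_of_nat])
    have "?t (F r) i j \<le> inverse (real (Suc r))" for r
    proof -
      have "?t (F r) i j \<le> (\<Sum>j<n. ?t (F r) i j)"
        using that by (intro member_le_sum ell2_norm_nonneg) auto
      also have "\<dots> \<le> (\<Sum>i<n. \<Sum>j<n. ?t (F r) i j)"
        using that by (intro member_le_sum[of i "{..<n}" "\<lambda>i. \<Sum>j<n. ?t (F r) i j"] sum_nonneg ell2_norm_nonneg) auto
      finally show ?thesis using F[of r] by (simp add: inverse_eq_divide)
    qed
    then show "\<forall>\<^sub>F r in sequentially. norm (?t (F r) i j) \<le> inverse (real (Suc r))"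
      by (simp add: ell2_norm_nonneg)
  qed
  with F show ?thesis by blast
qed

lemma psi_lift:
  assumes x: "x \<in> ell2_mats I n n"
  shows "\<exists>P\<in>mats H n n. (\<forall>i<n. \<forall>j<n. psi (P i j) = x i j) \<and> mnorm H n P \<le> N n n x"
proof -
  obtain F where F: "\<And>r. finite (F r)" "\<And>r. F r \<subseteq> I"
    and tail: "\<And>i j. i < n \<Longrightarrow> j < n \<Longrightarrow> (\<lambda>r. ell2_norm I (restrict0 (- F r) (x i j))) \<longlonglongrightarrow> 0"
    using ex_exhausting_sequence[OF x] by blast
  define s where "s = (\<lambda>i j r. diag_tensor (F r) (x i j))"
  have xij: "x i j \<in> ell2 I" if "i < n" "j < n" for i j using x that by (simp add: ell2_mats_def)
  have s: "s i j \<in> cauchy_seqs T" if ij: "i < n" "j < n" for i j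
    unfolding T.cauchy_seqs_iff
  proof (intro conjI allI impI)
    show "s i j k \<in> carr T" for k unfolding s_def by (intro diag_tensor_carr xij[OF ij] F)
    fix e :: real assume "0 < e"
    then have "\<forall>\<^sub>F r in sequentially. ell2_norm I (restrict0 (- F r) (x i j)) < e / 2"
      using tail[OF ij] by (intro order_tendstoD) auto
    then obtain M where M: "\<And>r. r \<ge> M \<Longrightarrow> ell2_norm I (restrict0 (- F r) (x i j)) < e / 2"
      unfolding eventually_sequentially by blast
    have "T.d (s i j k) (s i j l) < e" if "k \<ge> M" "l \<ge> M" for k l
      using diag_tensor_d_le[OF xij[OF ij] F F, of k l] M[OF that(1)] M[OF that(2)] by (simp add: s_def)
    then show "\<exists>M. \<forall>k\<ge>M. \<forall>l\<ge>M. T.d (s i j k) (s i j l) < e" by blast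
  qed
  define P where "P = (\<lambda>i j. cauchy_class T (s i j))"
  have P: "P \<in> mats H n n" by (simp add: mats_def P_def T.class_carr_H s)
  have sP: "s i j \<in> P i j" if "i < n" "j < n" for i j using that by (simp add: P_def T.mem_class s)
  have "psi (P i j) = x i j" if ij: "i < n" "j < n" for i j
  proof (rule psi_eqI[OF _ sP[OF ij]])
    show "P i j \<in> carr H" using P ij by (simp add: mats_def)
    fix k
    have "(\<lambda>r. restrict0 (- F r) (x i j) k) \<longlonglongrightarrow> 0"
      by (rule Lim_null_comparison[OF _ tail[OF ij]])
        (simp add: norm_entry_le_ell2_norm restrict0_Compl_in_ell2 xij[OF ij])
    then have "(\<lambda>r. x i j k - restrict0 (- F r) (x i j) k) \<longlonglongrightarrow> x i j k - 0"
      by (intro tendsto_diff tendsto_const)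
    moreover have "x i j k - restrict0 (- F r) (x i j) k = mu (s i j r) k" for r
      by (simp add: s_def mu_diag_tensor F(1) restrict0_def)
    ultimately show "(\<lambda>r. mu (s i j r) k) \<longlonglongrightarrow> x i j k" by simp
  qed
  moreover have "mnorm H n P \<le> N n n x"
    using T.mnorm_H[OF P sP]
    by (rule LIMSEQ_le_const2) (use diag_tensor_norm(1)[OF x F] in \<open>auto simp: s_def\<close>)
  ultimately show ?thesis using P by blast
qed


section \<open>The kernel of the multiplication map\<close>

lemma mult_in_ell2:
  assumes "a \<in> ell2 I" "b \<in> ell2 I" shows "pointwise_mult a b \<in> ell2 I"
proof -
  have "pointwise_mult a b = mu (a \<otimes> b)" by (auto simp: pointwise_mult_def mu_tensor)
  then show ?thesis using mu_carr(1)[OF tensor_carr[OF assms]] by simp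
qed

abbreviation balancing where "balancing \<equiv> balancing_subspace A pointwise_mult A pointwise_mult"

definition generators where
  "generators = {vsub H (completion_embed T (pointwise_mult a b \<otimes> x)) (completion_embed T (a \<otimes> pointwise_mult b x)) | a b x.
     a \<in> ell2 I \<and> b \<in> ell2 I \<and> x \<in> ell2 I}"

lemma balancing_eq: "balancing = closed_subspace H hull generators"
  by (simp add: balancing_subspace_def closed_span_def generators_def haagerup_def haagerup_tensor_def carr_A)

lemma vzero_H: "vzero H = completion_embed T (\<lambda>_. 0)"
  by (simp add: os_completion_def completion_embed_def T_simps)

text \<open>
  The kernel is closed because \<open>\<parallel>psi P\<parallel> = \<parallel>psi (P - Q)\<parallel> \<le> \<parallel>P - Q\<parallel>\<close> for all \<open>Q\<close> in it.
\<close>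

lemma closed_subspace_kernel: "closed_subspace H {P \<in> carr H. psi P = (\<lambda>_. 0)}"
  unfolding closed_subspace_def
proof (intro conjI ballI allI impI)
  show "vzero H \<in> {P \<in> carr H. psi P = (\<lambda>_. 0)}"
    by (auto simp: vzero_H T.embed_carr T.zero_carr psi_embed mu_def)
  show "vadd H P Q \<in> {P \<in> carr H. psi P = (\<lambda>_. 0)}"
    if "P \<in> {P \<in> carr H. psi P = (\<lambda>_. 0)}" "Q \<in> {P \<in> carr H. psi P = (\<lambda>_. 0)}" for P Q
    using that by (auto simp: psi_vadd intro: T.vadd_H T.rep_mem)
  show "vscale H c P \<in> {P \<in> carr H. psi P = (\<lambda>_. 0)}" if "P \<in> {P \<in> carr H. psi P = (\<lambda>_. 0)}" for c P
    using that by (auto simp: psi_vscale intro: T.vscale_H T.rep_mem)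
  show "P \<in> {P \<in> carr H. psi P = (\<lambda>_. 0)}"
    if P: "P \<in> carr H" and *: "\<forall>e>0. \<exists>Q\<in>{P \<in> carr H. psi P = (\<lambda>_. 0)}. vnorm H (vsub H P Q) < e" for P
  proof -
    have "cmod (psi P i) \<le> 0" for i
    proof (rule field_le_epsilon)
      fix e :: real assume "0 < e"
      then obtain Q where Q: "Q \<in> carr H" "psi Q = (\<lambda>_. 0)" "vnorm H (vsub H P Q) < e" using * by blast
      have "vsub H P Q \<in> carr H" using P Q T.vsub_H(1) T.rep_mem by blast
      then have "cmod (psi (vsub H P Q) i) \<le> vnorm H (vsub H P Q)"
        by (intro order_trans[OF norm_entry_le_ell2_norm[OF psi_carr(1)] psi_carr(2)])
      then show "cmod (psi P i) \<le> 0 + e" using Q P by (simp add: psi_vsub)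
    qed
    then show ?thesis using P by auto
  qed
qed auto

lemma generators_kernel: "generators \<subseteq> {P \<in> carr H. psi P = (\<lambda>_. 0)}"
proof
  fix P assume "P \<in> generators"
  then obtain a b x where abx: "a \<in> ell2 I" "b \<in> ell2 I" "x \<in> ell2 I"
    and P: "P = vsub H (completion_embed T (pointwise_mult a b \<otimes> x)) (completion_embed T (a \<otimes> pointwise_mult b x))"
    by (auto simp: generators_def)
  have c: "pointwise_mult a b \<otimes> x \<in> carr T" "a \<otimes> pointwise_mult b x \<in> carr T"
    by (intro tensor_carr mult_in_ell2 abx)+
  have "psi P = (\<lambda>_. 0)"
    unfolding P psi_vsub[OF T.embed_carr[OF c(1)] T.embed_carr[OF c(2)]] psi_embed[OF c(1)] psi_embed[OF c(2)]
    by (simp add: mu_tensor pointwise_mult_def)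
  moreover have "P \<in> carr H"
    unfolding P using c T.vsub_H(1) T.embed_carr T.embed_mem by blast
  ultimately show "P \<in> {P \<in> carr H. psi P = (\<lambda>_. 0)}" by simp
qed

lemma embed_add:
  "s \<in> carr T \<Longrightarrow> t \<in> carr T \<Longrightarrow>
    completion_embed T (\<lambda>B. s B + t B) = vadd H (completion_embed T s) (completion_embed T t)"
  by (rule T.carr_H_eqI[of _ _ "\<lambda>_ B. s B + t B"])
    (auto intro: T.embed_carr T.embed_mem T.add_carr T.vadd_H[OF T.embed_carr T.embed_carr T.embed_mem T.embed_mem])

lemma embed_scale:
  "t \<in> carr T \<Longrightarrow> completion_embed T (\<lambda>B. c * t B) = vscale H c (completion_embed T t)"
  by (rule T.carr_H_eqI[of _ _ "\<lambda>_ B. c * t B"])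
    (auto intro: T.embed_carr T.embed_mem T.scale_carr T.vscale_H[OF T.embed_carr T.embed_mem])

lemma embed_diff:
  "s \<in> carr T \<Longrightarrow> t \<in> carr T \<Longrightarrow>
    completion_embed T (\<lambda>B. s B - t B) = vsub H (completion_embed T s) (completion_embed T t)"
  by (rule T.carr_H_eqI[of _ _ "\<lambda>_ B. s B - t B"])
    (auto intro: T.embed_carr T.embed_mem T.diff_carr T.vsub_H[OF T.embed_carr T.embed_carr T.embed_mem T.embed_mem])

context
  fixes W
  assumes W: "closed_subspace H W" and gen: "generators \<subseteq> W"
begin

definition tensors_in_W where "tensors_in_W = {t \<in> carr T. completion_embed T t \<in> W}"

lemma tensors_in_W_zero: "(\<lambda>_. 0) \<in> tensors_in_W"
  using W unfolding closed_subspace_def vzero_H by (simp add: tensors_in_W_def T.zero_carr)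

lemma tensors_in_W_add: "s \<in> tensors_in_W \<Longrightarrow> t \<in> tensors_in_W \<Longrightarrow> (\<lambda>B. s B + t B) \<in> tensors_in_W"
  using W unfolding closed_subspace_def by (simp add: tensors_in_W_def T.add_carr embed_add)

lemma tensors_in_W_scale: "t \<in> tensors_in_W \<Longrightarrow> (\<lambda>B. c * t B) \<in> tensors_in_W"
  using W unfolding closed_subspace_def by (simp add: tensors_in_W_def T.scale_carr embed_scale)

lemma tensors_in_W_sum: "(\<And>q. q < (p::nat) \<Longrightarrow> f q \<in> tensors_in_W) \<Longrightarrow> (\<lambda>B. \<Sum>q<p. f q B) \<in> tensors_in_W"
  by (induction p) (auto intro: tensors_in_W_zero tensors_in_W_add)

text \<open>
  With \<open>c = b - b\<^sub>k e\<^sub>k\<close>, the tensor \<open>e\<^sub>k \<otimes> c\<close> is the generator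
  \<open>e\<^sub>k e\<^sub>k \<otimes> c - e\<^sub>k \<otimes> e\<^sub>k c\<close>, because \<open>e\<^sub>k c = 0\<close>.
\<close>

lemma tensors_in_W_unit_tensor:
  assumes k: "k \<in> I" and b: "b \<in> ell2 I"
  shows "(\<lambda>B. (unit_vec k \<otimes> b) B - b k * (unit_vec k \<otimes> unit_vec k) B) \<in> tensors_in_W"
proof -
  let ?e = "unit_vec k :: 'i \<Rightarrow> complex" and ?c = "\<lambda>i. b i + (- b k) * unit_vec k i"
  have e: "?e \<in> ell2 I" by (rule unit_vec_in_ell2[OF k])
  have c: "?c \<in> ell2 I" by (intro ell2_norm_triangle scale_in_ell2 b e)
  have ee: "pointwise_mult ?e ?e = ?e" and ec: "pointwise_mult ?e ?c = (\<lambda>_. 0)"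
    by (auto simp: pointwise_mult_def unit_vec_def)
  have car: "?e \<otimes> ?c \<in> carr T" "?e \<otimes> (\<lambda>_. 0) \<in> carr T"
    by (intro tensor_carr e c zero_in_ell2)+
  have "vsub H (completion_embed T (?e \<otimes> ?c)) (completion_embed T (?e \<otimes> (\<lambda>_. 0))) \<in> generators"
    unfolding generators_def
    by (rule CollectI, rule exI[of _ ?e], rule exI[of _ ?e], rule exI[of _ ?c]) (simp only: ee ec e c simp_thms)
  then have "(\<lambda>B. (?e \<otimes> ?c) B - (?e \<otimes> (\<lambda>_. 0)) B) \<in> tensors_in_W"
    using gen T.diff_carr[OF car] unfolding tensors_in_W_def mem_Collect_eq embed_diff[OF car] by blast
  moreover have "(?e \<otimes> ?c) B - (?e \<otimes> (\<lambda>_. 0)) B = (?e \<otimes> b) B - b k * (?e \<otimes> ?e) B" for B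
    by (simp only: tensor_zero[OF e] tensor_add(2)[OF b scale_in_ell2[OF e] e] tensor_scale[OF e e]) simp
  ultimately show ?thesis by (simp only:)
qed

lemma tensors_in_W_restrict_tensor:
  assumes F: "finite F" "F \<subseteq> I" and b: "b \<in> ell2 I"
  shows "(\<lambda>B. (restrict0 F a \<otimes> b) B - diag_tensor F (\<lambda>k. a k * b k) B) \<in> tensors_in_W"
  using F
proof (induction F rule: finite_induct)
  case empty
  have "restrict0 {} a = (\<lambda>_. 0)" by (auto simp: restrict0_def)
  then show ?case using tensors_in_W_zero by (simp add: diag_tensor_def tensor_zero b)
next
  case (insert k F)
  have k: "k \<in> I" and F: "F \<subseteq> I" using insert by auto
  let ?e = "unit_vec k :: 'i \<Rightarrow> complex"
  have e: "?e \<in> ell2 I" by (rule unit_vec_in_ell2[OF k])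
  have "restrict0 (insert k F) a = (\<lambda>i. restrict0 F a i + a k * ?e i)"
    using insert.hyps by (auto simp: restrict0_def unit_vec_def)
  then have 1: "(restrict0 (insert k F) a \<otimes> b) B = (restrict0 F a \<otimes> b) B + a k * (?e \<otimes> b) B" for B
    by (simp add: tensor_add[OF restrict0_in_ell2[OF insert.hyps(1) F] scale_in_ell2[OF e] b] tensor_scale[OF e b])
  have 2: "diag_tensor (insert k F) (\<lambda>k. a k * b k) B
      = diag_tensor F (\<lambda>k. a k * b k) B + a k * (b k * (?e \<otimes> ?e) B)" for B
    using insert.hyps by (simp add: diag_tensor_def algebra_simps)
  have "(\<lambda>B. ((restrict0 F a \<otimes> b) B - diag_tensor F (\<lambda>k. a k * b k) B) +
      a k * ((?e \<otimes> b) B - b k * (?e \<otimes> ?e) B)) \<in> tensors_in_W"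
    by (intro tensors_in_W_add tensors_in_W_scale insert.IH F tensors_in_W_unit_tensor k b)
  then show ?case unfolding 1 2 by (simp add: algebra_simps)
qed

lemma vnorm_tensor_le:
  assumes a: "a \<in> ell2 I" and b: "b \<in> ell2 I"
  shows "vnorm T (a \<otimes> b) \<le> ell2_norm I a * ell2_norm I b"
proof -
  have "factorises 1 (\<lambda>_ _. a \<otimes> b) 1 (\<lambda>_ _. a) (\<lambda>_ _. b)"
    using a b by (simp add: factorises_def ell2_mats_def)
  from mnorm_T_le[OF this] show ?thesis using N_1_1[OF a] N_1_1[OF b] by (simp add: vnorm_def)
qed

text \<open>
  Write \<open>t = \<Sum>\<^sub>q a\<^sub>q \<otimes> b\<^sub>q\<close> and truncate every \<open>a\<^sub>q\<close> to a large finite set \<open>F\<close>.  The truncated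
  tensor differs from the diagonal tensor of \<open>mu t\<close> on \<open>F\<close> by an element of
  \<open>tensors_in_W\<close>, and that diagonal tensor has norm at most \<open>\<parallel>mu t\<parallel>\<close>.
\<close>

lemma tensors_in_W_approximates:
  assumes t: "t \<in> carr T" and e: "0 < e"
  shows "\<exists>w\<in>tensors_in_W. T.d t w \<le> e + ell2_norm I (mu t)"
proof -
  obtain p v w where f: "factorises 1 (\<lambda>_ _. t) p v w" using t carr_T_iff by blast
  define a where "a = v 0"
  define b where "b = (\<lambda>q. w q 0)"
  have a: "a q \<in> ell2 I" and b: "b q \<in> ell2 I" if "q < p" for q
    using f that by (auto simp: a_def b_def factorises_def ell2_mats_def)
  have t_eq: "t = (\<lambda>B. \<Sum>q<p. (a q \<otimes> b q) B)" using f by (simp add: a_def b_def factorises_def)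
  let ?g = "\<lambda>F. \<Sum>q<p. ell2_norm I (restrict0 (- F) (a q)) * ell2_norm I (b q)"
  have "(?g \<longlongrightarrow> 0) (finite_subsets_at_top I)"
    by (intro tendsto_null_sum tendsto_mult_left_zero ell2_norm_restrict0_Compl_tendsto a) auto
  then have "\<forall>\<^sub>F F in finite_subsets_at_top I. ?g F < e" using e by (rule order_tendstoD)
  then obtain F where F: "finite F" "F \<subseteq> I" and g: "?g F < e"
    unfolding eventually_finite_subsets_at_top by blast
  define w where "w = (\<lambda>B. \<Sum>q<p. (restrict0 F (a q) \<otimes> b q) B - diag_tensor F (\<lambda>k. a q k * b q k) B)"
  have w: "w \<in> tensors_in_W" unfolding w_def by (intro tensors_in_W_sum tensors_in_W_restrict_tensor F b)
  define r where "r = (\<lambda>l B. \<Sum>q<l. (restrict0 (- F) (a q) \<otimes> b q) B)"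
  have r: "r l \<in> carr T \<and> vnorm T (r l) \<le> (\<Sum>q<l. ell2_norm I (restrict0 (- F) (a q)) * ell2_norm I (b q))"
    if "l \<le> p" for l
    using that
  proof (induction l)
    case 0
    then show ?case using T.zero_carr T.d_refl[OF T.zero_carr] by (simp add: r_def T.d_def)
  next
    case (Suc l)
    have c: "restrict0 (- F) (a l) \<otimes> b l \<in> carr T"
      using Suc.prems by (intro tensor_carr restrict0_Compl_in_ell2 a b) auto
    have "vnorm T (restrict0 (- F) (a l) \<otimes> b l) \<le> ell2_norm I (restrict0 (- F) (a l)) * ell2_norm I (b l)"
      using Suc.prems by (intro vnorm_tensor_le restrict0_Compl_in_ell2 a b) auto
    moreover have "r (Suc l) = (\<lambda>B. r l B + (restrict0 (- F) (a l) \<otimes> b l) B)" by (simp add: r_def)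
    ultimately show ?case
      using Suc T.add_carr[OF _ c, of "r l"] T.vnorm_add[OF _ c, of "r l"] by auto
  qed
  have dm: "diag_tensor F (mu t) \<in> carr T" "vnorm T (diag_tensor F (mu t)) \<le> ell2_norm I (mu t)"
    by (intro diag_tensor_carr mu_carr t F)+
  have "(\<lambda>B. t B - w B) = (\<lambda>B. r p B + diag_tensor F (mu t) B)"
  proof
    fix B
    have "(a q \<otimes> b q) B = (restrict0 F (a q) \<otimes> b q) B + (restrict0 (- F) (a q) \<otimes> b q) B" if "q < p" for q
    proof -
      have "(\<lambda>i. restrict0 F (a q) i + restrict0 (- F) (a q) i) = a q" by (auto simp: restrict0_def)
      then show ?thesis
        using tensor_add(1)[OF restrict0_in_ell2[OF F] restrict0_Compl_in_ell2[OF a[OF that]] b[OF that], of "a q" F B]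
        by simp
    qed
    moreover have "diag_tensor F (mu t) B = (\<Sum>q<p. diag_tensor F (\<lambda>k. a q k * b q k) B)"
    proof -
      have "mu t k = (\<Sum>q<p. a q k * b q k)" for k
        unfolding mu_tensor[symmetric] by (simp add: mu_def t_eq)
      then show ?thesis unfolding diag_tensor_def by (subst sum.swap) (simp add: sum_distrib_right)
    qed
    ultimately show "t B - w B = r p B + diag_tensor F (mu t) B"
      by (simp add: t_eq w_def r_def sum.distrib sum_subtractf)
  qed
  then have "T.d t w \<le> vnorm T (r p) + vnorm T (diag_tensor F (mu t))"
    unfolding T.d_def using T.vnorm_add[of "r p"] r[of p] dm by simp
  also have "\<dots> \<le> e + ell2_norm I (mu t)" using r[of p] g dm by simp
  finally show ?thesis using w by blast
qed

text \<open>
  An element \<open>P\<close> of the kernel is approximated by a tensor \<open>t\<close>; then \<open>mu t\<close> is small, so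
  \<open>t\<close> is close to an element of \<open>tensors_in_W\<close>.
\<close>

lemma kernel_subset: "{P \<in> carr H. psi P = (\<lambda>_. 0)} \<subseteq> W"
proof
  fix P assume "P \<in> {P \<in> carr H. psi P = (\<lambda>_. 0)}"
  then have P: "P \<in> carr H" and psi0: "psi P = (\<lambda>_. 0)" by auto
  have "\<exists>Q\<in>W. vnorm H (vsub H P Q) < e" if "0 < e" for e
  proof -
    define s where "s = cauchy_rep P"
    have s: "s \<in> P" unfolding s_def by (rule T.rep_mem[OF P])
    have sc: "s \<in> cauchy_seqs T" by (rule T.mem_carr_H(1)[OF P s])
    have sk: "s k \<in> carr T" for k by (rule T.cauchy_seqs_carr[OF sc])
    define e' where "e' = e / 4"
    have e': "0 < e'" using that by (simp add: e'_def)
    obtain M where M: "\<And>k l. k \<ge> M \<Longrightarrow> l \<ge> M \<Longrightarrow> T.d (s k) (s l) < e'"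
      using sc e' unfolding T.cauchy_seqs_iff by blast
    let ?t = "s M"
    have emb: "completion_embed T ?t \<in> carr H" "(\<lambda>_. ?t) \<in> completion_embed T ?t"
      by (rule T.embed_carr[OF sk], rule T.embed_mem[OF sk])
    have sub: "vsub H (completion_embed T ?t) P \<in> carr H" "(\<lambda>k b. ?t b - s k b) \<in> vsub H (completion_embed T ?t) P"
      by (rule T.vsub_H[OF emb(1) P emb(2) s])+
    have "mu ?t = psi (vsub H (completion_embed T ?t) P)"
      by (simp add: psi_vsub emb P psi0 psi_embed sk)
    then have "ell2_norm I (mu ?t) \<le> vnorm H (vsub H (completion_embed T ?t) P)"
      using psi_carr(2)[OF sub(1)] by simp
    also have "\<dots> \<le> e'"
      by (rule LIMSEQ_le_const2[OF T.vnorm_H[OF sub]])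
        (use M[of M] in \<open>auto simp: T.d_def intro!: exI[of _ M] less_imp_le\<close>)
    finally have mu: "ell2_norm I (mu ?t) \<le> e'" .
    obtain w where w: "w \<in> tensors_in_W" "T.d ?t w \<le> e' + ell2_norm I (mu ?t)"
      using tensors_in_W_approximates[OF sk e'] by blast
    have wc: "w \<in> carr T" and wW: "completion_embed T w \<in> W" using w by (auto simp: tensors_in_W_def)
    have "T.d (s k) w \<le> 3 * e'" if "k \<ge> M" for k
      using T.d_triangle[OF sk[of k] sk[of M] wc] M[of k M] that w(2) mu by simp
    then have "vnorm H (vsub H P (completion_embed T w)) \<le> 3 * e'"
      by (intro LIMSEQ_le_const2[OF T.vnorm_H[OF T.vsub_H[OF P T.embed_carr[OF wc] s T.embed_mem[OF wc]]]])
        (auto simp: T.d_def)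
    also have "\<dots> < e" using that by (simp add: e'_def)
    finally show ?thesis using wW by blast
  qed
  then show "P \<in> W" using W P unfolding closed_subspace_def by blast
qed

end

lemma balancing_kernel: "balancing = {P \<in> carr H. psi P = (\<lambda>_. 0)}"
proof
  show "balancing \<subseteq> {P \<in> carr H. psi P = (\<lambda>_. 0)}"
    unfolding balancing_eq by (rule hull_minimal[where S = "closed_subspace H", OF generators_kernel closed_subspace_kernel])
  show "{P \<in> carr H. psi P = (\<lambda>_. 0)} \<subseteq> balancing"
    unfolding balancing_eq hull_def using kernel_subset by blast
qed

end

section \<open>Quotients by kernels and dual spaces\<close>

definition fibre :: "'v opspace \<Rightarrow> ('v \<Rightarrow> 'w) \<Rightarrow> 'w \<Rightarrow> 'v set" where
  "fibre V f x = {v \<in> carr V. f v = x}"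

text \<open>
  The cosets of the kernel of \<open>f\<close> are its fibres.  Complete contractivity bounds the norm of a
  matrix of fibres from below and norm-decreasing lifts bound it from above, so \<open>x \<mapsto> fibre V f x\<close>
  inverts the map induced by \<open>f\<close> and is completely isometric.
\<close>

lemma quotient_by_kernel:
  fixes W :: "('b \<Rightarrow> complex) opspace"
  assumes lin: "linear_map V W f"
    and W_ops: "vadd W = (\<lambda>x y i. x i + y i)" "vscale W = (\<lambda>c x i. c * x i)"
    and kernel: "K = {v \<in> carr V. f v = (\<lambda>_. 0)}"
    and V_add: "\<And>v w. v \<in> carr V \<Longrightarrow> w \<in> carr V \<Longrightarrow> vadd V v w \<in> carr V"
    and V_scale: "\<And>c v. v \<in> carr V \<Longrightarrow> vscale V c v \<in> carr V"
    and V_diff: "\<And>v w. v \<in> carr V \<Longrightarrow> w \<in> carr V \<Longrightarrow> vadd V v (vsub V w v) = w"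
    and contractive: "\<And>n v x. v \<in> mats V n n \<Longrightarrow> (\<And>i j. i < n \<Longrightarrow> j < n \<Longrightarrow> f (v i j) = x i j) \<Longrightarrow>
      mnorm W n x \<le> mnorm V n v"
    and lift: "\<And>n x. x \<in> mats W n n \<Longrightarrow>
      \<exists>v\<in>mats V n n. (\<forall>i<n. \<forall>j<n. f (v i j) = x i j) \<and> mnorm V n v \<le> mnorm W n x"
  shows "linear_map W (os_quotient V K) (fibre V f)"
    and "bij_betw (fibre V f) (carr W) (carr (os_quotient V K))"
    and "\<And>n x. x \<in> mats W n n \<Longrightarrow> mnorm (os_quotient V K) n (\<lambda>i j. fibre V f (x i j)) = mnorm W n x"
proof -
  let ?Q = "os_quotient V K"
  have f_carr: "f v \<in> carr W" if "v \<in> carr V" for v using lin that by (simp add: linear_map_def)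
  have f_add: "f (vadd V v w) = (\<lambda>i. f v i + f w i)" if "v \<in> carr V" "w \<in> carr V" for v w
    using lin that by (simp add: linear_map_def W_ops)
  have f_scale: "f (vscale V c v) = (\<lambda>i. c * f v i)" if "v \<in> carr V" for c v
    using lin that by (simp add: linear_map_def W_ops)
  have diff_carr: "vsub V v w \<in> carr V" if "v \<in> carr V" "w \<in> carr V" for v w
    using that by (simp add: vsub_def V_add V_scale)
  have f_diff: "f (vsub V v w) = (\<lambda>i. f v i - f w i)" if "v \<in> carr V" "w \<in> carr V" for v w
    using that by (simp add: vsub_def f_add f_scale V_scale)
  have surj: "\<exists>v\<in>carr V. f v = x" if "x \<in> carr W" for x
    using lift[of "\<lambda>_ _. x" 1] that by (auto simp: mats_def)
  have coset: "os_coset V K v = fibre V f (f v)" if v: "v \<in> carr V" for v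
  proof
    show "os_coset V K v \<subseteq> fibre V f (f v)"
      using v by (auto simp: os_coset_def fibre_def kernel V_add f_add)
    show "fibre V f (f v) \<subseteq> os_coset V K v"
    proof
      fix w assume "w \<in> fibre V f (f v)"
      then have w: "w \<in> carr V" "f w = f v" by (auto simp: fibre_def)
      then have "vsub V w v \<in> K" using v by (simp add: kernel diff_carr f_diff)
      then show "w \<in> os_coset V K v" using V_diff[OF v w(1)] unfolding os_coset_def by (metis image_eqI)
    qed
  qed
  have carr_Q: "carr ?Q = fibre V f ` carr W"
  proof -
    have "carr ?Q = (\<lambda>v. fibre V f (f v)) ` carr V"
      using coset by (simp add: os_quotient_def)
    also have "\<dots> = fibre V f ` (f ` carr V)" by (simp add: image_image)
    also have "f ` carr V = carr W" using surj f_carr by auto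
    finally show ?thesis .
  qed
  have inj: "inj_on (fibre V f) (carr W)"
  proof (rule inj_onI)
    fix x y assume x: "x \<in> carr W" and eq: "fibre V f x = fibre V f y"
    obtain v where "v \<in> carr V" "f v = x" using surj[OF x] by blast
    then have "v \<in> fibre V f y" using eq by (auto simp: fibre_def)
    then show "x = y" using \<open>f v = x\<close> by (simp add: fibre_def)
  qed
  show "bij_betw (fibre V f) (carr W) (carr ?Q)"
    using inj by (simp add: bij_betw_def carr_Q)
  show "linear_map W ?Q (fibre V f)"
    unfolding linear_map_def
  proof (intro conjI ballI allI)
    fix x assume x: "x \<in> carr W"
    then show "fibre V f x \<in> carr ?Q" by (simp add: carr_Q)
    obtain p where p: "p \<in> carr V" "f p = x" using surj[OF x] by blast
    show "fibre V f (vscale W c x) = vscale ?Q c (fibre V f x)" for c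
    proof
      show "vscale ?Q c (fibre V f x) \<subseteq> fibre V f (vscale W c x)"
        by (auto simp: os_quotient_def fibre_def kernel V_add V_scale f_add f_scale W_ops)
      show "fibre V f (vscale W c x) \<subseteq> vscale ?Q c (fibre V f x)"
      proof
        fix r assume "r \<in> fibre V f (vscale W c x)"
        then have r: "r \<in> carr V" "f r = (\<lambda>i. c * x i)" by (auto simp: fibre_def W_ops)
        then have "vsub V r (vscale V c p) \<in> K"
          using p by (simp add: kernel diff_carr f_diff f_scale V_scale)
        moreover have "vadd V (vscale V c p) (vsub V r (vscale V c p)) = r"
          by (intro V_diff V_scale p r)
        ultimately show "r \<in> vscale ?Q c (fibre V f x)"
          using p unfolding os_quotient_def fibre_def by simp metis
      qed
    qed
    fix y assume y: "y \<in> carr W"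
    show "fibre V f (vadd W x y) = vadd ?Q (fibre V f x) (fibre V f y)"
    proof
      show "vadd ?Q (fibre V f x) (fibre V f y) \<subseteq> fibre V f (vadd W x y)"
        by (auto simp: os_quotient_def fibre_def V_add f_add W_ops)
      show "fibre V f (vadd W x y) \<subseteq> vadd ?Q (fibre V f x) (fibre V f y)"
      proof
        fix r assume "r \<in> fibre V f (vadd W x y)"
        then have r: "r \<in> carr V" "f r = (\<lambda>i. x i + y i)" by (auto simp: fibre_def W_ops)
        then have "vsub V r p \<in> fibre V f y" using p by (simp add: fibre_def diff_carr f_diff)
        moreover have "vadd V p (vsub V r p) = r" by (intro V_diff p r)
        ultimately show "r \<in> vadd ?Q (fibre V f x) (fibre V f y)"
          using p unfolding os_quotient_def fibre_def by simp metis
      qed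
    qed
  qed
  show "mnorm ?Q n (\<lambda>i j. fibre V f (x i j)) = mnorm W n x" if x: "x \<in> mats W n n" for n x
  proof -
    let ?S = "{mnorm V n v | v. v \<in> mats V n n \<and> (\<forall>i<n. \<forall>j<n. v i j \<in> fibre V f (x i j))}"
    have lower: "mnorm W n x \<le> s" if "s \<in> ?S" for s
      using that contractive by (auto simp: fibre_def)
    obtain v where v: "v \<in> mats V n n" "\<forall>i<n. \<forall>j<n. f (v i j) = x i j" "mnorm V n v \<le> mnorm W n x"
      using lift[OF x] by blast
    have mem: "mnorm V n v \<in> ?S" using v by (auto simp: fibre_def mats_def)
    have "Inf ?S = mnorm W n x"
    proof (rule antisym)
      have "Inf ?S \<le> mnorm V n v" by (rule cInf_lower[OF mem bdd_belowI[OF lower]])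
      then show "Inf ?S \<le> mnorm W n x" using v(3) by simp
      show "mnorm W n x \<le> Inf ?S" by (rule cInf_greatest) (use mem lower in blast)+
    qed
    then show ?thesis by (simp add: os_quotient_def)
  qed
qed

lemma matrix_opnorm_cong:
  assumes "\<And>r c. r \<in> R \<Longrightarrow> c \<in> C \<Longrightarrow> M r c = M' r c"
  shows "matrix_opnorm R C M = matrix_opnorm R C M'"
proof -
  have "ell2_norm R (\<lambda>r. \<Sum>\<^sub>\<infinity>c\<in>C. M r c * z c) = ell2_norm R (\<lambda>r. \<Sum>\<^sub>\<infinity>c\<in>C. M' r c * z c)" for z
    unfolding ell2_norm_def using assms by (simp cong: infsum_cong)
  then show ?thesis unfolding matrix_opnorm_def by simp
qed

text \<open>
  Precomposition with \<open>h\<close>.  The isometry assumption includes matrices of size \<open>0\<close>, because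
  these also enter the supremum that defines the norm of the dual.
\<close>

lemma os_dual_iso:
  assumes lin: "linear_map V W h" and bij: "bij_betw h (carr V) (carr W)"
    and iso: "\<And>n v. v \<in> mats V n n \<Longrightarrow> mnorm W n (\<lambda>i j. h (v i j)) = mnorm V n v"
    and W_cong: "\<And>n v w. (\<And>i j. i < n \<Longrightarrow> j < n \<Longrightarrow> v i j = w i j) \<Longrightarrow> mnorm W n v = mnorm W n w"
    and V_add: "\<And>v w. v \<in> carr V \<Longrightarrow> w \<in> carr V \<Longrightarrow> vadd V v w \<in> carr V"
    and V_scale: "\<And>c v. v \<in> carr V \<Longrightarrow> vscale V c v \<in> carr V"
  shows "os_dual W \<cong>\<^sub>c\<^sub>i os_dual V"
proof -
  define \<Phi> where "\<Phi> = (\<lambda>F v. if v \<in> carr V then F (h v) else (0::complex))"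
  define g where "g = inv_into (carr V) h"
  have h: "h v \<in> carr W" if "v \<in> carr V" for v using bij that by (auto simp: bij_betw_def)
  have g: "g w \<in> carr V" "h (g w) = w" if "w \<in> carr W" for w
    using bij that by (auto simp: g_def bij_betw_def inv_into_into f_inv_into_f)
  have gh: "g (h v) = v" if "v \<in> carr V" for v using bij that by (simp add: g_def bij_betw_def)
  have h_add: "h (vadd V v v') = vadd W (h v) (h v')" if "v \<in> carr V" "v' \<in> carr V" for v v'
    using lin that by (simp add: linear_map_def)
  have h_scale: "h (vscale V c v) = vscale W c (h v)" if "v \<in> carr V" for c v
    using lin that by (simp add: linear_map_def)
  have vnorm: "vnorm W (h v) = vnorm V v" if "v \<in> carr V" for v
    unfolding vnorm_def using iso[of "\<lambda>_ _. v" 1] that by (simp add: mats_def)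
  have carr: "F \<in> carr (os_dual X) \<longleftrightarrow> bounded_functional X F \<and> (\<forall>v. v \<notin> carr X \<longrightarrow> F v = 0)"
    for X :: "'x opspace" and F by (simp add: os_dual_def)
  have \<Phi>_carr: "\<Phi> F \<in> carr (os_dual V)" if F: "F \<in> carr (os_dual W)" for F
    unfolding carr
  proof (intro conjI allI impI)
    obtain K where K: "\<forall>w\<in>carr W. cmod (F w) \<le> K * vnorm W w"
      using F unfolding carr bounded_functional_def by blast
    show "bounded_functional V (\<Phi> F)"
      unfolding bounded_functional_def
    proof (intro conjI ballI allI)
      show "\<exists>K. \<forall>v\<in>carr V. cmod (\<Phi> F v) \<le> K * vnorm V v"
        using K h by (intro exI[of _ K]) (auto simp: \<Phi>_def vnorm[symmetric])
    qed (use F in \<open>auto simp: carr bounded_functional_def \<Phi>_def V_add V_scale h_add h_scale h\<close>)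
  qed (simp add: \<Phi>_def)
  have "linear_map (os_dual W) (os_dual V) \<Phi>"
    unfolding linear_map_def by (auto simp: \<Phi>_carr) (auto simp: os_dual_def \<Phi>_def)
  moreover have "bij_betw \<Phi> (carr (os_dual W)) (carr (os_dual V))"
    unfolding bij_betw_def
  proof
    show "inj_on \<Phi> (carr (os_dual W))"
    proof (rule inj_onI, rule ext)
      fix F F' w assume F: "F \<in> carr (os_dual W)" "F' \<in> carr (os_dual W)" and eq: "\<Phi> F = \<Phi> F'"
      show "F w = F' w"
      proof (cases "w \<in> carr W")
        case True
        then show ?thesis using fun_cong[OF eq, of "g w"] g by (simp add: \<Phi>_def)
      qed (use F in \<open>simp add: carr\<close>)
    qed
    show "\<Phi> ` carr (os_dual W) = carr (os_dual V)"
    proof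
      show "\<Phi> ` carr (os_dual W) \<subseteq> carr (os_dual V)" using \<Phi>_carr by auto
      show "carr (os_dual V) \<subseteq> \<Phi> ` carr (os_dual W)"
      proof
        fix G assume G: "G \<in> carr (os_dual V)"
        define F where "F = (\<lambda>w. if w \<in> carr W then G (g w) else 0)"
        have F_h: "F (h v) = G v" if "v \<in> carr V" for v using that by (simp add: F_def h gh)
        obtain K where K: "\<forall>v\<in>carr V. cmod (G v) \<le> K * vnorm V v"
          using G unfolding carr bounded_functional_def by blast
        have "bounded_functional W F"
          unfolding bounded_functional_def
        proof (intro conjI ballI allI)
          fix w assume w: "w \<in> carr W"
          show "F (vadd W w w') = F w + F w'" if w': "w' \<in> carr W" for w'
          proof -
            have "vadd W w w' = h (vadd V (g w) (g w'))" using g w w' by (simp add: h_add)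
            then show ?thesis
              using G g w w' by (simp add: F_h V_add carr bounded_functional_def) (simp add: F_def)
          qed
          show "F (vscale W c w) = c * F w" for c
          proof -
            have "vscale W c w = h (vscale V c (g w))" using g w by (simp add: h_scale)
            then show ?thesis
              using G g w by (simp add: F_h V_scale carr bounded_functional_def) (simp add: F_def)
          qed
        next
          show "\<exists>K. \<forall>w\<in>carr W. cmod (F w) \<le> K * vnorm W w"
          proof (intro exI ballI)
            fix w assume w: "w \<in> carr W"
            show "cmod (F w) \<le> K * vnorm W w"
              using K g[OF w] w vnorm[of "g w"] by (simp add: F_def)
          qed
        qed
        then have "F \<in> carr (os_dual W)" by (simp add: carr F_def)
        moreover have "\<Phi> F = G" using G by (auto simp: \<Phi>_def F_h carr)
        ultimately show "G \<in> \<Phi> ` carr (os_dual W)" by blast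
      qed
    qed
  qed
  moreover have "mnorm (os_dual V) n (\<lambda>i j. \<Phi> (F i j)) = mnorm (os_dual W) n F" for n F
  proof -
    let ?op = "\<lambda>m G v. matrix_opnorm ({..<n} \<times> {..<m}) ({..<n} \<times> {..<m}) (\<lambda>(i, k) (j, l). G i j (v k l))"
    have op: "?op m (\<lambda>i j. \<Phi> (F i j)) v = ?op m F w"
      if "v \<in> mats V m m" "\<And>k l. k < m \<Longrightarrow> l < m \<Longrightarrow> h (v k l) = w k l" for m v w
      using that by (intro matrix_opnorm_cong) (auto simp: \<Phi>_def mats_def)
    have "{?op m (\<lambda>i j. \<Phi> (F i j)) v | m v. v \<in> mats V m m \<and> mnorm V m v \<le> 1}
        = {?op m F w | m w. w \<in> mats W m m \<and> mnorm W m w \<le> 1}" (is "?A = ?B")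
    proof
      show "?A \<subseteq> ?B"
      proof
        fix s assume "s \<in> ?A"
        then obtain m v where s: "s = ?op m (\<lambda>i j. \<Phi> (F i j)) v" and v: "v \<in> mats V m m" "mnorm V m v \<le> 1"
          by blast
        have "s = ?op m F (\<lambda>k l. h (v k l))" unfolding s by (rule op[OF v(1)]) simp
        moreover have "(\<lambda>k l. h (v k l)) \<in> mats W m m" using v(1) h by (simp add: mats_def)
        moreover have "mnorm W m (\<lambda>k l. h (v k l)) \<le> 1" using iso[OF v(1)] v(2) by simp
        ultimately show "s \<in> ?B"
          by (intro CollectI exI[of _ m] exI[of _ "\<lambda>k l. h (v k l)"] conjI)
      qed
      show "?B \<subseteq> ?A"
      proof
        fix s assume "s \<in> ?B"
        then obtain m w where s: "s = ?op m F w" and w: "w \<in> mats W m m" "mnorm W m w \<le> 1"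
          by blast
        have v: "(\<lambda>k l. g (w k l)) \<in> mats V m m" using w(1) g by (simp add: mats_def)
        have hv: "h (g (w k l)) = w k l" if "k < m" "l < m" for k l using w(1) g that by (simp add: mats_def)
        have "s = ?op m (\<lambda>i j. \<Phi> (F i j)) (\<lambda>k l. g (w k l))"
          unfolding s by (rule op[OF v hv, symmetric])
        moreover have "mnorm V m (\<lambda>k l. g (w k l)) \<le> 1"
          using iso[OF v] W_cong[of m "\<lambda>k l. h (g (w k l))" w] hv w(2) by simp
        ultimately show "s \<in> ?A"
          using v by (intro CollectI exI[of _ m] exI[of _ "\<lambda>k l. g (w k l)"] conjI)
      qed
    qed
    then show ?thesis by (simp add: os_dual_def)
  qed
  ultimately show ?thesis
    unfolding completely_isometrically_isomorphic_def completely_isometric_iso_def by blast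
qed

context hilbertian_algebra
begin

text \<open>
  The lifting lemma makes \<open>psi\<close> a complete quotient map, and its kernel is the balancing
  subspace; so \<open>A\<close> is the module Haagerup tensor product, and dualising preserves this.
\<close>

lemma haagerup_dual_iso: "haagerup_dual A pointwise_mult A pointwise_mult \<cong>\<^sub>c\<^sub>i os_dual A"
proof -
  have H_diff: "vadd H P (vsub H R P) = R" if P: "P \<in> carr H" and R: "R \<in> carr H" for P R
  proof -
    note p = T.rep_mem[OF P] and r = T.rep_mem[OF R]
    note sub = T.vsub_H[OF R P r p]
    have "(\<lambda>k b. cauchy_rep P k b + (cauchy_rep R k b - cauchy_rep P k b)) = cauchy_rep R" by simp
    with T.vadd_H[OF P sub(1) p sub(2)] show ?thesis
      using T.carr_H_eqI[OF _ R _ r] by metis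
  qed
  have contr: "mnorm A n x \<le> mnorm H n P"
    if P: "P \<in> mats H n n" and eq: "\<And>i j. i < n \<Longrightarrow> j < n \<Longrightarrow> psi (P i j) = x i j" for n P x
  proof -
    note c = psi_contractive[OF P]
    have x: "x \<in> ell2_mats I n n" using c(1) eq by (simp add: ell2_mats_def)
    show ?thesis using c(2) N_cong[OF c(1), of x] eq mnorm_A[OF x] by simp
  qed
  have lift: "\<exists>P\<in>mats H n n. (\<forall>i<n. \<forall>j<n. psi (P i j) = x i j) \<and> mnorm H n P \<le> mnorm A n x"
    if "x \<in> mats A n n" for n x
    using psi_lift[of x n] that mnorm_A[of x n] by (simp add: mats_A)
  note q = quotient_by_kernel[OF linear_map_psi vadd_A vscale_A balancing_kernel
      T.vadd_H(1)[OF _ _ T.rep_mem T.rep_mem] T.vscale_H(1)[OF _ T.rep_mem] H_diff contr lift]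
  have "os_dual (os_quotient H balancing) \<cong>\<^sub>c\<^sub>i os_dual A"
  proof (rule os_dual_iso[OF q])
    show "mnorm (os_quotient H balancing) n v = mnorm (os_quotient H balancing) n w"
      if "\<And>i j. i < n \<Longrightarrow> j < n \<Longrightarrow> v i j = w i j" for n v w
    proof -
      have "(\<forall>i<n. \<forall>j<n. u i j \<in> v i j) \<longleftrightarrow> (\<forall>i<n. \<forall>j<n. u i j \<in> w i j)" for u
        using that by simp
      then show ?thesis by (simp add: os_quotient_def)
    qed
  qed (auto simp: carr_A vadd_A vscale_A ell2_norm_triangle(1) scale_in_ell2)
  then show ?thesis
    by (simp add: haagerup_dual_def module_haagerup_def haagerup_def)
qed

end

theorem proposition4p4:
  fixes I :: "'i set"
  shows "haagerup_dual (row_ell2 I) pointwise_mult (row_ell2 I) pointwise_mult \<cong>\<^sub>c\<^sub>i os_dual (row_ell2 I)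
       \<and> haagerup_dual (column_ell2 I) pointwise_mult (column_ell2 I) pointwise_mult \<cong>\<^sub>c\<^sub>i os_dual (column_ell2 I)"
  using hilbertian_algebra.haagerup_dual_iso[OF hilbertian_algebra_row]
    hilbertian_algebra.haagerup_dual_iso[OF hilbertian_algebra_column] by blast

end
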